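(* Let $N\ge 2$, let $b^-<b^+$ be real constants, and let $\Omega=\{x\in\mathbb{R}^N : b^-<x_N<b^+\}$. There exists a unique linear operator $$\operatorname{Tr}:\dot{W}^{1,1}(\Omega)\to L^1_{\mathrm{loc}}(\partial\Omega)$$ satisfying the following. (1) $\operatorname{Tr}(u)=u$ on $\partial\Omega$ for all $u\in\dot{W}^{1,1}(\Omega)\cap C^0(\overline\Omega)$. (2) There exists a constant $c=c(N)>0$ such that for every $0<\varepsilon<b^+-b^-$ and every $u\in\dot{W}^{1,1}(\Omega)$, $$\int_{\mathbb{R}^{N-1}}|\operatorname{Tr}(u)(x',b^+)-\operatorname{Tr}(u)(x',b^-)|\,dx'\le\int_\Omega|\partial_Nu(x)|\,dx,$$ $$\sup_{|h'|\le\varepsilon}\int_{\mathbb{R}^{N-1}}|\operatorname{Tr}(u)(x'+h',b^\pm)-\operatorname{Tr}(u)(x',b^\pm)|\,dx'\le c\int_{\Omega_\varepsilon}|\nabla u(x)|\,dx,$$ where $\Omega_\varepsilon:=\mathbb{R}^{N-1}\times\big((b^-,b^-+\varepsilon)\cup(b^+-\varepsilon,b^+)\big)$. In particular, $$\lim_{\varepsilon\to0^+}\sup_{|h'|\le\varepsilon}\int_{\mathbb{R}^{N-1}}|\operatorname{Tr}(u)(x'+h',b^\pm)-\operatorname{Tr}(u)(x',b^\pm)|\,dx'=0.$$ (3) The integration by parts formula $$\int_\Omega u\,\partial_i\psi\,dx=-\int_\Omega\psi\,\partial_iu\,dx+\int_{\partial\Omega}\psi\operatorname{Tr}(u)\,\nu_i\,d\mathcal{H}^{N-1}$$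 holds for all $u\in\dot{W}^{1,1}(\Omega)$, all $\psi\in C^1_c(\mathbb{R}^N)$, and all $i=1,\dots,N$.
   Context: Points are written $x=(x',x_N)\in\mathbb{R}^{N-1}\times\mathbb{R}$. $\dot{W}^{1,1}(\Omega)$ is the space of real-valued $u\in L^1_{\mathrm{loc}}(\Omega)$ whose first-order weak derivatives all belong to $L^1(\Omega)$. $\nu$ is the outward unit normal to $\partial\Omega$ and $\mathcal{H}^{N-1}$ is the $(N-1)$-dimensional Hausdorff measure. The variable $h'$ ranges over $\mathbb{R}^{N-1}$. *)

theory Defs
  imports "HOL-Analysis.Analysis"
begin

fun C_k :: "nat \<Rightarrow> ('a::euclidean_space \<Rightarrow> real) \<Rightarrow> bool" where
  "C_k 0 f \<longleftrightarrow> continuous_on UNIV f"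
| "C_k (Suc k) f \<longleftrightarrow> (\<forall>x. f differentiable (at x)) \<and>
     (\<forall>i\<in>Basis. C_k k (\<lambda>x. frechet_derivative f (at x) i))"

definition C_c :: "nat \<Rightarrow> ('a::euclidean_space \<Rightarrow> real) set" where
  "C_c k = {f. C_k k f \<and> compact (closure {x. f x \<noteq> 0})}"

text \<open>Test functions on \<open>\<Omega>\<close>, extended by zero to the whole space.\<close>

definition test_functions :: "'a::euclidean_space set \<Rightarrow> ('a \<Rightarrow> real) set" where
  "test_functions \<Omega> = {\<phi>. (\<forall>k. C_k k \<phi>) \<and> compact (closure {x. \<phi> x \<noteq> 0}) \<and>
     closure {x. \<phi> x \<noteq> 0} \<subseteq> \<Omega>}"

text \<open>
  Elements of the function spaces below are representatives: total functions whose values off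
  the set \<open>S\<close> are irrelevant, to be identified when they agree almost everywhere on \<open>S\<close>.
\<close>

definition L1_loc :: "'a::euclidean_space measure \<Rightarrow> 'a set \<Rightarrow> ('a \<Rightarrow> real) set" where
  "L1_loc M S = {f. \<forall>K. compact K \<and> K \<subseteq> S \<longrightarrow> set_integrable M K f}"

definition has_weak_partial ::
  "'a::euclidean_space set \<Rightarrow> 'a \<Rightarrow> ('a \<Rightarrow> real) \<Rightarrow> ('a \<Rightarrow> real) \<Rightarrow> bool" where
  "has_weak_partial \<Omega> i u g \<longleftrightarrow> u \<in> L1_loc lebesgue \<Omega> \<and> g \<in> L1_loc lebesgue \<Omega> \<and>
     (\<forall>\<phi>\<in>test_functions \<Omega>.
        (LINT x:\<Omega>|lebesgue. u x * frechet_derivative \<phi> (at x) i) =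
        - (LINT x:\<Omega>|lebesgue. g x * \<phi> x))"

definition has_weak_gradient ::
  "'a::euclidean_space set \<Rightarrow> ('a \<Rightarrow> real) \<Rightarrow> ('a \<Rightarrow> 'a) \<Rightarrow> bool" where
  "has_weak_gradient \<Omega> u G \<longleftrightarrow> (\<forall>i\<in>Basis. has_weak_partial \<Omega> i u (\<lambda>x. G x \<bullet> i))"

definition W11_dot :: "'a::euclidean_space set \<Rightarrow> ('a \<Rightarrow> real) set" where
  "W11_dot \<Omega> = {u. u \<in> L1_loc lebesgue \<Omega> \<and>
     (\<forall>i\<in>Basis. \<exists>g. has_weak_partial \<Omega> i u g \<and> set_integrable lebesgue \<Omega> g)}"

text \<open>
  The usual normalisation, for \<open>s > 0\<close>: covering sets are weighted by
  \<open>\<alpha>(s) (diam E / 2)\<^sup>s\<close> with \<open>\<alpha>(s) = \<pi>\<^bsup>s/2\<^esup> / \<Gamma>(s/2 + 1)\<close>. The covering sets have to be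
  required bounded because \<^const>\<open>diameter\<close> is \<open>0\<close> on unbounded sets.
\<close>

definition hausdorff_pre :: "real \<Rightarrow> real \<Rightarrow> 'a::metric_space set \<Rightarrow> ennreal" where
  "hausdorff_pre s \<delta> A =
     (INF E\<in>{E :: nat \<Rightarrow> 'a set. A \<subseteq> (\<Union>k. E k) \<and> (\<forall>k. bounded (E k) \<and> diameter (E k) \<le> \<delta>)}.
        \<Sum>k. ennreal (unit_ball_vol s * (diameter (E k) / 2) powr s))"

definition hausdorff_outer :: "real \<Rightarrow> 'a::metric_space set \<Rightarrow> ennreal" where
  "hausdorff_outer s A = (SUP \<delta>\<in>{0<..}. hausdorff_pre s \<delta> A)"

text \<open>Completed Borel measure, in analogy with \<^const>\<open>lborel\<close> and \<^term>\<open>lebesgue\<close>.\<close>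

definition hausdorff_measure :: "real \<Rightarrow> 'a::metric_space measure" where
  "hausdorff_measure s = completion (measure_of UNIV (sets borel) (hausdorff_outer s))"

text \<open>
  Near \<open>x\<close> the set is \<open>{\<phi> < 0}\<close> for a \<open>C\<^sup>1\<close> function \<open>\<phi>\<close> with \<open>\<phi>(x) = 0\<close> and \<open>\<nabla>\<phi>(x) \<noteq> 0\<close>;
  the normal is \<open>\<nabla>\<phi>(x) / |\<nabla>\<phi>(x)|\<close>.
\<close>

definition outward_unit_normal :: "'a::euclidean_space set \<Rightarrow> 'a \<Rightarrow> 'a" where
  "outward_unit_normal \<Omega> x = (THE n. \<exists>U \<phi> d. open U \<and> x \<in> U \<and> C_k 1 \<phi> \<and> \<phi> x = 0 \<and>
     (GDERIV \<phi> x :> d) \<and> d \<noteq> 0 \<and> \<Omega> \<inter> U = {y\<in>U. \<phi> y < 0} \<and> n = d /\<^sub>R norm d)"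

text \<open>
  \<open>T\<close>, acting on representatives, induces a linear map from \<open>X\<close> modulo equality almost everywhere
  on \<open>A\<close> to \<open>Y\<close> modulo equality almost everywhere on \<open>B\<close>.
\<close>

definition linear_operator ::
  "'a measure \<Rightarrow> 'a set \<Rightarrow> ('a \<Rightarrow> real) set \<Rightarrow> 'b measure \<Rightarrow> 'b set \<Rightarrow> ('b \<Rightarrow> real) set \<Rightarrow>
     (('a \<Rightarrow> real) \<Rightarrow> ('b \<Rightarrow> real)) \<Rightarrow> bool" where
  "linear_operator M A X M' B Y T \<longleftrightarrow>
     (\<forall>u\<in>X. T u \<in> Y) \<and>
     (\<forall>u\<in>X. \<forall>v\<in>X. (AE x\<in>A in M. u x = v x) \<longrightarrow> (AE y\<in>B in M'. T u y = T v y)) \<and>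
     (\<forall>u\<in>X. \<forall>v\<in>X. AE y\<in>B in M'. T (\<lambda>x. u x + v x) y = T u y + T v y) \<and>
     (\<forall>u\<in>X. \<forall>a. AE y\<in>B in M'. T (\<lambda>x. a * u x) y = a * T u y)"

text \<open>
  Points of \<open>\<real>\<^sup>N\<close> are pairs in \<^typ>\<open>(real^'n) \<times> real\<close>, so that \<open>N - 1 = CARD('n) \<ge> 1\<close> and
  the last basis vector \<open>e\<^sub>N\<close> is \<open>(0, 1)\<close>.
\<close>

definition strip :: "real \<Rightarrow> real \<Rightarrow> ((real^'n) \<times> real) set" where
  "strip bm bp = {x. bm < snd x \<and> snd x < bp}"

definition boundary_layer :: "real \<Rightarrow> real \<Rightarrow> real \<Rightarrow> ((real^'n) \<times> real) set" where
  "boundary_layer bm bp \<epsilon> = UNIV \<times> ({bm<..<bm + \<epsilon>} \<union> {bp - \<epsilon><..<bp})"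

abbreviation surface_measure :: "((real^'n) \<times> real) measure" where
  "surface_measure \<equiv> hausdorff_measure (real CARD('n))"

definition L1_modulus :: "((real^'n) \<times> real \<Rightarrow> real) \<Rightarrow> real \<Rightarrow> real \<Rightarrow> ennreal" where
  "L1_modulus f b \<epsilon> =
     (SUP h\<in>{h. norm h \<le> \<epsilon>}. \<integral>\<^sup>+x. ennreal \<bar>f (x + h, b) - f (x, b)\<bar> \<partial>lebesgue)"

definition trace_of_continuous ::
  "real \<Rightarrow> real \<Rightarrow> (((real^'n) \<times> real \<Rightarrow> real) \<Rightarrow> ((real^'n) \<times> real \<Rightarrow> real)) \<Rightarrow> bool" where
  "trace_of_continuous bm bp Tr \<longleftrightarrow>
     (\<forall>u\<in>W11_dot (strip bm bp). continuous_on (closure (strip bm bp)) u \<longrightarrow>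
        (AE x\<in>frontier (strip bm bp) in surface_measure. Tr u x = u x))"

definition trace_estimates ::
  "real \<Rightarrow> real \<Rightarrow> real \<Rightarrow> (((real^'n) \<times> real \<Rightarrow> real) \<Rightarrow> ((real^'n) \<times> real \<Rightarrow> real)) \<Rightarrow> bool" where
  "trace_estimates c bm bp Tr \<longleftrightarrow>
     (\<forall>\<epsilon> u G. 0 < \<epsilon> \<and> \<epsilon> < bp - bm \<and> u \<in> W11_dot (strip bm bp) \<and>
        has_weak_gradient (strip bm bp) u G \<longrightarrow>
        (\<integral>\<^sup>+x. ennreal \<bar>Tr u (x, bp) - Tr u (x, bm)\<bar> \<partial>lebesgue)
          \<le> (\<integral>\<^sup>+x\<in>strip bm bp. ennreal \<bar>G x \<bullet> (0, 1)\<bar> \<partial>lebesgue) \<and>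
        (\<forall>b\<in>{bm, bp}. L1_modulus (Tr u) b \<epsilon>
          \<le> ennreal c * (\<integral>\<^sup>+x\<in>boundary_layer bm bp \<epsilon>. ennreal (norm (G x)) \<partial>lebesgue)))"

definition trace_L1_continuity ::
  "real \<Rightarrow> real \<Rightarrow> (((real^'n) \<times> real \<Rightarrow> real) \<Rightarrow> ((real^'n) \<times> real \<Rightarrow> real)) \<Rightarrow> bool" where
  "trace_L1_continuity bm bp Tr \<longleftrightarrow>
     (\<forall>u\<in>W11_dot (strip bm bp). \<forall>b\<in>{bm, bp}. (L1_modulus (Tr u) b \<longlongrightarrow> 0) (at_right 0))"

text \<open>
  Integrability of \<open>u \<partial>\<^sub>i\<psi>\<close> up to the boundary is part of the claim: the Bochner integral of a
  non-integrable function is \<open>0\<close>. The other two integrands are integrable because \<open>\<psi>\<close> is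
  bounded with compact support.
\<close>

definition trace_integration_by_parts ::
  "real \<Rightarrow> real \<Rightarrow> (((real^'n) \<times> real \<Rightarrow> real) \<Rightarrow> ((real^'n) \<times> real \<Rightarrow> real)) \<Rightarrow> bool" where
  "trace_integration_by_parts bm bp Tr \<longleftrightarrow>
     (\<forall>u\<in>W11_dot (strip bm bp). \<forall>\<psi>\<in>C_c 1. \<forall>i\<in>Basis. \<forall>g. has_weak_partial (strip bm bp) i u g \<longrightarrow>
        set_integrable lebesgue (strip bm bp) (\<lambda>x. u x * frechet_derivative \<psi> (at x) i) \<and>
        (LINT x:strip bm bp|lebesgue. u x * frechet_derivative \<psi> (at x) i) =
        - (LINT x:strip bm bp|lebesgue. \<psi> x * g x) +
        (LINT x:frontier (strip bm bp)|surface_measure.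
           \<psi> x * Tr u x * (outward_unit_normal (strip bm bp) x \<bullet> i)))"

definition is_trace_operator ::
  "real \<Rightarrow> real \<Rightarrow> real \<Rightarrow> (((real^'n) \<times> real \<Rightarrow> real) \<Rightarrow> ((real^'n) \<times> real \<Rightarrow> real)) \<Rightarrow> bool" where
  "is_trace_operator c bm bp Tr \<longleftrightarrow>
     linear_operator lebesgue (strip bm bp) (W11_dot (strip bm bp))
       surface_measure (frontier (strip bm bp)) (L1_loc surface_measure (frontier (strip bm bp))) Tr \<and>
     trace_of_continuous bm bp Tr \<and>
     trace_estimates c bm bp Tr \<and>
     trace_L1_continuity bm bp Tr \<and>
     trace_integration_by_parts bm bp Tr"

end

theory Submission
  imports Defs
begin

text \<open>
  The constant \<open>c = 3\<close> works. Testing the weak gradient with translates of a test function shows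
  \<open>u(x + h) - u(x) = \<integral>\<^sub>0\<^sup>1 \<nabla>u(x + s h) \<cdot> h ds\<close> for almost every \<open>x\<close>. For vertical \<open>h\<close> it follows, by Fubini
  in \<open>h\<close>, that \<open>u(x', t) = w(x') + \<integral>\<^bsub>b\<^sup>-\<^esub>\<^bsup>t\<^esup> \<partial>\<^sub>Nu(x', s) ds\<close> almost everywhere, and the traces are the values of the
  right-hand side at \<open>t = b\<^sup>\<plusminus>\<close>. The first estimate is then immediate; for the second one, write
  \<open>Tr u(x' + h', b\<^sup>\<plusminus>) - Tr u(x', b\<^sup>\<plusminus>)\<close> as a horizontal difference of \<open>u\<close> at height \<open>t\<close> plus two vertical integrals
  and average over the layer. Integration by parts is Fubini in the vertical direction and a limit of
  difference quotients in the horizontal ones. It determines the trace, which gives uniqueness and linearity.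

  To interpret the boundary integral, \<open>H\<^sup>N\<^sup>-\<^sup>1\<close> has to be identified with Lebesgue measure on the two
  hyperplanes. This needs Caratheodory's criterion, Vitali's covering theorem, and the isodiametric inequality,
  which follows from \<open>|A - A| \<ge> 2\<^sup>n |A|\<close>.
\<close>

section \<open>The isodiametric inequality\<close>

text \<open>Two obstacles shape the proof. The first is the lower bound for
  \<open>hausdorff_outer\<close>: covering sets are arbitrary, so their volume must be compared with
  that of a ball of the same diameter. A set A of diameter d has A - A inside the ball of radius d,
  so 2^n |A| \<le> |A - A| gives exactly the weight (d/2)^n. Caratheodory's criterion matters
  because \<open>measure_of\<close> silently returns the zero measure when its set function is not a
  measure. The second is that u is controlled only on compact subsets of the open strip. The
  function w is read off from interior heights alone, and u = w plus a vertical integral then shows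
  both integrability up to the boundary and what the boundary values are. The constant is 1 + 1 + 1:
  over the layer of thickness \<epsilon> next to one hyperplane, each of the two vertical integrals
  averages to at most the mass of the gradient there, and so does the horizontal difference, because
  |h'| \<le> \<epsilon> cancels the division by \<epsilon>.\<close>

definition nonoverlapping_boxes :: "'a::euclidean_space set set \<Rightarrow> bool" where
  "nonoverlapping_boxes D \<longleftrightarrow> finite D \<and> (\<forall>K\<in>D. (\<exists>a b. K = cbox a b) \<and> 0 < measure lborel K) \<and>
     pairwise (\<lambda>A B. interior A \<inter> interior B = {}) D"

text \<open>Pieces of content zero are thrown away. This keeps every box nondegenerate, and it is
  what makes the number of boxes drop when a box touches \<open>H\<close> only in its
  boundary.\<close>

definition cut :: "'a::euclidean_space set set \<Rightarrow> 'a set \<Rightarrow> 'a set set" where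
  "cut D H = (\<lambda>K. K \<inter> H) ` {K\<in>D. 0 < measure lborel (K \<inter> H)}"

lemma nonoverlapping_boxesE:
  assumes "nonoverlapping_boxes D" "K \<in> D"
  obtains a b where "K = cbox a b" "0 < measure lborel (cbox a b)"
proof -
  obtain a b where "K = cbox a b" using assms unfolding nonoverlapping_boxes_def by blast
  moreover have "0 < measure lborel K" using assms unfolding nonoverlapping_boxes_def by blast
  ultimately show thesis using that by blast
qed

lemma nonoverlapping_boxes_cut:
  fixes D :: "'a::euclidean_space set set"
  assumes D: "nonoverlapping_boxes D" and H: "\<And>a b. \<exists>c d. cbox a b \<inter> H = cbox c d"
  shows "nonoverlapping_boxes (cut D H)"
    and "(\<Sum>K\<in>cut D H. measure lborel K) = (\<Sum>K\<in>D. measure lborel (K \<inter> H))"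
    and "card (cut D H) \<le> card D"
proof -
  have fin: "finite D" and box: "\<And>K. K \<in> D \<Longrightarrow> \<exists>a b. K = cbox a b"
    and dis: "\<And>K L. K \<in> D \<Longrightarrow> L \<in> D \<Longrightarrow> K \<noteq> L \<Longrightarrow> interior K \<inter> interior L = {}"
    using D by (auto simp: nonoverlapping_boxes_def pairwise_def)
  have box': "\<exists>a b. K \<inter> H = cbox a b" if "K \<in> D" for K
    using box[OF that] H by metis
  have int: "interior (K \<inter> H) \<noteq> {}" if "K \<in> D" "0 < measure lborel (K \<inter> H)" for K
    using box'[OF that(1)] that(2) by (metis content_eq_0_interior less_irrefl)
  \<comment> \<open>No two pieces merge in the image: a common piece of positive content would have
    interior points belonging to two different boxes.\<close>
  have inj: "inj_on (\<lambda>K. K \<inter> H) {K\<in>D. 0 < measure lborel (K \<inter> H)}"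
  proof (rule inj_onI)
    fix K L assume K: "K \<in> {K\<in>D. 0 < measure lborel (K \<inter> H)}" and L: "L \<in> {K\<in>D. 0 < measure lborel (K \<inter> H)}"
      and eq: "K \<inter> H = L \<inter> H"
    have "interior (K \<inter> H) \<subseteq> interior K \<inter> interior L"
      by (metis Int_lower1 Int_subset_iff eq interior_mono)
    then show "K = L"
      using int[of K] K L dis[of K L] by blast
  qed
  show "nonoverlapping_boxes (cut D H)"
    unfolding nonoverlapping_boxes_def
  proof (intro conjI ballI)
    show "finite (cut D H)" using fin by (simp add: cut_def)
    show "\<exists>a b. K = cbox a b" if "K \<in> cut D H" for K using that box' by (auto simp: cut_def)
    show "0 < measure lborel K" if "K \<in> cut D H" for K using that by (auto simp: cut_def)
    show "pairwise (\<lambda>A B. interior A \<inter> interior B = {}) (cut D H)"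
      unfolding pairwise_def cut_def using dis by (fastforce simp: interior_Int)
  qed
  have "(\<Sum>K\<in>cut D H. measure lborel K) = (\<Sum>K\<in>{K\<in>D. 0 < measure lborel (K \<inter> H)}. measure lborel (K \<inter> H))"
    unfolding cut_def by (simp add: sum.reindex[OF inj])
  also have "\<dots> = (\<Sum>K\<in>D. measure lborel (K \<inter> H))"
    by (rule sum.mono_neutral_left[OF fin]) (use zero_less_measure_iff in force)+
  finally show "(\<Sum>K\<in>cut D H. measure lborel K) = (\<Sum>K\<in>D. measure lborel (K \<inter> H))" .
  show "card (cut D H) \<le> card D"
    unfolding cut_def using fin
    by (metis (no_types, lifting) card_image_le card_mono finite_subset le_trans mem_Collect_eq subsetI)
qed

lemma card_cut_less:
  assumes "finite D" "K \<in> D" "measure lborel (K \<inter> H) = 0"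
  shows "card (cut D H) < card D"
proof -
  have "card (cut D H) \<le> card {K\<in>D. 0 < measure lborel (K \<inter> H)}"
    unfolding cut_def using assms(1) by (intro card_image_le) auto
  also have "\<dots> < card D"
    using assms by (intro psubset_card_mono) (auto dest!: equalityD2)
  finally show ?thesis .
qed

text \<open>The explicit formula exhibits the volume below the hyperplane as a continuous function
  of \<open>t\<close>, as the intermediate value theorem requires, and as zero once \<open>t\<close>
  is at or below the lower face.\<close>

lemma content_cbox_below:
  fixes a b :: "'a::euclidean_space"
  assumes "i \<in> Basis" "0 < measure lborel (cbox a b)"
  shows "measure lborel (cbox a b \<inter> {x. x \<bullet> i \<le> t}) =
    (\<Prod>j\<in>Basis - {i}. b \<bullet> j - a \<bullet> j) * max 0 (min (b \<bullet> i) t - a \<bullet> i)"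
proof -
  have lt: "\<And>j. j \<in> Basis \<Longrightarrow> a \<bullet> j < b \<bullet> j"
    using assms(2) by (simp add: content_pos_lt_eq)
  define c where "c = (\<Sum>j\<in>Basis. (if j = i then min (b \<bullet> i) t else b \<bullet> j) *\<^sub>R j)"
  have c: "c \<bullet> j = (if j = i then min (b \<bullet> i) t else b \<bullet> j)" if "j \<in> Basis" for j
    using that by (simp add: c_def)
  have "cbox a b \<inter> {x. x \<bullet> i \<le> t} = cbox a c"
    using interval_split(1)[OF assms(1)] by (simp add: c_def)
  moreover have "measure lborel (cbox a c) = (\<Prod>j\<in>Basis - {i}. b \<bullet> j - a \<bullet> j) * max 0 (min (b \<bullet> i) t - a \<bullet> i)"
  proof (cases "a \<bullet> i \<le> min (b \<bullet> i) t")
    case True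
    then have "\<forall>j\<in>Basis. a \<bullet> j \<le> c \<bullet> j" using c lt by (auto intro: less_imp_le)
    then have "measure lborel (cbox a c) = (\<Prod>j\<in>Basis. c \<bullet> j - a \<bullet> j)" by (simp add: content_cbox flip: inner_diff_left)
    also have "\<dots> = (c \<bullet> i - a \<bullet> i) * (\<Prod>j\<in>Basis - {i}. c \<bullet> j - a \<bullet> j)"
      using assms(1) by (simp add: prod.remove)
    also have "(\<Prod>j\<in>Basis - {i}. c \<bullet> j - a \<bullet> j) = (\<Prod>j\<in>Basis - {i}. b \<bullet> j - a \<bullet> j)"
      by (intro prod.cong) (auto simp: c)
    finally show ?thesis using True c assms(1) by (simp add: mult.commute)
  next
    case False
    moreover from this have "\<not> (\<forall>j\<in>Basis. a \<bullet> j \<le> c \<bullet> j)" using c assms(1) by force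
    then have "measure lborel (cbox a c) = 0" using content_eq_0 by force
    ultimately show ?thesis by auto
  qed
  ultimately show ?thesis by simp
qed

text \<open>Base case of the induction: the sum contains a box with sides p_i + q_i, and p_i + q_i
  \<ge> 2 sqrt(p_i q_i). Since the two volumes agree, the product of the right-hand sides is 2^n
  times the volume. Everything is squared to avoid roots.\<close>

lemma content_plus_cbox_ge:
  fixes a b c d :: "'a::euclidean_space"
  assumes "0 < measure lborel (cbox a b)" "measure lborel (cbox a b) = measure lborel (cbox c d)"
  shows "2 ^ DIM('a) * measure lborel (cbox a b) \<le> measure lebesgue {x + y |x y. x \<in> cbox a b \<and> y \<in> cbox c d}"
proof -
  have ab: "\<And>i. i \<in> Basis \<Longrightarrow> a \<bullet> i < b \<bullet> i" and cd: "\<And>i. i \<in> Basis \<Longrightarrow> c \<bullet> i < d \<bullet> i"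
    using assms content_pos_lt_eq by metis+
  have sub: "cbox (a + c) (b + d) \<subseteq> {x + y |x y. x \<in> cbox a b \<and> y \<in> cbox c d}"
  proof
    fix z assume z: "z \<in> cbox (a + c) (b + d)"
    \<comment> \<open>The smallest point of the first box, coordinate by coordinate, for which z - x
      does not exceed \<open>d\<close>.\<close>
    define x where "x = (\<Sum>i\<in>Basis. max (a \<bullet> i) (z \<bullet> i - d \<bullet> i) *\<^sub>R i)"
    have x: "x \<bullet> i = max (a \<bullet> i) (z \<bullet> i - d \<bullet> i)" if "i \<in> Basis" for i
      using that by (simp add: x_def)
    have "x \<in> cbox a b" "z - x \<in> cbox c d"
      using z ab cd by (force simp: mem_box x inner_add_left inner_diff_left max_def)+
    then show "z \<in> {x + y |x y. x \<in> cbox a b \<and> y \<in> cbox c d}"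
      by (intro CollectI exI[of _ x] exI[of _ "z - x"]) simp
  qed
  let ?p = "\<lambda>i. b \<bullet> i - a \<bullet> i" and ?q = "\<lambda>i. d \<bullet> i - c \<bullet> i"
  have "\<And>i. i \<in> Basis \<Longrightarrow> (a + c) \<bullet> i \<le> (b + d) \<bullet> i"
    using ab cd by (simp add: inner_add_left add_mono less_imp_le)
  then have P: "measure lborel (cbox a b) = prod ?p Basis" "measure lborel (cbox c d) = prod ?q Basis"
    "measure lborel (cbox (a + c) (b + d)) = (\<Prod>i\<in>Basis. ?p i + ?q i)"
    using ab cd by (simp_all add: content_cbox less_imp_le inner_add_left algebra_simps)
  have "(2 ^ DIM('a) * measure lborel (cbox a b))\<^sup>2 = (\<Prod>i\<in>Basis. 4 * (?p i * ?q i))"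
    using assms P by (simp add: prod.distrib power2_eq_square flip: power_mult_distrib)
  also have "\<dots> \<le> (\<Prod>i\<in>Basis. (?p i + ?q i)\<^sup>2)"
  proof (intro prod_mono conjI)
    fix i :: 'a assume i: "i \<in> Basis"
    show "0 \<le> 4 * (?p i * ?q i)" using ab[OF i] cd[OF i] by simp
    have "0 \<le> (?p i - ?q i)\<^sup>2" by simp
    then show "4 * (?p i * ?q i) \<le> (?p i + ?q i)\<^sup>2"
      by (simp add: power2_eq_square algebra_simps)
  qed
  also have "\<dots> = (measure lborel (cbox (a + c) (b + d)))\<^sup>2"
    by (simp add: P prod_power_distrib)
  finally have "2 ^ DIM('a) * measure lborel (cbox a b) \<le> measure lborel (cbox (a + c) (b + d))"
    by (rule power2_le_imp_le) simp
  also have "\<dots> \<le> measure lebesgue {x + y |x y. x \<in> cbox a b \<and> y \<in> cbox c d}"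
    using measure_mono_fmeasurable[OF sub, of lebesgue]
      lmeasurable_compact[OF compact_sums[OF compact_cbox[of a b] compact_cbox[of c d]]] by simp
  finally show ?thesis .
qed

text \<open>
  The Hadwiger--Ohmann induction, restricted to equal volumes: cut the first family by a
  hyperplane separating two of its boxes, and the second one by a parallel hyperplane
  that divides the volume in the same way.
\<close>

lemma measure_sum_boxes_ge:
  fixes A B :: "'a::euclidean_space set set"
  assumes "nonoverlapping_boxes A" "nonoverlapping_boxes B"
    and "(\<Sum>K\<in>A. measure lborel K) = (\<Sum>K\<in>B. measure lborel K)"
  shows "2 ^ DIM('a) * (\<Sum>K\<in>A. measure lborel K) \<le> measure lebesgue {x + y |x y. x \<in> \<Union>A \<and> y \<in> \<Union>B}"
  using assms
proof (induction "card A + card B" arbitrary: A B rule: less_induct)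
  case less
  have fin: "finite A" "finite B" using less.prems by (auto simp: nonoverlapping_boxes_def)
  have comp: "compact {x + y |x y. x \<in> \<Union>A \<and> y \<in> \<Union>B}"
    if "nonoverlapping_boxes A" "nonoverlapping_boxes B" for A B :: "'a set set"
    using that by (intro compact_sums compact_Union) (auto simp: nonoverlapping_boxes_def)
  \<comment> \<open>The induction hypothesis is phrased with separate \<open>A'\<close> and
    \<open>B'\<close>, so that the same step serves when the two families exchange roles.\<close>
  have step: "2 ^ DIM('a) * (\<Sum>K\<in>A. measure lborel K) \<le> measure lebesgue {x + y |x y. x \<in> \<Union>A \<and> y \<in> \<Union>B}"
    if K: "cbox a b \<in> A" "cbox c d \<in> A" "i \<in> Basis" "b \<bullet> i \<le> c \<bullet> i"
      and A: "nonoverlapping_boxes A" and B: "nonoverlapping_boxes B"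
      and eq: "(\<Sum>K\<in>A. measure lborel K) = (\<Sum>K\<in>B. measure lborel K)" and card: "card A + card B = card A' + card B'"
      and IH: "\<And>(A::'a set set) (B::'a set set). card A + card B < card A' + card B' \<Longrightarrow> nonoverlapping_boxes A \<Longrightarrow> nonoverlapping_boxes B
        \<Longrightarrow> (\<Sum>K\<in>A. measure lborel K) = (\<Sum>K\<in>B. measure lborel K) \<Longrightarrow>
         2 ^ DIM('a) * (\<Sum>K\<in>A. measure lborel K) \<le> measure lebesgue {x + y |x y. x \<in> \<Union>A \<and> y \<in> \<Union>B}"
    for A B :: "'a set set" and A' B' :: "'a set set" and a b c d :: 'a and i
  proof -
    define lo hi where "lo t = {x. x \<bullet> i \<le> t}" and "hi t = {x. x \<bullet> i \<ge> t}" for t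
    have bx: "\<exists>c d. cbox a b \<inter> lo t = cbox c d" "\<exists>c d. cbox a b \<inter> hi t = cbox c d" for a b t
      using interval_split[OF K(3)] unfolding lo_def hi_def by blast+
    have split: "measure lborel K = measure lborel (K \<inter> lo t) + measure lborel (K \<inter> hi t)" if KAB: "K \<in> A \<union> B" for K t
    proof -
      obtain p q where "K = cbox p q" using KAB A B by (meson Un_iff nonoverlapping_boxes_def)
      then show ?thesis using content_split[OF K(3), of p q t] unfolding lo_def hi_def by simp
    qed
    have finAB: "finite A" "finite B" using A B by (auto simp: nonoverlapping_boxes_def)
    have pos: "0 < measure lborel (cbox a b)" "0 < measure lborel (cbox c d)"
      using A K by (auto simp: nonoverlapping_boxes_def)
    \<comment> \<open>The hyperplane through the upper face of the first box: that box has no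
      content above it, the second one none below it. Each half of \<open>A\<close> therefore has
      fewer boxes than \<open>A\<close>.\<close>
    define s where "s = b \<bullet> i"
    have "cbox a b \<subseteq> lo s" using K(3) by (auto simp: lo_def s_def mem_box)
    then have "measure lborel (cbox a b \<inter> hi s) = 0"
      using split[of "cbox a b" s] K(1) by (simp add: inf.absorb1)
    then have c2: "card (cut A (hi s)) < card A"
      using K(1) finAB card_cut_less by blast
    have "measure lborel (cbox c d \<inter> lo s) = 0"
      using content_cbox_below[OF K(3) pos(2)] K(4) unfolding lo_def s_def by (simp add: max_def)
    then have c1: "card (cut A (lo s)) < card A"
      using K(2) finAB card_cut_less by blast
    \<comment> \<open>Volume of the second family below height \<open>t\<close>. It grows
      continuously from 0 at \<open>-R\<close> to the full volume at \<open>R\<close>, so some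
      \<open>t\<close> makes the two lower halves equal in volume; the upper halves then agree as
      well.\<close>
    define f where "f t = (\<Sum>K\<in>B. measure lborel (K \<inter> lo t))" for t
    have "continuous_on UNIV f"
      unfolding f_def
    proof (intro continuous_on_sum)
      fix K assume "K \<in> B"
      then obtain p q where pq: "K = cbox p q" "0 < measure lborel (cbox p q)" using B by (auto simp: nonoverlapping_boxes_def)
      show "continuous_on UNIV (\<lambda>t. measure lborel (K \<inter> lo t))"
        unfolding pq(1) lo_def content_cbox_below[OF K(3) pq(2)] by (intro continuous_intros)
    qed
    have "bounded (\<Union>B)" using B
      by (intro bounded_Union) (auto simp: nonoverlapping_boxes_def)
    then obtain R where R: "\<And>x. x \<in> \<Union>B \<Longrightarrow> norm x < R" by (metis bounded_pos_less)
    have coord: "\<bar>x \<bullet> i\<bar> < R" if "x \<in> \<Union>B" for x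
      using R[OF that] Basis_le_norm[OF K(3), of x] by simp
    have "f (-R) = 0"
    proof -
      have "K \<inter> lo (-R) = {}" if "K \<in> B" for K using coord that by (force simp: lo_def)
      then show ?thesis by (simp add: f_def)
    qed
    moreover have fR: "f R = (\<Sum>K\<in>B. measure lborel K)"
    proof -
      have "K \<inter> lo R = K" if "K \<in> B" for K using coord that by (force simp: lo_def)
      then show ?thesis by (simp add: f_def)
    qed
    have le: "(\<Sum>K\<in>A. measure lborel (K \<inter> lo s)) \<le> f R"
      unfolding fR eq[symmetric] using split[of _ s] by (intro sum_mono) (metis UnI1 le_add_same_cancel1 measure_nonneg)
    have "-R \<le> R \<or> B = {}"
    proof (cases "B = {}")
      case False
      then obtain L where "L \<in> B" by blast
      moreover from this have "L \<noteq> {}" using B by (auto simp: nonoverlapping_boxes_def)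
      ultimately obtain x where "x \<in> \<Union>B" by blast
      then show ?thesis using coord[of x] by linarith
    qed simp
    moreover have "B \<noteq> {}"
    proof
      assume "B = {}"
      then have "(\<Sum>K\<in>A. measure lborel K) = 0" using eq by simp
      then have "measure lborel (cbox a b) = 0" using finAB K(1) by (simp add: sum_nonneg_eq_0_iff)
      then show False using pos by simp
    qed
    ultimately obtain t where t: "f t = (\<Sum>K\<in>A. measure lborel (K \<inter> lo s))"
      using IVT'[of f "-R" "(\<Sum>K\<in>A. measure lborel (K \<inter> lo s))" R] le sum_nonneg
        \<open>continuous_on UNIV f\<close> by (metis (no_types, lifting) continuous_on_subset measure_nonneg subset_UNIV)
    note A1 = nonoverlapping_boxes_cut[OF A bx(1)[of _ _ s]] and A2 = nonoverlapping_boxes_cut[OF A bx(2)[of _ _ s]]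
      and B1 = nonoverlapping_boxes_cut[OF B bx(1)[of _ _ t]] and B2 = nonoverlapping_boxes_cut[OF B bx(2)[of _ _ t]]
    have sA: "(\<Sum>K\<in>A. measure lborel K) = (\<Sum>K\<in>A. measure lborel (K \<inter> lo s)) + (\<Sum>K\<in>A. measure lborel (K \<inter> hi s))"
      by (simp add: sum.distrib[symmetric] split[of _ s])
    have sB: "(\<Sum>K\<in>B. measure lborel K) = f t + (\<Sum>K\<in>B. measure lborel (K \<inter> hi t))"
      unfolding f_def by (simp add: sum.distrib[symmetric] split[of _ t])
    define S1 S2 S where "S1 = {x + y |x y. x \<in> \<Union>(cut A (lo s)) \<and> y \<in> \<Union>(cut B (lo t))}"
      and "S2 = {x + y |x y. x \<in> \<Union>(cut A (hi s)) \<and> y \<in> \<Union>(cut B (hi t))}"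
      and "S = {x + y |x y. x \<in> \<Union>A \<and> y \<in> \<Union>B}"
    have IH1: "2 ^ DIM('a) * (\<Sum>K\<in>A. measure lborel (K \<inter> lo s)) \<le> measure lebesgue S1"
      using IH[of "cut A (lo s)" "cut B (lo t)"] A1 B1 c1 card t unfolding S1_def f_def by simp
    have IH2: "2 ^ DIM('a) * (\<Sum>K\<in>A. measure lborel (K \<inter> hi s)) \<le> measure lebesgue S2"
      using IH[of "cut A (hi s)" "cut B (hi t)"] A2 B2 c2 card t sA sB eq unfolding S2_def by simp
    have m: "S1 \<in> lmeasurable" "S2 \<in> lmeasurable" "S \<in> lmeasurable"
      unfolding S1_def S2_def S_def using comp A B A1(1) A2(1) B1(1) B2(1) lmeasurable_compact by blast+
    \<comment> \<open>The sums of lower halves and of upper halves lie on opposite sides of one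
      hyperplane, so they overlap in a null set and their measures add.\<close>
    have "x \<bullet> i \<le> s + t" if "x \<in> S1" for x
      using that unfolding S1_def cut_def lo_def by (auto simp: inner_add_left add_mono)
    moreover have "s + t \<le> x \<bullet> i" if "x \<in> S2" for x
      using that unfolding S2_def cut_def hi_def by (auto simp: inner_add_left add_mono)
    ultimately have "S1 \<inter> S2 \<subseteq> {x. i \<bullet> x = s + t}"
      by (force simp: inner_commute[of i])
    then have "negligible (S1 \<inter> S2)"
      using negligible_hyperplane[of i "s + t"] K(3) negligible_subset nonzero_Basis by blast
    then have "measure lebesgue (S1 \<union> S2) = measure lebesgue S1 + measure lebesgue S2"
      using measure_Un3[OF m(1,2)] by (simp add: negligible_imp_measure0)
    moreover have "measure lebesgue (S1 \<union> S2) \<le> measure lebesgue S"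
    proof (rule measure_mono_fmeasurable[OF _ _ m(3)])
      show "S1 \<union> S2 \<subseteq> S" unfolding S1_def S2_def S_def cut_def by blast
      show "S1 \<union> S2 \<in> sets lebesgue" using m by auto
    qed
    ultimately show ?thesis
      using IH1 IH2 unfolding sA S_def[symmetric] by (simp add: distrib_left)
  qed
  \<comment> \<open>Boxes with disjoint interiors are separated in some coordinate
    direction.\<close>
  have two: "\<exists>a b c d i. cbox a b \<in> A \<and> cbox c d \<in> A \<and> i \<in> Basis \<and> b \<bullet> i \<le> c \<bullet> i"
    if A: "nonoverlapping_boxes A" and KA: "K \<in> A" "L \<in> A" "K \<noteq> L" for A :: "'a set set" and K L
  proof -
    obtain a b c d where KL: "K = cbox a b" "L = cbox c d" "0 < measure lborel K" "0 < measure lborel L"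
      using KA by (metis A nonoverlapping_boxesE)
    have "box a b \<inter> box c d = {}"
      using A KA KL unfolding nonoverlapping_boxes_def pairwise_def by (metis interior_cbox)
    then obtain i where "i \<in> Basis" "b \<bullet> i \<le> a \<bullet> i \<or> d \<bullet> i \<le> c \<bullet> i \<or> b \<bullet> i \<le> c \<bullet> i \<or> d \<bullet> i \<le> a \<bullet> i"
      using disjoint_interval(4)[of a b c d] by blast
    moreover have "a \<bullet> i < b \<bullet> i" "c \<bullet> i < d \<bullet> i"
      using KL \<open>i \<in> Basis\<close> content_pos_lt_eq by metis+
    ultimately show ?thesis using KA KL by (metis not_less)
  qed
  have comm: "{x + y |x y. x \<in> \<Union>A \<and> y \<in> \<Union>B} = {x + y |x y. x \<in> \<Union>B \<and> y \<in> \<Union>A}"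
    by (auto simp: add.commute) (metis add.commute UnionI)+
  consider "A = {}" | "B = {}" | K L where "K \<in> A" "L \<in> A" "K \<noteq> L" | K L where "K \<in> B" "L \<in> B" "K \<noteq> L"
    | K L where "A = {K}" "B = {L}"
    by (metis all_not_in_conv insertI1 is_singletonI' is_singleton_the_elem)
  then show ?case
  proof cases
    case 1 then show ?thesis by simp
  next
    case 2 then show ?thesis using less.prems by simp
  next
    case (3 K L)
    from two[OF less.prems(1) this] obtain a b c d i where *:
      "cbox a b \<in> A" "cbox c d \<in> A" "i \<in> Basis" "b \<bullet> i \<le> c \<bullet> i" by blast
    show ?thesis
      by (rule step[OF * less.prems refl]) (rule less.hyps)
  next
    case (4 K L)
    from two[OF less.prems(2) this] obtain a b c d i where *:
      "cbox a b \<in> B" "cbox c d \<in> B" "i \<in> Basis" "b \<bullet> i \<le> c \<bullet> i" by blast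
    have "2 ^ DIM('a) * (\<Sum>K\<in>B. measure lborel K) \<le> measure lebesgue {x + y |x y. x \<in> \<Union>B \<and> y \<in> \<Union>A}"
      by (rule step[OF * less.prems(2,1) less.prems(3)[symmetric] add.commute]) (rule less.hyps)
    then show ?thesis
      using less.prems(3) comm by simp
  next
    case (5 K L)
    obtain a b c d where "K = cbox a b" "L = cbox c d" "0 < measure lborel (cbox a b)"
      using nonoverlapping_boxesE less.prems 5 by (metis insertI1)
    then show ?thesis
      using less.prems(3) 5 content_plus_cbox_ge[of a b c d] by simp
  qed
qed

text \<open>Differences are sums with the reflected family, which consists of boxes of the same
  total volume; this is why equal volumes suffice above.\<close>

lemma measure_differences_boxes_ge:
  fixes D :: "'a::euclidean_space set set"
  assumes D: "nonoverlapping_boxes D"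
  shows "2 ^ DIM('a) * (\<Sum>K\<in>D. measure lborel K) \<le> measure lebesgue {x - y |x y. x \<in> \<Union>D \<and> y \<in> \<Union>D}"
proof -
  have box: "uminus ` cbox a b = cbox (- b) (- a)" for a b :: 'a
  proof -
    have "x \<in> cbox (- b) (- a) \<longleftrightarrow> - x \<in> cbox a b" for x
      by (auto simp: mem_box)
    then have "uminus ` cbox a b \<subseteq> cbox (- b) (- a)" "cbox (- b) (- a) \<subseteq> uminus ` cbox a b"
      by (auto intro: image_eqI[of _ _ "- _"])
    then show ?thesis by blast
  qed
  have meas: "measure lborel (uminus ` K) = measure lborel K" if "K \<in> D" for K
  proof -
    obtain a b where K: "K = cbox a b" "0 < measure lborel (cbox a b)" using \<open>K \<in> D\<close> nonoverlapping_boxesE[OF D] by blast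
    then have "\<forall>i\<in>Basis. a \<bullet> i \<le> b \<bullet> i" using content_pos_lt_eq less_imp_le by metis
    then show ?thesis by (simp add: K(1) box content_cbox_cases)
  qed
  have inj: "inj_on (image uminus) D"
    by (intro inj_onI) (metis inj_image_eq_iff inj_uminus)
  have nb: "nonoverlapping_boxes (image uminus ` D)"
    unfolding nonoverlapping_boxes_def
  proof (intro conjI ballI)
    show "finite (image uminus ` D)" using D by (simp add: nonoverlapping_boxes_def)
    show "\<exists>a b. K = cbox a b" if "K \<in> image uminus ` D" for K
      using that D box by (metis imageE nonoverlapping_boxesE)
    show "0 < measure lborel K" if "K \<in> image uminus ` D" for K
      using that D meas by (auto simp: nonoverlapping_boxes_def)
    show "pairwise (\<lambda>A B. interior A \<inter> interior B = {}) (image uminus ` D)"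
      unfolding pairwise_def
    proof (intro ballI impI)
      fix A B assume "A \<in> image uminus ` D" "B \<in> image uminus ` D" and ne: "A \<noteq> B"
      then obtain K L where KL: "K \<in> D" "L \<in> D" "A = uminus ` K" "B = uminus ` L" by blast
      then have "interior K \<inter> interior L = {}"
        using D ne unfolding nonoverlapping_boxes_def pairwise_def by metis
      then have "uminus ` interior K \<inter> uminus ` interior L = {}"
        by (metis image_Int image_empty inj_uminus)
      then show "interior A \<inter> interior B = {}" by (simp add: KL interior_negations)
    qed
  qed
  have eq: "(\<Sum>K\<in>D. measure lborel K) = (\<Sum>K\<in>image uminus ` D. measure lborel K)"
    by (simp add: sum.reindex[OF inj] meas)
  have "{x + y |x y. x \<in> \<Union>D \<and> y \<in> \<Union>(image uminus ` D)} = {x - y |x y. x \<in> \<Union>D \<and> y \<in> \<Union>D}"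
  proof (intro set_eqI iffI)
    fix z assume "z \<in> {x + y |x y. x \<in> \<Union>D \<and> y \<in> \<Union>(image uminus ` D)}"
    then obtain x y where "z = x + - y" "x \<in> \<Union>D" "y \<in> \<Union>D" by blast
    then show "z \<in> {x - y |x y. x \<in> \<Union>D \<and> y \<in> \<Union>D}" by (metis (mono_tags, lifting) diff_conv_add_uminus mem_Collect_eq)
  next
    fix z assume "z \<in> {x - y |x y. x \<in> \<Union>D \<and> y \<in> \<Union>D}"
    then obtain x y where *: "z = x - y" "x \<in> \<Union>D" "y \<in> \<Union>D" by blast
    then have "z = x + - y" "- y \<in> \<Union>(image uminus ` D)" by auto
    with * show "z \<in> {x + y |x y. x \<in> \<Union>D \<and> y \<in> \<Union>(image uminus ` D)}" by blast
  qed
  then show ?thesis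
    using measure_sum_boxes_ge[OF D nb eq] by simp
qed

text \<open>An open set is filled by countably many nonoverlapping boxes. For finitely many of them
  the difference set lies in the ball of radius \<open>d\<close>, whose volume is 2^n times the
  claimed bound; a limit over finite subfamilies concludes.\<close>

lemma isodiametric_open:
  fixes G :: "'a::euclidean_space set"
  assumes G: "open G" "bounded G" and d: "\<And>x y. x \<in> G \<Longrightarrow> y \<in> G \<Longrightarrow> dist x y \<le> d" "0 \<le> d"
  shows "measure lebesgue G \<le> unit_ball_vol (DIM('a)) * (d / 2) ^ DIM('a)"
proof -
  obtain c where c: "G \<subseteq> cbox (- c) c" "box (- c) c \<noteq> {}"
  proof -
    obtain a where a: "G \<subseteq> cbox (- a) a" using bounded_subset_cbox_symmetric[OF G(2)] by blast
    define c where "c = (\<Sum>i\<in>Basis. (\<bar>a \<bullet> i\<bar> + 1) *\<^sub>R i)"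
    have ci: "c \<bullet> i = \<bar>a \<bullet> i\<bar> + 1" if "i \<in> Basis" for i
      using that by (simp add: c_def)
    have "- \<bar>a \<bullet> i\<bar> \<le> - (a \<bullet> i)" for i by simp
    then have "cbox (- a) a \<subseteq> cbox (- c) c"
      unfolding subset_box using ci by fastforce
    moreover have "box (- c) c \<noteq> {}"
      unfolding box_ne_empty using ci by fastforce
    ultimately have "cbox (- a) a \<subseteq> cbox (- c) c" "box (- c) c \<noteq> {}" .
    then show thesis using a that by blast
  qed
  \<comment> \<open>A gauge equal to \<open>G\<close> at every point of \<open>G\<close> forces each
    box of the covering lemma, whose tag lies in \<open>G\<close>, to be contained in
    \<open>G\<close>.\<close>
  define g where "g x = (if x \<in> G then G else UNIV)" for x
  have "gauge g" using G(1) by (auto simp: gauge_def g_def)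
  then obtain D where D: "countable D" "\<And>K. K \<in> D \<Longrightarrow> interior K \<noteq> {} \<and> (\<exists>c d. K = cbox c d)"
    "pairwise (\<lambda>A B. interior A \<inter> interior B = {}) D"
    "\<And>K. K \<in> D \<Longrightarrow> \<exists>x \<in> G \<inter> K. K \<subseteq> g x" "G \<subseteq> \<Union>D"
    using covering_lemma[OF c, of g] by metis
  have sub: "K \<subseteq> G" if "K \<in> D" for K using D(4)[OF that] by (auto simp: g_def)
  then have eq: "G = \<Union>D" using D(5) by blast
  have lm: "K \<in> lmeasurable" if "K \<in> D" for K using D(2)[OF that] by auto
  have fin: "measure lebesgue (\<Union>F) \<le> unit_ball_vol (DIM('a)) * (d / 2) ^ DIM('a)"
    if F: "F \<subseteq> D" "finite F" for F
  proof -
    from F have nb: "nonoverlapping_boxes F"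
      using D unfolding nonoverlapping_boxes_def
      by (metis (no_types, lifting) content_eq_0_interior pairwise_mono subset_iff zero_less_measure_iff)
    have "dist x y \<le> d" if "x \<in> \<Union>F" "y \<in> \<Union>F" for x y
      using that F sub d(1) by blast
    then have "{x - y |x y. x \<in> \<Union>F \<and> y \<in> \<Union>F} \<subseteq> cball 0 d"
      unfolding dist_norm by (smt (verit, ccfv_threshold) mem_Collect_eq mem_cball_0 subsetI)
    moreover have "compact {x - y |x y. x \<in> \<Union>F \<and> y \<in> \<Union>F}"
      using nb by (intro compact_differences compact_Union) (auto simp: nonoverlapping_boxes_def)
    ultimately have "measure lebesgue {x - y |x y. x \<in> \<Union>F \<and> y \<in> \<Union>F} \<le> measure lebesgue (cball (0::'a) d)"
      by (intro measure_mono_fmeasurable) (auto simp: lmeasurable_compact fmeasurableD)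
    also have "\<dots> = unit_ball_vol (DIM('a)) * d ^ DIM('a)"
      using content_cball[OF d(2)] by simp
    finally have "2 ^ DIM('a) * (\<Sum>K\<in>F. measure lborel K) \<le> unit_ball_vol (DIM('a)) * d ^ DIM('a)"
      using measure_differences_boxes_ge[OF nb] by linarith
    moreover have "measure lebesgue (\<Union>F) \<le> (\<Sum>K\<in>F. measure lborel K)"
    proof -
      have "measure lebesgue (\<Union>F) \<le> (\<Sum>K\<in>F. measure lebesgue K)"
        using measure_Union_le[of F lebesgue] F lm by blast
      also have "\<dots> = (\<Sum>K\<in>F. measure lborel K)"
        using nb by (intro sum.cong) (auto simp: nonoverlapping_boxes_def)
      finally show ?thesis .
    qed
    moreover have "(\<Sum>K\<in>F. measure lborel K) \<le> unit_ball_vol (DIM('a)) * d ^ DIM('a) / 2 ^ DIM('a)"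
      using calculation(1) by (simp add: pos_le_divide_eq mult.commute)
    ultimately show "measure lebesgue (\<Union>F) \<le> unit_ball_vol (DIM('a)) * (d / 2) ^ DIM('a)"
      by (simp add: power_divide)
  qed
  show ?thesis
  proof (rule field_le_epsilon)
    fix e :: real assume "0 < e"
    then obtain F where "F \<subseteq> D" "finite F" "measure lebesgue (\<Union>D) - e < measure lebesgue (\<Union>F)"
      using measure_countable_Union_approachable[OF D(1) _ lm fin] by metis
    moreover from this have "measure lebesgue (\<Union>F) \<le> unit_ball_vol (DIM('a)) * (d / 2) ^ DIM('a)"
      by (intro fin)
    ultimately show "measure lebesgue G \<le> unit_ball_vol (DIM('a)) * (d / 2) ^ DIM('a) + e"
      unfolding eq by linarith
  qed
qed

text \<open>The closure is approximated by its open neighbourhoods of radius \<open>e\<close>, whose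
  diameter is at most that of \<open>E\<close> plus 2e.\<close>

lemma isodiametric:
  fixes E :: "'a::euclidean_space set"
  assumes "bounded E"
  shows "measure lebesgue (closure E) \<le> unit_ball_vol (DIM('a)) * (diameter E / 2) ^ DIM('a)"
proof -
  have d0: "0 \<le> diameter E" using assms by (rule diameter_ge_0)
  have dd: "dist x y \<le> diameter E" if "x \<in> closure E" "y \<in> closure E" for x y
    using diameter_bounded_bound[OF bounded_closure[OF assms] that] assms by (simp add: diameter_closure)
  have le: "measure lebesgue (closure E) \<le> unit_ball_vol (DIM('a)) * ((diameter E + 2 * e) / 2) ^ DIM('a)"
    if e: "0 < e" for e
  proof -
    define G where "G = (\<Union>x\<in>closure E. ball x e)"
    have G: "open G" by (auto simp: G_def)
    have bG: "bounded G"
    proof -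
      obtain B where B: "\<And>x. x \<in> closure E \<Longrightarrow> norm x \<le> B" using bounded_closure[OF assms] by (metis bounded_iff)
      have "norm x \<le> B + e" if "x \<in> G" for x
      proof -
        obtain y where y: "y \<in> closure E" "dist y x < e" using \<open>x \<in> G\<close> unfolding G_def by auto
        have "norm x \<le> norm y + dist y x" by (metis add.commute dist_commute dist_norm norm_triangle_sub)
        with B[OF y(1)] y(2) show ?thesis by linarith
      qed
      then show ?thesis by (metis bounded_iff)
    qed
    have "dist x y \<le> diameter E + 2 * e" if xy: "x \<in> G" "y \<in> G" for x y
    proof -
      obtain p q where pq: "p \<in> closure E" "q \<in> closure E" "dist p x < e" "dist q y < e"
        using xy unfolding G_def by auto
      have "dist x y \<le> dist x p + dist p q + dist q y"
        by (metis add_le_cancel_right dist_triangle dist_triangle_le order.trans)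
      then show ?thesis using pq dd[OF pq(1,2)] by (simp add: dist_commute)
    qed
    then have "measure lebesgue G \<le> unit_ball_vol (DIM('a)) * ((diameter E + 2 * e) / 2) ^ DIM('a)"
      using isodiametric_open[OF G bG, of "diameter E + 2 * e"] d0 e by simp
    moreover have "measure lebesgue (closure E) \<le> measure lebesgue G"
      using e G bG assms by (intro measure_mono_fmeasurable) (auto simp: G_def lmeasurable_open)
    ultimately show ?thesis by linarith
  qed
  have "((\<lambda>e. unit_ball_vol (DIM('a)) * ((diameter E + 2 * e) / 2) ^ DIM('a))
      \<longlongrightarrow> unit_ball_vol (DIM('a)) * ((diameter E + 2 * 0) / 2) ^ DIM('a)) (at_right 0)"
    by (intro tendsto_intros) auto
  moreover have "\<forall>\<^sub>F e in at_right 0. measure lebesgue (closure E)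
      \<le> unit_ball_vol (DIM('a)) * ((diameter E + 2 * e) / 2) ^ DIM('a)"
    using le by (auto simp: eventually_at_right_less intro: eventually_at_rightI[of 0 1])
  ultimately show ?thesis
    using tendsto_lowerbound[of _ _ "at_right (0::real)"] by fastforce
qed

section \<open>Hausdorff measure\<close>

text \<open>The nontrivial half of the axiom of a metric outer measure; the reverse inequality is
  subadditivity.\<close>

definition separately_superadditive :: "('a::metric_space set \<Rightarrow> ennreal) \<Rightarrow> bool" where
  "separately_superadditive f \<longleftrightarrow> (\<forall>A B d. 0 < d \<longrightarrow> (\<forall>x\<in>A. \<forall>y\<in>B. d \<le> dist x y) \<longrightarrow> f A + f B \<le> f (A \<union> B))"

lemma separately_superadditiveD:
  assumes "separately_superadditive f" "0 < d" "\<And>x y. x \<in> A \<Longrightarrow> y \<in> B \<Longrightarrow> d \<le> dist x y"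
  shows "f A + f B \<le> f (A \<union> B)"
  using assms by (auto simp: separately_superadditive_def)

text \<open>Annuli whose indices have equal parity are separated by the annulus between them,
  because the distance to \<open>C\<close> is 1-Lipschitz. Superadditivity can then be applied one
  annulus at a time.\<close>

lemma metric_outer_measure_annuli_le:
  fixes f :: "'a::metric_space set \<Rightarrow> ennreal" and R :: "nat \<Rightarrow> 'a set"
  assumes mono: "mono f"
    and metric: "separately_superadditive f"
    and R: "\<And>j. R j \<subseteq> {x\<in>X. 1 / (real j + 2) \<le> infdist x C \<and> infdist x C < 1 / (real j + 1)}"
  shows "(\<Sum>j<n. f (R (2 * j + p))) \<le> f (X \<inter> (\<Union>j<n. R (2 * j + p)))"
proof (induction n)
  case (Suc n)
  define U where "U = X \<inter> (\<Union>j<n. R (2 * j + p))"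
  show ?case
  proof (cases "n = 0")
    case True
    have "R p \<subseteq> X \<inter> R p" using R by blast
    then have "f (R p) \<le> f (X \<inter> R p)" by (rule monoD[OF mono])
    then show ?thesis using True by (simp add: lessThan_Suc)
  next
    case False
    \<comment> \<open>Earlier annuli of this parity have distance at least 1/(2n+p) from
      \<open>C\<close>, the new one less than 1/(2n+p+1). The case n = 0 is treated apart, since 1/0
      = 0 would spoil the gap for p = 0.\<close>
    define d where "d = 1 / real (2 * n + p) - 1 / (real (2 * n + p) + 1)"
    have "1 / (real (2 * n + p) + 1) < 1 / real (2 * n + p)"
      using False by (intro divide_strict_left_mono mult_pos_pos) auto
    then have d: "0 < d" by (simp add: d_def)
    have "d \<le> dist x y" if x: "x \<in> U" and y: "y \<in> R (2 * n + p)" for x y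
    proof -
      obtain j where j: "j < n" "x \<in> R (2 * j + p)" using x by (auto simp: U_def)
      have "1 / real (2 * n + p) \<le> 1 / (real (2 * j + p) + 2)"
        using j(1) by (intro divide_left_mono mult_pos_pos) auto
      also have "\<dots> \<le> infdist x C" using R[of "2 * j + p"] j(2) by auto
      also have "\<dots> \<le> infdist y C + dist x y" by (rule infdist_triangle)
      also have "infdist y C < 1 / (real (2 * n + p) + 1)" using R[of "2 * n + p"] y by auto
      finally show ?thesis by (simp add: d_def)
    qed
    then have "f U + f (R (2 * n + p)) \<le> f (U \<union> R (2 * n + p))"
      by (rule separately_superadditiveD[OF metric d])
    also have "\<dots> \<le> f (X \<inter> (\<Union>j<Suc n. R (2 * j + p)))"
      using R[of "2 * n + p"] by (intro monoD[OF mono]) (auto simp: U_def lessThan_Suc)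
    finally have "f U + f (R (2 * n + p)) \<le> f (X \<inter> (\<Union>j<Suc n. R (2 * j + p)))" .
    moreover have "(\<Sum>j<Suc n. f (R (2 * j + p))) \<le> f U + f (R (2 * n + p))"
      using Suc.IH unfolding U_def by (simp add: add_right_mono)
    ultimately show ?thesis by (rule order_trans[rotated])
  qed
qed simp

text \<open>Points of X outside \<open>C\<close> at distance at least 1/(k+1) form
  \<open>D k\<close>, which is separated from \<open>C\<close>. What remains of X - C is a tail of
  annuli around \<open>C\<close>, and the measures of the annuli have a finite sum, so the tail is
  negligible in the limit.\<close>

lemma metric_outer_measure_closed:
  fixes f :: "'a::metric_space set \<Rightarrow> ennreal"
  assumes outer: "outer_measure_space UNIV f"
    and metric: "separately_superadditive f"
    and C: "closed C"
  shows "C \<in> lambda_system UNIV UNIV f"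
proof (cases "C = {}")
  case True
  then show ?thesis using outer by (auto simp: outer_measure_space_def positive_def lambda_system_def)
next
  case ne: False
  have f0: "f {} = 0" and mono: "\<And>A B. A \<subseteq> B \<Longrightarrow> f A \<le> f B"
    and csub: "\<And>A::nat \<Rightarrow> 'a set. disjoint_family A \<Longrightarrow> f (\<Union>i. A i) \<le> (\<Sum>i. f (A i))"
    using outer by (auto simp: outer_measure_space_def positive_def increasing_def countably_subadditive_def)
  have sub2: "f (A \<union> B) \<le> f A + f B" if "A \<inter> B = {}" for A B
  proof -
    have "f (\<Union>i. binaryset A B i) \<le> (\<Sum>i. f (binaryset A B i))"
      using that by (intro csub) (auto simp: disjoint_family_on_def binaryset_def)
    then show ?thesis by (simp add: UN_binaryset_eq suminf_binaryset_eq f0)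
  qed
  have key: "f (C \<inter> X) + f (X - C) \<le> f X" for X
  proof (cases "f X = \<infinity>")
    case False
    define D where "D k = {x\<in>X. 1 / (real k + 1) \<le> infdist x C}" for k :: nat
    define R where "R j = {x\<in>X. 1 / (real j + 2) \<le> infdist x C \<and> infdist x C < 1 / (real j + 1)}" for j :: nat
    have "mono f" using mono by (rule monoI)
    have par: "(\<Sum>j. f (R (2 * j + p))) \<le> f X" for p
    proof (rule suminf_le_const[OF summableI])
      show "(\<Sum>j<n. f (R (2 * j + p))) \<le> f X" for n
      proof -
        have "(\<Sum>j<n. f (R (2 * j + p))) \<le> f (X \<inter> (\<Union>j<n. R (2 * j + p)))"
          by (rule metric_outer_measure_annuli_le[OF \<open>mono f\<close> metric, where C=C]) (simp add: R_def)
        also have "\<dots> \<le> f X" by (intro mono) simp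
        finally show ?thesis .
      qed
    qed
    \<comment> \<open>The even and the odd annuli contribute at most \<open>f X\<close>
      each.\<close>
    have tot: "(\<Sum>j. f (R j)) \<le> f X + f X"
    proof (rule suminf_le_const[OF summableI])
      fix n
      have split: "(\<Sum>j<2 * n. f (R j)) = (\<Sum>j<n. f (R (2 * j + 0))) + (\<Sum>j<n. f (R (2 * j + 1)))"
        by (induction n) (simp_all add: algebra_simps)
      have "(\<Sum>j<n. f (R j)) \<le> (\<Sum>j<2 * n. f (R j))" by (intro sum_mono2) auto
      also have "\<dots> \<le> (\<Sum>j. f (R (2 * j + 0))) + (\<Sum>j. f (R (2 * j + 1)))"
        unfolding split by (intro add_mono sum_le_suminf) auto
      also have "\<dots> \<le> f X + f X" by (intro add_mono par)
      finally show "(\<Sum>j<n. f (R j)) \<le> f X + f X" .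
    qed
    have fin: "(\<Sum>j. f (R j)) < \<infinity>"
      using tot False by (metis ennreal_add_eq_top infinity_ennreal_def le_less_trans top.not_eq_extremum)
    have sepD: "f (C \<inter> X) + f (D k) \<le> f X" for k
    proof -
      have "f (C \<inter> X) + f (D k) \<le> f ((C \<inter> X) \<union> D k)"
      proof (rule separately_superadditiveD[OF metric, of "1 / (real k + 1)"])
        fix x y assume "x \<in> C \<inter> X" "y \<in> D k"
        then show "1 / (real k + 1) \<le> dist x y"
          using infdist_le[of x C y] by (simp add: D_def dist_commute)
      qed simp
      also have "\<dots> \<le> f X" by (intro mono) (auto simp: D_def)
      finally show ?thesis .
    qed
    have disR: "disjoint_family (\<lambda>j. R (j + k))" for k
    proof -
      have "R i \<inter> R j = {}" if "i < j" for i j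
      proof -
        have "1 / (real j + 1) \<le> 1 / (real i + 2)"
          using that by (intro divide_left_mono mult_pos_pos) auto
        then show ?thesis by (force simp: R_def)
      qed
      then show ?thesis unfolding disjoint_family_on_def
        by (metis Int_commute add_right_cancel linorder_neqE_nat)
    qed
    have cover: "X - C = D k \<union> (\<Union>j. R (j + k))" for k
    proof (intro equalityI subsetI)
      fix x assume x: "x \<in> X - C"
      then have pos: "0 < infdist x C"
        using infdist_pos_not_in_closed[OF C ne] by simp
      show "x \<in> D k \<union> (\<Union>j. R (j + k))"
      proof (cases "1 / (real k + 1) \<le> infdist x C")
        case True then show ?thesis using x by (simp add: D_def)
      next
        case F: False
        define m where "m = (LEAST m. 1 / (real m + 1) \<le> infdist x C)"
        have ex: "\<exists>m. 1 / (real m + 1) \<le> infdist x C"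
          using nat_approx_posE[OF pos] by (metis add.commute less_imp_le of_nat_Suc)
        have m: "1 / (real m + 1) \<le> infdist x C"
          unfolding m_def using ex by (rule LeastI_ex)
        have km: "k < m"
        proof (rule ccontr)
          assume "\<not> k < m"
          then have "1 / (real k + 1) \<le> 1 / (real m + 1)" by (intro divide_left_mono mult_pos_pos) auto
          with m F show False by linarith
        qed
        then obtain j where j: "m = Suc (j + k)" by (metis add.commute less_imp_Suc_add)
        have "\<not> 1 / (real (j + k) + 1) \<le> infdist x C"
          using not_less_Least[of "j + k" "\<lambda>m. 1 / (real m + 1) \<le> infdist x C"] j by (simp add: m_def)
        then have "x \<in> R (j + k)" using x m j by (simp add: R_def add.commute)
        then show ?thesis by blast
      qed
    next
      fix x assume "x \<in> D k \<union> (\<Union>j. R (j + k))"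
      then have "x \<in> X" "1 / (real k + 1) \<le> infdist x C \<or> (\<exists>j. 1 / (real (j + k) + 2) \<le> infdist x C)"
        by (auto simp: D_def R_def)
      moreover have "0 < 1 / (real k + 1)" "0 < 1 / (real (j + k) + 2)" for j by simp_all
      ultimately have "x \<in> X" "0 < infdist x C" by (metis order_less_le_trans)+
      then show "x \<in> X - C" by auto
    qed
    \<comment> \<open>Instead of subtracting a tail, which is awkward in \<open>ennreal\<close>, the
      first \<open>k\<close> annuli are added on both sides. Letting \<open>k\<close> grow, the full
      sum appears on both sides and cancels because it is finite.\<close>
    have step: "f (C \<inter> X) + f (X - C) + (\<Sum>j<k. f (R j)) \<le> f X + (\<Sum>j. f (R j))" for k
    proof -
      have "f (X - C) \<le> f (D k) + f (\<Union>j. R (j + k))"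
        unfolding cover[of k]
      proof (rule sub2)
        show "D k \<inter> (\<Union>j. R (j + k)) = {}"
        proof -
          have "1 / (real (j + k) + 1) \<le> 1 / (real k + 1)" for j
            by (intro divide_left_mono mult_pos_pos) auto
          then have "x \<notin> R (j + k)" if "x \<in> D k" for x j
            using that unfolding D_def R_def by (smt (verit, best) mem_Collect_eq)
          then show ?thesis by blast
        qed
      qed
      also have "\<dots> \<le> f (D k) + (\<Sum>j. f (R (j + k)))"
        by (intro add_left_mono csub disR)
      finally have "f (C \<inter> X) + f (X - C) + (\<Sum>j<k. f (R j))
          \<le> f (C \<inter> X) + (f (D k) + (\<Sum>j. f (R (j + k)))) + (\<Sum>j<k. f (R j))"
        by (intro add_mono order_refl)
      also have "\<dots> = (f (C \<inter> X) + f (D k)) + (\<Sum>j. f (R j))"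
        by (simp add: suminf_offset[OF summableI, of "\<lambda>j. f (R j)" k] algebra_simps)
      also have "\<dots> \<le> f X + (\<Sum>j. f (R j))"
        by (intro add_mono sepD order_refl)
      finally show ?thesis .
    qed
    have "(\<lambda>k. f (C \<inter> X) + f (X - C) + (\<Sum>j<k. f (R j))) \<longlonglongrightarrow> f (C \<inter> X) + f (X - C) + (\<Sum>j. f (R j))"
      by (intro tendsto_add tendsto_const summable_LIMSEQ summableI)
    then have "f (C \<inter> X) + f (X - C) + (\<Sum>j. f (R j)) \<le> f X + (\<Sum>j. f (R j))"
      using step by (intro LIMSEQ_le_const2) auto
    then show ?thesis
      using fin by (metis add.commute ennreal_add_left_cancel_le infinity_ennreal_def order.strict_iff_order)
  qed (simp add: top_greatest)
  have "f (C \<inter> X) + f ((UNIV - C) \<inter> X) = f X" for X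
  proof (rule antisym)
    have eq: "(UNIV - C) \<inter> X = X - C" by auto
    show "f (C \<inter> X) + f ((UNIV - C) \<inter> X) \<le> f X" unfolding eq by (rule key)
    have "f ((C \<inter> X) \<union> (X - C)) \<le> f (C \<inter> X) + f (X - C)" by (rule sub2) auto
    then show "f X \<le> f (C \<inter> X) + f ((UNIV - C) \<inter> X)"
      unfolding eq by (simp add: Int_commute[of C] Int_Diff_Un)
  qed
  then show ?thesis by (simp add: lambda_system_def)
qed

lemma metric_outer_measure_borel:
  fixes f :: "'a::metric_space set \<Rightarrow> ennreal"
  assumes outer: "outer_measure_space UNIV f"
    and metric: "separately_superadditive f"
  shows "measure_space UNIV (sets borel) f"
proof -
  interpret sigma_algebra "UNIV :: 'a set" UNIV
    by (metis Pow_UNIV sigma_algebra_Pow)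
  have ms: "measure_space UNIV (lambda_system UNIV UNIV f) f"
    by (rule caratheodory_lemma[OF outer])
  then interpret L: sigma_algebra UNIV "lambda_system UNIV UNIV f"
    by (simp add: measure_space_def)
  have "sets (borel :: 'a measure) \<subseteq> lambda_system UNIV UNIV f"
  proof -
    have "sets (borel :: 'a measure) = sigma_sets UNIV {S. closed S}"
      by (simp add: borel_eq_closed)
    also have "\<dots> \<subseteq> lambda_system UNIV UNIV f"
      using metric_outer_measure_closed[OF outer metric] by (intro L.sigma_sets_subset) blast
    finally show ?thesis .
  qed
  then show ?thesis
    using ms sets.sigma_algebra_axioms[of "borel :: 'a measure"]
    by (auto simp: measure_space_def positive_def countably_additive_def)
qed

section \<open>Hausdorff premeasures and outer measure\<close>

lemma hausdorff_pre_mono: "A \<subseteq> B \<Longrightarrow> hausdorff_pre s \<delta> A \<le> hausdorff_pre s \<delta> B"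
  unfolding hausdorff_pre_def by (rule INF_superset_mono) auto

lemma hausdorff_pre_antimono: "\<delta>' \<le> \<delta> \<Longrightarrow> hausdorff_pre s \<delta> A \<le> hausdorff_pre s \<delta>' A"
  unfolding hausdorff_pre_def by (rule INF_superset_mono) (auto intro: order_trans)

lemma hausdorff_pre_le:
  assumes "A \<subseteq> (\<Union>k. E k)" "\<And>k. bounded (E k)" "\<And>k. diameter (E k) \<le> \<delta>"
  shows "hausdorff_pre s \<delta> A \<le> (\<Sum>k. ennreal (unit_ball_vol s * (diameter (E k) / 2) powr s))"
  unfolding hausdorff_pre_def using assms by (intro INF_lower) auto

lemma hausdorff_pre_empty:
  assumes "0 \<le> \<delta>"
  shows "hausdorff_pre s \<delta> ({} :: 'a::metric_space set) = 0"
proof -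
  have "hausdorff_pre s \<delta> ({} :: 'a set) \<le> (\<Sum>k::nat. ennreal (unit_ball_vol s * (diameter ({} :: 'a set) / 2) powr s))"
    using assms by (intro hausdorff_pre_le[where E = "\<lambda>_. {}"]) auto
  then show ?thesis by simp
qed

lemma hausdorff_pre_countably_subadditive:
  "hausdorff_pre s \<delta> (\<Union>i::nat. A i) \<le> (\<Sum>i. hausdorff_pre s \<delta> (A i))"
proof (rule ennreal_le_epsilon)
  fix e :: real assume fin: "(\<Sum>i. hausdorff_pre s \<delta> (A i)) < top" and e: "0 < e"
  define w where "w E = ennreal (unit_ball_vol s * (diameter E / 2) powr s)" for E :: "'a set"
  have "\<exists>E. A i \<subseteq> (\<Union>k. E k) \<and> (\<forall>k. bounded (E k) \<and> diameter (E k) \<le> \<delta>) \<and>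
      (\<Sum>k. w (E k)) \<le> hausdorff_pre s \<delta> (A i) + ennreal (e * (1/2) ^ Suc i)" for i
  proof -
    have "hausdorff_pre s \<delta> (A i) < top"
      using fin by (rule ennreal_suminf_lessD)
    then have "hausdorff_pre s \<delta> (A i) < hausdorff_pre s \<delta> (A i) + ennreal (e * (1/2) ^ Suc i)"
      using e by (cases "hausdorff_pre s \<delta> (A i)") (auto simp: ennreal_less_iff simp flip: ennreal_plus)
    then show ?thesis
      unfolding hausdorff_pre_def INF_less_iff w_def by (metis (mono_tags, lifting) less_imp_le mem_Collect_eq)
  qed
  then obtain E where E: "\<And>i. A i \<subseteq> (\<Union>k. E i k)" "\<And>i k. bounded (E i k)" "\<And>i k. diameter (E i k) \<le> \<delta>"
    "\<And>i. (\<Sum>k. w (E i k)) \<le> hausdorff_pre s \<delta> (A i) + ennreal (e * (1/2) ^ Suc i)"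
    by metis
  have "hausdorff_pre s \<delta> (\<Union>i. A i) \<le> (\<Sum>n. w (case_prod E (prod_decode n)))"
    unfolding w_def
  proof (rule hausdorff_pre_le)
    show "(\<Union>i. A i) \<subseteq> (\<Union>n. case_prod E (prod_decode n))"
    proof
      fix x assume "x \<in> (\<Union>i. A i)"
      then obtain i k where "x \<in> E i k" using E(1) by blast
      then have "x \<in> case_prod E (prod_decode (prod_encode (i, k)))" by simp
      then show "x \<in> (\<Union>n. case_prod E (prod_decode n))" by (rule UN_I[OF UNIV_I])
    qed
  qed (auto simp: E split: prod.split)
  also have "\<dots> = (\<Sum>i. \<Sum>k. w (E i k))"
    by (subst suminf_ennreal_2dimen[of "\<lambda>i. \<Sum>k. w (E i k)" "\<lambda>p. w (case_prod E p)"]) auto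
  also have "\<dots> \<le> (\<Sum>i. hausdorff_pre s \<delta> (A i) + ennreal (e * (1/2) ^ Suc i))"
    by (intro suminf_le E(4) summableI)
  also have "\<dots> = (\<Sum>i. hausdorff_pre s \<delta> (A i)) + (\<Sum>i. ennreal (e * (1/2) ^ Suc i))"
    by (intro suminf_add[symmetric] summableI)
  also have "(\<Sum>i. ennreal (e * (1/2) ^ Suc i)) = ennreal e"
    using sums_mult[OF power_half_series, of e] e by (intro suminf_ennreal_eq) auto
  finally show "hausdorff_pre s \<delta> (\<Union>i. A i) \<le> (\<Sum>i. hausdorff_pre s \<delta> (A i)) + ennreal e" .
qed

text \<open>A set of diameter at most \<delta> < d cannot meet both \<open>A\<close> and
  \<open>B\<close>, so every admissible cover of the union splits into a cover of each.\<close>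

lemma hausdorff_pre_separated:
  assumes d: "\<delta> < d" "0 \<le> \<delta>" and sep: "\<And>x y. x \<in> A \<Longrightarrow> y \<in> B \<Longrightarrow> d \<le> dist x y"
  shows "hausdorff_pre s \<delta> A + hausdorff_pre s \<delta> B \<le> hausdorff_pre s \<delta> (A \<union> B)"
  unfolding hausdorff_pre_def[of s \<delta> "A \<union> B"]
proof (rule INF_greatest)
  fix E :: "nat \<Rightarrow> 'a set" assume "E \<in> {E. A \<union> B \<subseteq> (\<Union>k. E k) \<and> (\<forall>k. bounded (E k) \<and> diameter (E k) \<le> \<delta>)}"
  then have E: "A \<union> B \<subseteq> (\<Union>k. E k)" "\<And>k. bounded (E k)" "\<And>k. diameter (E k) \<le> \<delta>" by auto
  define w where "w E = ennreal (unit_ball_vol s * (diameter E / 2) powr s)" for E :: "'a set"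
  \<comment> \<open>Discarded sets are replaced by the empty set, whose weight is 0 because
    \<open>0 powr s\<close> is 0.\<close>
  define F G where "F k = (if E k \<inter> A \<noteq> {} then E k else {})"
    and "G k = (if E k \<inter> A \<noteq> {} then {} else E k)" for k
  have "hausdorff_pre s \<delta> A \<le> (\<Sum>k. w (F k))"
    unfolding w_def
  proof (rule hausdorff_pre_le)
    show "A \<subseteq> (\<Union>k. F k)" using E(1) by (fastforce simp: F_def)
  qed (use E d in \<open>auto simp: F_def\<close>)
  moreover have "hausdorff_pre s \<delta> B \<le> (\<Sum>k. w (G k))"
    unfolding w_def
  proof (rule hausdorff_pre_le)
    show "B \<subseteq> (\<Union>k. G k)"
    proof
      fix y assume y: "y \<in> B"
      then obtain k where k: "y \<in> E k" using E(1) by blast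
      have "E k \<inter> A = {}"
      proof (rule ccontr)
        assume "E k \<inter> A \<noteq> {}"
        then obtain x where x: "x \<in> E k" "x \<in> A" by blast
        then show False
          using sep[OF x(2) y] diameter_bounded_bound[OF E(2) x(1) k] E(3)[of k] d(1) by linarith
      qed
      then show "y \<in> (\<Union>k. G k)" using k by (auto simp: G_def)
    qed
  qed (use E d in \<open>auto simp: G_def\<close>)
  ultimately have "hausdorff_pre s \<delta> A + hausdorff_pre s \<delta> B \<le> (\<Sum>k. w (F k)) + (\<Sum>k. w (G k))"
    by (rule add_mono)
  also have "\<dots> = (\<Sum>k. w (F k) + w (G k))" by (intro suminf_add summableI)
  also have "\<dots> = (\<Sum>k. w (E k))" by (intro suminf_cong) (simp add: F_def G_def w_def)
  finally show "hausdorff_pre s \<delta> A + hausdorff_pre s \<delta> B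
      \<le> (\<Sum>k. ennreal (unit_ball_vol s * (diameter (E k) / 2) powr s))"
    by (simp add: w_def)
qed

lemma hausdorff_pre_le_outer: "0 < \<delta> \<Longrightarrow> hausdorff_pre s \<delta> A \<le> hausdorff_outer s A"
  unfolding hausdorff_outer_def by (rule SUP_upper) simp

lemma hausdorff_outer_mono: "A \<subseteq> B \<Longrightarrow> hausdorff_outer s A \<le> hausdorff_outer s B"
  unfolding hausdorff_outer_def by (intro SUP_mono' hausdorff_pre_mono)

lemma outer_measure_space_hausdorff: "outer_measure_space UNIV (hausdorff_outer s)"
  unfolding outer_measure_space_def positive_def increasing_def countably_subadditive_def
proof (intro conjI ballI allI impI)
  show "hausdorff_outer s {} = 0"
    by (simp add: hausdorff_outer_def hausdorff_pre_empty)
  show "hausdorff_outer s A \<le> hausdorff_outer s B" if "A \<subseteq> B" for A B :: "'a set"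
    using that by (rule hausdorff_outer_mono)
  fix A :: "nat \<Rightarrow> 'a set"
  show "hausdorff_outer s (\<Union>i. A i) \<le> (\<Sum>i. hausdorff_outer s (A i))"
    unfolding hausdorff_outer_def[of s "\<Union>i. A i"]
  proof (rule SUP_least)
    fix \<delta> :: real assume "\<delta> \<in> {0<..}"
    then have "(\<Sum>i. hausdorff_pre s \<delta> (A i)) \<le> (\<Sum>i. hausdorff_outer s (A i))"
      by (intro suminf_le hausdorff_pre_le_outer summableI) auto
    then show "hausdorff_pre s \<delta> (\<Union>i. A i) \<le> (\<Sum>i. hausdorff_outer s (A i))"
      using hausdorff_pre_countably_subadditive order_trans by blast
  qed
qed

text \<open>The premeasures increase as \<delta> decreases, so only \<delta> below \<open>d\<close>
  matter, and the two suprema can be taken along a common \<delta>.\<close>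

lemma hausdorff_outer_separated:
  assumes d: "0 < d" and sep: "\<And>x y. x \<in> A \<Longrightarrow> y \<in> B \<Longrightarrow> d \<le> dist x y"
  shows "hausdorff_outer s A + hausdorff_outer s B \<le> hausdorff_outer s (A \<union> B)"
proof -
  have "hausdorff_outer s A + hausdorff_outer s B = (SUP \<delta>\<in>{0<..}. hausdorff_pre s \<delta> A + hausdorff_pre s \<delta> B)"
    unfolding hausdorff_outer_def
  proof (rule SUP_add_directed_ennreal[symmetric])
    fix \<delta> \<delta>' :: real assume "\<delta> \<in> {0<..}" "\<delta>' \<in> {0<..}"
    then show "\<exists>k\<in>{0<..}. hausdorff_pre s \<delta> A + hausdorff_pre s \<delta>' B \<le> hausdorff_pre s k A + hausdorff_pre s k B"
      by (intro bexI[of _ "min \<delta> \<delta>'"] add_mono hausdorff_pre_antimono) auto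
  qed
  also have "\<dots> \<le> hausdorff_outer s (A \<union> B)"
  proof (rule SUP_least)
    fix \<delta> :: real assume \<delta>: "\<delta> \<in> {0<..}"
    have "hausdorff_pre s \<delta> A + hausdorff_pre s \<delta> B
        \<le> hausdorff_pre s (min \<delta> (d/2)) A + hausdorff_pre s (min \<delta> (d/2)) B"
      by (intro add_mono hausdorff_pre_antimono) auto
    also have "\<dots> \<le> hausdorff_pre s (min \<delta> (d/2)) (A \<union> B)"
      using d \<delta> by (intro hausdorff_pre_separated[of _ d] sep) auto
    also have "\<dots> \<le> hausdorff_outer s (A \<union> B)"
      using d \<delta> by (intro hausdorff_pre_le_outer) auto
    finally show "hausdorff_pre s \<delta> A + hausdorff_pre s \<delta> B \<le> hausdorff_outer s (A \<union> B)" .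
  qed
  finally show ?thesis .
qed

definition borel_hausdorff :: "real \<Rightarrow> 'a::metric_space measure" where
  "borel_hausdorff s = measure_of UNIV (sets borel) (hausdorff_outer s)"

lemma sets_borel_hausdorff [simp, measurable_cong]:
  "sets (borel_hausdorff s :: 'a::metric_space measure) = sets borel"
  using sets.sigma_sets_eq[of "borel :: 'a measure"] by (simp add: borel_hausdorff_def)

text \<open>\<open>measure_of\<close> keeps the given set function only if it is a measure on the
  generated sigma-algebra, and is zero otherwise; Caratheodory's criterion supplies exactly
  this.\<close>

lemma emeasure_borel_hausdorff:
  fixes A :: "'a::metric_space set"
  assumes "A \<in> sets borel"
  shows "emeasure (borel_hausdorff s) A = hausdorff_outer s A"
proof -
  have "separately_superadditive (hausdorff_outer s :: 'a set \<Rightarrow> ennreal)"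
    unfolding separately_superadditive_def by (meson hausdorff_outer_separated)
  then have "measure_space UNIV (sets (borel :: 'a measure)) (hausdorff_outer s)"
    by (rule metric_outer_measure_borel[OF outer_measure_space_hausdorff])
  then show ?thesis
    using assms unfolding borel_hausdorff_def
    by (intro emeasure_measure_of_sigma) (auto simp: measure_space_def)
qed

lemma hausdorff_measure_eq: "hausdorff_measure s = completion (borel_hausdorff s)"
  by (simp add: hausdorff_measure_def borel_hausdorff_def)

section \<open>Smooth functions and the fundamental lemma\<close>

lemma C_k_SucI:
  assumes "\<And>x. (f has_derivative D x) (at x)" "\<And>i. i \<in> Basis \<Longrightarrow> C_k k (\<lambda>x. D x i)"
  shows "C_k (Suc k) f"
proof -
  have "frechet_derivative f (at x) = D x" for x
    using frechet_derivative_at[OF assms(1)] by simp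
  then show ?thesis using assms by (auto simp: differentiable_def)
qed

lemma C_k_SucD:
  assumes "C_k (Suc k) f"
  shows "(f has_derivative frechet_derivative f (at x)) (at x)"
    and "i \<in> Basis \<Longrightarrow> C_k k (\<lambda>x. frechet_derivative f (at x) i)"
  using assms frechet_derivative_works by auto

lemma C_k_imp_continuous: "C_k k f \<Longrightarrow> continuous_on UNIV f"
  by (cases k) (auto simp: differentiable_imp_continuous_within continuous_at_imp_continuous_on)

lemma C_k_Suc_imp: "C_k (Suc k) f \<Longrightarrow> C_k k f"
proof (induction k arbitrary: f)
  case 0
  then show ?case using C_k_imp_continuous[of 1 f] by simp
next
  case (Suc k)
  show ?case
    by (rule C_k_SucI[OF C_k_SucD(1)[OF Suc.prems]]) (rule Suc.IH[OF C_k_SucD(2)[OF Suc.prems]])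
qed

lemma C_k_const: "C_k k (\<lambda>_. c)"
proof (induction k arbitrary: c)
  case (Suc k)
  then show ?case by (intro C_k_SucI[of _ "\<lambda>_ _. 0"]) auto
qed simp

lemma C_k_add: "C_k k f \<Longrightarrow> C_k k g \<Longrightarrow> C_k k (\<lambda>x. f x + g x)"
proof (induction k arbitrary: f g)
  case (Suc k)
  show ?case
    by (rule C_k_SucI[OF has_derivative_add[OF C_k_SucD(1)[OF Suc.prems(1)] C_k_SucD(1)[OF Suc.prems(2)]]])
       (intro Suc.IH C_k_SucD(2)[OF Suc.prems(1)] C_k_SucD(2)[OF Suc.prems(2)])
qed (auto intro: continuous_intros)

lemma C_k_mult: "C_k k f \<Longrightarrow> C_k k g \<Longrightarrow> C_k k (\<lambda>x. f x * g x)"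
proof (induction k arbitrary: f g)
  case (Suc k)
  show ?case
    by (rule C_k_SucI[OF has_derivative_mult[OF C_k_SucD(1)[OF Suc.prems(1)] C_k_SucD(1)[OF Suc.prems(2)]]])
       (intro C_k_add Suc.IH C_k_SucD(2)[OF Suc.prems(1)] C_k_SucD(2)[OF Suc.prems(2)]
          C_k_Suc_imp[OF Suc.prems(1)] C_k_Suc_imp[OF Suc.prems(2)])
qed (auto intro: continuous_intros)

lemma C_k_sum: "finite I \<Longrightarrow> (\<And>i. i \<in> I \<Longrightarrow> C_k k (f i)) \<Longrightarrow> C_k k (\<lambda>x. \<Sum>i\<in>I. f i x)"
  by (induction I rule: finite_induct) (auto intro: C_k_const C_k_add)

lemma C_k_prod: "finite I \<Longrightarrow> (\<And>i. i \<in> I \<Longrightarrow> C_k k (f i)) \<Longrightarrow> C_k k (\<lambda>x. \<Prod>i\<in>I. f i x)"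
  by (induction I rule: finite_induct) (auto intro: C_k_const C_k_mult)

text \<open>The chain rule produces the derivative of \<open>f\<close> in direction
  \<open>L i\<close>. Expanding \<open>L i\<close> in the basis reduces it to partial derivatives,
  to which the induction hypothesis applies.\<close>

lemma C_k_affine:
  fixes f :: "'b::euclidean_space \<Rightarrow> real" and L :: "'a::euclidean_space \<Rightarrow> 'b"
  assumes L: "bounded_linear L"
  shows "C_k k f \<Longrightarrow> C_k k (\<lambda>x. f (L x + a))"
proof (induction k arbitrary: f)
  case 0
  then have "continuous_on UNIV f" by simp
  then have "continuous_on UNIV (\<lambda>x. f (L x + a))"
    by (rule continuous_on_compose2) (intro continuous_intros linear_continuous_on L subset_UNIV)+
  then show ?case by simp
next
  case (Suc k)
  have D: "((\<lambda>x. f (L x + a)) has_derivative (\<lambda>h. frechet_derivative f (at (L x + a)) (L h))) (at x)" for x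
  proof -
    have "((\<lambda>x. L x + a) has_derivative L) (at x)"
      by (rule has_derivative_eq_rhs[OF has_derivative_add[OF bounded_linear_imp_has_derivative[OF L] has_derivative_const]]) simp
    then show ?thesis
      by (rule has_derivative_compose[OF _ C_k_SucD(1)[OF Suc.prems]])
  qed
  have E: "frechet_derivative f (at (L x + a)) (L i) =
      (\<Sum>j\<in>Basis. (L i \<bullet> j) * frechet_derivative f (at (L x + a)) j)" for x i
  proof -
    have "bounded_linear (frechet_derivative f (at (L x + a)))"
      using C_k_SucD(1)[OF Suc.prems] by (rule has_derivative_bounded_linear)
    then interpret bounded_linear "frechet_derivative f (at (L x + a))" .
    have "frechet_derivative f (at (L x + a)) (L i) =
        frechet_derivative f (at (L x + a)) (\<Sum>j\<in>Basis. (L i \<bullet> j) *\<^sub>R j)"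
      by (simp add: euclidean_representation)
    then show ?thesis by (simp add: sum scaleR)
  qed
  show ?case
  proof (rule C_k_SucI[OF D])
    fix i :: 'a
    show "C_k k (\<lambda>x. frechet_derivative f (at (L x + a)) (L i))"
      unfolding E by (intro C_k_sum C_k_mult C_k_const Suc.IH C_k_SucD(2)[OF Suc.prems]) auto
  qed
qed

lemma C_k_linear:
  fixes L :: "'a::euclidean_space \<Rightarrow> real"
  assumes "bounded_linear L"
  shows "C_k k (\<lambda>x. L x + c)"
proof (cases k)
  case 0
  then show ?thesis using bounded_linear.continuous_on[OF assms continuous_on_id] by (auto intro!: continuous_intros)
next
  case (Suc l)
  have "((\<lambda>x. L x + c) has_derivative L) (at x)" for x
    by (rule has_derivative_eq_rhs[OF has_derivative_add[OF bounded_linear_imp_has_derivative[OF assms] has_derivative_const]]) simp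
  then show ?thesis unfolding Suc by (rule C_k_SucI) (rule C_k_const)
qed

text \<open>A whole class closed under differentiation is treated at once: the derivative of a
  composition contains \<open>h'\<close>, which is again in the class, so the induction on
  \<open>k\<close> can vary \<open>h\<close>.\<close>

lemma C_k_compose_real:
  fixes h :: "real \<Rightarrow> real" and S :: "(real \<Rightarrow> real) set"
  assumes S: "\<And>h. h \<in> S \<Longrightarrow> \<exists>h'\<in>S. \<forall>x. (h has_real_derivative h' x) (at x)"
  shows "h \<in> S \<Longrightarrow> C_k k f \<Longrightarrow> C_k k (\<lambda>x. h (f x))"
proof (induction k arbitrary: h)
  case 0
  obtain h' where "\<forall>x. (h has_real_derivative h' x) (at x)" using S[OF 0(1)] by blast
  then have "continuous_on UNIV h" by (meson DERIV_isCont continuous_at_imp_continuous_on)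
  then show ?case using 0(2) continuous_on_compose2[of UNIV h UNIV f] by simp
next
  case (Suc k)
  obtain h' where h': "h' \<in> S" "\<And>x. (h has_real_derivative h' x) (at x)" using S[OF Suc.prems(1)] by blast
  show ?case
  proof (rule C_k_SucI[where D = "\<lambda>x i. frechet_derivative f (at x) i * h' (f x)"])
    show "((\<lambda>x. h (f x)) has_derivative (\<lambda>i. frechet_derivative f (at x) i * h' (f x))) (at x)" for x
      by (rule DERIV_compose_FDERIV[OF h'(2) C_k_SucD(1)[OF Suc.prems(2)]])
    have "C_k k (\<lambda>x. h' (f x))" by (rule Suc.IH[OF h'(1) C_k_Suc_imp[OF Suc.prems(2)]])
    then show "C_k k (\<lambda>x. frechet_derivative f (at x) i * h' (f x))" if "i \<in> Basis" for i
      using C_k_mult[OF C_k_SucD(2)[OF Suc.prems(2) that]] by blast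
  qed
qed

text \<open>The class of functions \<open>p(1/x) exp(-1/x)\<close>, extended by zero, is closed under differentiation.\<close>

definition flat_exp :: "real poly \<Rightarrow> real \<Rightarrow> real" where
  "flat_exp p x = (if 0 < x then poly p (1 / x) * exp (- 1 / x) else 0)"

text \<open>The free power of \<open>y\<close> absorbs the degree shift when a coefficient is split
  off the polynomial.\<close>

lemma poly_exp_minus_tendsto: "((\<lambda>y::real. y ^ k * (poly p y * exp (- y))) \<longlongrightarrow> 0) at_top"
proof (induction p arbitrary: k)
  case (pCons a p)
  have "((\<lambda>y::real. a * (y ^ k / exp y) + y ^ Suc k * (poly p y * exp (- y))) \<longlongrightarrow> a * 0 + 0) at_top"
    by (intro tendsto_intros tendsto_power_div_exp_0 pCons.IH)
  then show ?case by (simp add: algebra_simps exp_minus divide_inverse)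
qed simp

text \<open>With y = 1/x, differentiation multiplies by y^2 and turns p into p - p'. At 0 the right
  difference quotient equals y p(y) exp(-y) and tends to 0 as y tends to infinity.\<close>

lemma flat_exp_has_derivative:
  "(flat_exp p has_real_derivative flat_exp ([:0, 0, 1:] * (p - pderiv p)) x) (at x)"
proof -
  consider "0 < x" | "x < 0" | "x = 0" by linarith
  then show ?thesis
  proof cases
    case 1
    have "((\<lambda>x. 1 / x) has_real_derivative - (1 / x\<^sup>2)) (at x)"
      using 1 by (auto intro!: derivative_eq_intros simp: power2_eq_square)
    then have P: "((\<lambda>x. poly p (1 / x)) has_real_derivative poly (pderiv p) (1 / x) * - (1 / x\<^sup>2)) (at x)"
      by (rule DERIV_chain2[OF poly_DERIV])
    have Q: "((\<lambda>x. exp (- 1 / x)) has_real_derivative exp (- 1 / x) * (1 / x\<^sup>2)) (at x)"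
      using 1 by (auto intro!: derivative_eq_intros simp: power2_eq_square)
    have "((\<lambda>x. poly p (1 / x) * exp (- 1 / x)) has_real_derivative
        poly ([:0, 0, 1:] * (p - pderiv p)) (1 / x) * exp (- 1 / x)) (at x)"
      by (rule DERIV_cong[OF DERIV_mult[OF P Q]]) (simp add: power2_eq_square algebra_simps)
    then have "((\<lambda>x. poly p (1 / x) * exp (- 1 / x)) has_real_derivative
        flat_exp ([:0, 0, 1:] * (p - pderiv p)) x) (at x)"
      using 1 by (simp only: flat_exp_def if_True)
    then show ?thesis
      by (rule has_field_derivative_transform_within_open[where S = "{0<..}"]) (use 1 in \<open>auto simp: flat_exp_def\<close>)
  next
    case 2
    have "((\<lambda>x. 0) has_real_derivative flat_exp ([:0, 0, 1:] * (p - pderiv p)) x) (at x)"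
      using 2 by (simp add: flat_exp_def)
    then show ?thesis
      by (rule has_field_derivative_transform_within_open[where S = "{..<0}"]) (use 2 in \<open>auto simp: flat_exp_def\<close>)
  next
    case 3
    have "((\<lambda>y. (flat_exp p y - flat_exp p 0) / (y - 0)) \<longlongrightarrow> 0) (at 0)"
    proof (rule filterlim_split_at)
      show "((\<lambda>y. (flat_exp p y - flat_exp p 0) / (y - 0)) \<longlongrightarrow> 0) (at_left 0)"
        by (rule tendsto_eventually) (auto simp: eventually_at_left_field flat_exp_def intro!: exI[of _ "-1"])
      have "\<forall>\<^sub>F y::real in at_top. y ^ 1 * (poly p y * exp (- y)) =
          (flat_exp p (inverse y) - flat_exp p 0) / (inverse y - 0)"
        using eventually_gt_at_top[of 0]
        by eventually_elim (simp add: flat_exp_def field_simps)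
      then show "((\<lambda>y. (flat_exp p y - flat_exp p 0) / (y - 0)) \<longlongrightarrow> 0) (at_right 0)"
        unfolding filterlim_at_right_to_top using poly_exp_minus_tendsto[of 1 p]
        by (rule Lim_transform_eventually[rotated])
    qed
    then show ?thesis
      using 3 by (simp add: has_field_derivative_iff flat_exp_def)
  qed
qed

section \<open>Smooth bumps approximating indicators of boxes\<close>

text \<open>Not itself constant beyond 0; the step arises by scaling the argument, since
  exp(-1/(kx)) tends to 1 for every x > 0. Pointwise convergence and the bound 1 are all that
  dominated convergence asks for.\<close>

definition smooth_step :: "real \<Rightarrow> real" where
  "smooth_step = flat_exp 1"

lemma smooth_step_eq: "smooth_step x = (if 0 < x then exp (- 1 / x) else 0)"
  by (simp add: smooth_step_def flat_exp_def)

lemma C_k_smooth_step: "C_k k f \<Longrightarrow> C_k k (\<lambda>x. smooth_step (f x))"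
  unfolding smooth_step_def
  by (rule C_k_compose_real[of "range flat_exp"]) (use flat_exp_has_derivative in auto)

lemma smooth_step_bounds: "0 \<le> smooth_step x" "smooth_step x \<le> 1"
  by (auto simp: smooth_step_eq)

lemma smooth_step_tendsto: "(\<lambda>k. smooth_step (real k * x)) \<longlonglongrightarrow> (if 0 < x then 1 else 0)"
proof (cases "0 < x")
  case True
  have "(\<lambda>k. exp (- (inverse x * inverse (real k)))) \<longlonglongrightarrow> exp (- (inverse x * 0))"
    by (intro tendsto_intros LIMSEQ_inverse_real_of_nat[THEN LIMSEQ_imp_Suc] lim_inverse_n)
  moreover have "\<forall>\<^sub>F k in sequentially. exp (- (inverse x * inverse (real k))) = smooth_step (real k * x)"
    using eventually_gt_at_top[of 0] by eventually_elim (use True in \<open>auto simp: smooth_step_eq field_simps\<close>)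
  ultimately show ?thesis using True by (auto intro: Lim_transform_eventually)
next
  case False
  then have "smooth_step (real k * x) = 0" for k
    by (simp add: smooth_step_eq not_less mult_nonneg_nonpos)
  then show ?thesis using False by simp
qed

definition box_bump :: "'a::euclidean_space \<Rightarrow> 'a \<Rightarrow> nat \<Rightarrow> 'a \<Rightarrow> real" where
  "box_bump a b k x = (\<Prod>i\<in>Basis. smooth_step (real k * (x \<bullet> i - a \<bullet> i)) * smooth_step (real k * (b \<bullet> i - x \<bullet> i)))"

lemma C_k_box_bump: "C_k l (box_bump a b k)"
proof -
  have 1: "C_k l (\<lambda>x. real k * (x \<bullet> i - a \<bullet> i))" for i :: 'a
    using C_k_linear[of "\<lambda>x. real k * (x \<bullet> i)" l "- (real k * (a \<bullet> i))"]
    by (simp add: algebra_simps bounded_linear_intros)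
  have 2: "C_k l (\<lambda>x. real k * (b \<bullet> i - x \<bullet> i))" for i :: 'a
    using C_k_linear[OF bounded_linear_inner_left, of l "- (real k *\<^sub>R i)" "real k * (b \<bullet> i)"]
    by (simp add: algebra_simps)
  have "box_bump a b k = (\<lambda>x. \<Prod>i\<in>Basis. smooth_step (real k * (x \<bullet> i - a \<bullet> i)) * smooth_step (real k * (b \<bullet> i - x \<bullet> i)))"
    by (simp add: box_bump_def fun_eq_iff)
  then show ?thesis
    by (simp only:) (intro C_k_prod C_k_mult C_k_smooth_step 1 2 finite_Basis)
qed

lemma box_bump_bounds: "0 \<le> box_bump a b k x" "box_bump a b k x \<le> 1"
  unfolding box_bump_def by (auto intro!: prod_nonneg prod_le_1 mult_nonneg_nonneg mult_le_one smooth_step_bounds)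

lemma box_bump_eq_0: "x \<notin> box a b \<Longrightarrow> box_bump a b k x = 0"
  unfolding box_bump_def
proof (rule prod_zero)
  assume "x \<notin> box a b"
  then obtain i where i: "i \<in> Basis" "x \<bullet> i \<le> a \<bullet> i \<or> b \<bullet> i \<le> x \<bullet> i" by (auto simp: mem_box not_less)
  then show "\<exists>i\<in>Basis. smooth_step (real k * (x \<bullet> i - a \<bullet> i)) * smooth_step (real k * (b \<bullet> i - x \<bullet> i)) = 0"
    by (intro bexI[of _ i]) (auto simp: smooth_step_eq zero_less_mult_iff)
qed simp

lemma box_bump_tendsto: "(\<lambda>k. box_bump a b k x) \<longlonglongrightarrow> indicator (box a b) x"
proof -
  have "(\<lambda>k. box_bump a b k x) \<longlonglongrightarrow>
      (\<Prod>i\<in>Basis. (if 0 < x \<bullet> i - a \<bullet> i then 1 else 0) * (if 0 < b \<bullet> i - x \<bullet> i then 1 else 0))"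
    unfolding box_bump_def by (intro tendsto_prod tendsto_mult smooth_step_tendsto)
  also have "(\<Prod>i\<in>Basis. (if 0 < x \<bullet> i - a \<bullet> i then 1 else 0) * (if 0 < b \<bullet> i - x \<bullet> i then 1 else 0)) =
      (indicator (box a b) x :: real)"
  proof (cases "x \<in> box a b")
    case True
    then show ?thesis by (auto simp: mem_box intro!: prod.neutral)
  next
    case False
    then obtain i where "i \<in> Basis" "x \<bullet> i \<le> a \<bullet> i \<or> b \<bullet> i \<le> x \<bullet> i" by (auto simp: mem_box not_less)
    then have "\<exists>i\<in>Basis. (if 0 < x \<bullet> i - a \<bullet> i then 1 else 0) * (if 0 < b \<bullet> i - x \<bullet> i then 1 else 0) = (0::real)"
      by (intro bexI[of _ i]) auto
    then show ?thesis using False by (simp add: prod_zero)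
  qed
  finally show ?thesis .
qed

lemma closure_support_box_bump: "closure {x. box_bump a b k x \<noteq> 0} \<subseteq> cbox a b"
proof (rule closure_minimal)
  show "{x. box_bump a b k x \<noteq> 0} \<subseteq> cbox a b"
    using box_bump_eq_0 box_subset_cbox by blast
qed (rule closed_cbox)

lemma box_bump_test_function:
  assumes "cbox a b \<subseteq> \<Omega>"
  shows "box_bump a b k \<in> test_functions \<Omega>"
  unfolding test_functions_def
proof (intro CollectI conjI allI)
  show "closure {x. box_bump a b k x \<noteq> 0} \<subseteq> \<Omega>"
    using assms closure_support_box_bump by blast
  then show "compact (closure {x. box_bump a b k x \<noteq> 0})"
    using closure_support_box_bump by (metis bounded_cbox bounded_subset closed_closure compact_eq_bounded_closed)
qed (rule C_k_box_bump)

section \<open>The fundamental lemma of the calculus of variations\<close>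

text \<open>The positive and negative parts of \<open>F\<close> are densities of two finite
  measures. These agree on open boxes, an intersection-stable generator of the Borel sets, hence
  everywhere.\<close>

lemma integral_boxes_zero_imp_AE_zero:
  fixes F :: "'a::euclidean_space \<Rightarrow> real"
  assumes F: "integrable lborel F" and 0: "\<And>a b. (\<integral>x. indicator (box a b) x * F x \<partial>lborel) = 0"
  shows "AE x in lborel. F x = 0"
proof -
  have [measurable]: "F \<in> borel_measurable borel" using F by simp
  let ?P = "\<lambda>x. ennreal (F x)" and ?N = "\<lambda>x. ennreal (- F x)"
  have fin: "(\<integral>\<^sup>+x. ?P x \<partial>lborel) \<noteq> \<infinity>" "(\<integral>\<^sup>+x. ?N x \<partial>lborel) \<noteq> \<infinity>"
    using F by (auto simp: real_integrable_def)
  have eq: "(\<integral>\<^sup>+x. ?P x * indicator (box a b) x \<partial>lborel) = (\<integral>\<^sup>+x. ?N x * indicator (box a b) x \<partial>lborel)" for a b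
  proof -
    let ?g = "\<lambda>x. indicator (box a b) x * F x"
    have gi: "integrable lborel ?g"
      using F by (rule Bochner_Integration.integrable_bound) (auto simp: indicator_def)
    have P: "(\<integral>\<^sup>+x. ennreal (?g x) \<partial>lborel) = (\<integral>\<^sup>+x. ?P x * indicator (box a b) x \<partial>lborel)"
      and N: "(\<integral>\<^sup>+x. ennreal (- ?g x) \<partial>lborel) = (\<integral>\<^sup>+x. ?N x * indicator (box a b) x \<partial>lborel)"
      by (auto intro!: nn_integral_cong simp: indicator_def)
    have f: "(\<integral>\<^sup>+x. ennreal (?g x) \<partial>lborel) \<noteq> \<infinity>" "(\<integral>\<^sup>+x. ennreal (- ?g x) \<partial>lborel) \<noteq> \<infinity>"
      using gi by (auto simp: real_integrable_def)
    have "enn2real (\<integral>\<^sup>+x. ennreal (?g x) \<partial>lborel) = enn2real (\<integral>\<^sup>+x. ennreal (- ?g x) \<partial>lborel)"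
      using 0[of a b] real_lebesgue_integral_def[OF gi] by simp
    moreover have "p = q" if "enn2real p = enn2real q" "p \<noteq> \<infinity>" "q \<noteq> \<infinity>" for p q
      using that by (cases p; cases q) auto
    ultimately show ?thesis
      unfolding P[symmetric] N[symmetric] using f by blast
  qed
  have "density lborel ?P = density lborel ?N"
  proof (rule measure_eqI_generator_eq)
    let ?E = "range (\<lambda>(a, b). box a b::'a set)"
    show "Int_stable ?E"
      by (auto simp: Int_stable_def box_Int_box)
    show "?E \<subseteq> Pow UNIV" "sets (density lborel ?P) = sigma_sets UNIV ?E" "sets (density lborel ?N) = sigma_sets UNIV ?E"
      by (simp_all add: borel_eq_box)
    let ?A = "\<lambda>n::nat. box (- (real n *\<^sub>R One)) (real n *\<^sub>R One) :: 'a set"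
    show "range ?A \<subseteq> ?E" "(\<Union>i. ?A i) = UNIV"
      unfolding UN_box_eq_UNIV by auto
    show "emeasure (density lborel ?P) (?A i) \<noteq> \<infinity>" for i
    proof -
      have "emeasure (density lborel ?P) (?A i) \<le> (\<integral>\<^sup>+x. ?P x \<partial>lborel)"
        by (subst emeasure_density) (auto intro!: nn_integral_mono simp: indicator_def)
      then show ?thesis using fin(1) by (metis infinity_ennreal_def neq_top_trans)
    qed
    show "emeasure (density lborel ?P) X = emeasure (density lborel ?N) X" if "X \<in> ?E" for X
      using that eq by (auto simp: emeasure_density)
  qed
  \<comment> \<open>\<open>ennreal\<close> truncates negative numbers to 0, so the two values can
    only agree where \<open>F\<close> vanishes.\<close>
  then have "AE x in lborel. ?P x = ?N x"
    by (subst (asm) finite_density_unique) (use fin in auto)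
  then show ?thesis
    by eventually_elim (metis ennreal_eq_0_iff ennreal_neg less_eq_real_def linorder_not_le neg_0_less_iff_less neg_le_0_iff_le)
qed

text \<open>On a closed box inside the domain, bumps converge to indicators of smaller boxes, so a
  Borel representative has vanishing integral over each of them. Countably many closed boxes exhaust
  the open domain.\<close>

lemma fundamental_lemma_calculus_of_variations:
  fixes f :: "'a::euclidean_space \<Rightarrow> real"
  assumes \<Omega>: "open \<Omega>" and f: "f \<in> L1_loc lebesgue \<Omega>"
    and 0: "\<And>\<phi>. \<phi> \<in> test_functions \<Omega> \<Longrightarrow> (LINT x:\<Omega>|lebesgue. f x * \<phi> x) = 0"
  shows "AE x in lebesgue. x \<in> \<Omega> \<longrightarrow> f x = 0"
proof -
  have cb: "AE x in lebesgue. x \<in> cbox c d \<longrightarrow> f x = 0" if sub: "cbox c d \<subseteq> \<Omega>" for c d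
  proof -
    have int: "integrable lebesgue (\<lambda>x. indicator (box c d) x * f x)"
    proof -
      have "set_integrable lebesgue (cbox c d) f" using f sub by (auto simp: L1_loc_def)
      then have "set_integrable lebesgue (box c d) f"
        by (rule set_integrable_subset) (auto simp: box_subset_cbox)
      then show ?thesis by (simp add: set_integrable_def)
    qed
    then obtain F where F: "F \<in> borel_measurable lborel" "AE x in lborel. indicator (box c d) x * f x = F x"
      using completion_ex_borel_measurable_real[of _ lborel] by (blast dest: borel_measurable_integrable)
    have F': "AE x in lebesgue. indicator (box c d) x * f x = F x" using F(2) by (rule AE_completion)
    have Fm: "F \<in> borel_measurable lebesgue" using F(1) by (rule measurable_completion)
    have Fi: "integrable lborel F"
      using int integrable_cong_AE[OF borel_measurable_integrable[OF int] Fm F'] F(1)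
      by (simp add: integrable_completion)
    have z: "(\<integral>x. indicator (box a b) x * F x \<partial>lborel) = 0" if ab: "cbox a b \<subseteq> cbox c d" for a b
    proof -
      have "(\<integral>x. box_bump a b k x * F x \<partial>lborel) = 0" for k
      proof -
        have [measurable]: "box_bump a b k \<in> borel_measurable borel"
          by (intro borel_measurable_continuous_onI C_k_imp_continuous[OF C_k_box_bump[of 0]])
        have "box a b \<subseteq> box c d" using ab by (metis interior_cbox interior_mono)
        then have b0: "box_bump a b k x = 0" if "x \<notin> box c d" for x using that box_bump_eq_0 by blast
        have "(\<integral>x. box_bump a b k x * F x \<partial>lborel) = (\<integral>x. box_bump a b k x * F x \<partial>lebesgue)"
          using F(1) by (subst integral_completion) auto
        also have "\<dots> = (\<integral>x. box_bump a b k x * (indicator (box c d) x * f x) \<partial>lebesgue)"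
        proof (rule integral_cong_AE)
          have bm: "box_bump a b k \<in> borel_measurable lebesgue" by (intro measurable_completion) simp
          show "(\<lambda>x. box_bump a b k x * F x) \<in> borel_measurable lebesgue"
            by (rule borel_measurable_times[OF bm Fm])
          show "(\<lambda>x. box_bump a b k x * (indicator (box c d) x * f x)) \<in> borel_measurable lebesgue"
            by (rule borel_measurable_times[OF bm borel_measurable_integrable[OF int]])
          show "AE x in lebesgue. box_bump a b k x * F x = box_bump a b k x * (indicator (box c d) x * f x)"
            using F' by eventually_elim simp
        qed
        also have "\<dots> = (LINT x:\<Omega>|lebesgue. f x * box_bump a b k x)"
          unfolding set_lebesgue_integral_def
        proof (rule Bochner_Integration.integral_cong[OF refl])
          fix x
          show "box_bump a b k x * (indicator (box c d) x * f x) = indicator \<Omega> x *\<^sub>R (f x * box_bump a b k x)"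
            using b0[of x] sub box_subset_cbox[of c d] by (cases "x \<in> box c d") (auto simp: indicator_def)
        qed
        also have "\<dots> = 0"
          using ab sub by (intro 0 box_bump_test_function) auto
        finally show ?thesis .
      qed
      moreover have "(\<lambda>k. \<integral>x. box_bump a b k x * F x \<partial>lborel) \<longlonglongrightarrow> (\<integral>x. indicator (box a b) x * F x \<partial>lborel)"
      proof (rule integral_dominated_convergence[where w = "\<lambda>x. \<bar>F x\<bar>"])
        have "box_bump a b k \<in> borel_measurable borel" for k
          by (intro borel_measurable_continuous_onI C_k_imp_continuous[OF C_k_box_bump[of 0]])
        then show "(\<lambda>x. box_bump a b k x * F x) \<in> borel_measurable lborel" for k using F(1) by auto
        show "(\<lambda>x. indicator (box a b) x * F x) \<in> borel_measurable lborel" using F(1) by auto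
        show "integrable lborel (\<lambda>x. \<bar>F x\<bar>)" using Fi by simp
        show "AE x in lborel. (\<lambda>k. box_bump a b k x * F x) \<longlonglongrightarrow> indicator (box a b) x * F x"
          by (intro AE_I2 tendsto_mult box_bump_tendsto tendsto_const)
        show "AE x in lborel. norm (box_bump a b k x * F x) \<le> \<bar>F x\<bar>" for k
          using box_bump_bounds[of a b k] by (intro AE_I2) (simp add: abs_mult mult_left_le_one_le)
      qed
      ultimately show ?thesis by (simp add: LIMSEQ_unique)
    qed
    have "AE x in lborel. F x = 0"
    proof (rule integral_boxes_zero_imp_AE_zero[OF Fi])
      fix a b
      \<comment> \<open>An arbitrary box may be replaced by its intersection with
        \<open>box c d\<close>, since \<open>F\<close> vanishes almost everywhere outside the
        latter.\<close>
      define p where "p = (\<Sum>i\<in>Basis. max (a\<bullet>i) (c\<bullet>i) *\<^sub>R i)"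
      define q where "q = (\<Sum>i\<in>Basis. min (b\<bullet>i) (d\<bullet>i) *\<^sub>R i)"
      have pq: "box a b \<inter> box c d = box p q" unfolding p_def q_def by (rule box_Int_box)
      have "cbox p q \<subseteq> cbox c d" unfolding p_def q_def by (auto simp: mem_box)
      then have "(\<integral>x. indicator (box p q) x * F x \<partial>lborel) = 0" by (rule z)
      moreover have "(\<integral>x. indicator (box a b) x * F x \<partial>lborel) = (\<integral>x. indicator (box p q) x * F x \<partial>lborel)"
      proof (rule integral_cong_AE)
        show "AE x in lborel. indicator (box a b) x * F x = indicator (box p q) x * F x"
          using F(2) unfolding pq[symmetric] by eventually_elim (auto simp: indicator_def split: if_splits)
      qed (use F(1) in auto)
      ultimately show "(\<integral>x. indicator (box a b) x * F x \<partial>lborel) = 0" by simp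
    qed
    then have "AE x in lebesgue. F x = 0" by (rule AE_completion)
    moreover have "AE x in lebesgue. x \<notin> cbox c d - box c d"
    proof (rule AE_not_in)
      show "cbox c d - box c d \<in> null_sets lebesgue"
        using negligible_frontier_interval[of c d] by (simp add: negligible_iff_null_sets)
    qed
    ultimately show ?thesis using F'
      by eventually_elim (auto simp: indicator_def split: if_splits)
  qed
  obtain D where D: "countable D" "D \<subseteq> Pow \<Omega>" "\<And>X. X \<in> D \<Longrightarrow> \<exists>a b. X = cbox a b" "\<Union>D = \<Omega>"
    using open_countable_Union_open_cbox[OF \<Omega>] by metis
  have "AE x in lebesgue. \<forall>X\<in>D. x \<in> X \<longrightarrow> f x = 0"
    unfolding AE_ball_countable[OF D(1)]
  proof
    fix X assume X: "X \<in> D"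
    then obtain c d where "X = cbox c d" using D(3) by blast
    then show "AE x in lebesgue. x \<in> X \<longrightarrow> f x = 0" using cb D(2) X by auto
  qed
  then show ?thesis by eventually_elim (use D(4) in auto)
qed

section \<open>Hausdorff measure on horizontal hyperplanes\<close>

lemma diameter_le_image:
  assumes "bounded S" "\<And>x y. x \<in> T \<Longrightarrow> y \<in> T \<Longrightarrow> \<exists>x'\<in>S. \<exists>y'\<in>S. dist x y \<le> dist x' y'"
  shows "diameter (T :: 'b::real_normed_vector set) \<le> diameter (S :: 'c::metric_space set)"
proof (rule diameter_le)
  show "T \<noteq> {} \<or> 0 \<le> diameter S" using diameter_ge_0[OF assms(1)] by simp
  show "norm (x - y) \<le> diameter S" if "x \<in> T" "y \<in> T" for x y
    using assms(2)[OF that] diameter_bounded_bound[OF assms(1)] unfolding dist_norm[symmetric] by fastforce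
qed

lemma hausdorff_pre_Un:
  "hausdorff_pre s \<delta> (A \<union> B) \<le> hausdorff_pre s \<delta> A + hausdorff_pre s \<delta> B" if "0 \<le> \<delta>"
  using hausdorff_pre_countably_subadditive[of s \<delta> "binaryset A B"] that
  by (simp add: UN_binaryset_eq suminf_binaryset_eq hausdorff_pre_empty)

text \<open>A ball of radius c r in the hyperplane has Hausdorff weight at most c^n times the volume
  of the ball of radius r; the latter balls are disjoint and lie in \<open>U\<close>. The factor c
  is 5 for the covering lemma and 1 for the covering theorem of Vitali.\<close>

lemma hausdorff_pre_balls_le:
  fixes a :: "'i \<Rightarrow> 'a::euclidean_space"
  assumes C: "countable C" and dis: "pairwise (\<lambda>i j. disjnt (cball (a i) (r i)) (cball (a j) (r j))) C"
    and r: "\<And>i. i \<in> C \<Longrightarrow> 0 < r i \<and> 2 * (c * r i) \<le> \<delta> \<and> cball (a i) (r i) \<subseteq> U"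
    and c: "0 < c" and \<delta>: "0 \<le> \<delta>" and U: "U \<in> sets borel"
  shows "hausdorff_pre (DIM('a)) \<delta> ((\<Union>i\<in>C. cball (a i) (c * r i)) \<times> {b::real})
    \<le> ennreal (c ^ DIM('a)) * emeasure lborel U"
proof -
  \<comment> \<open>Covers in \<open>hausdorff_pre\<close> are sequences, so the countable, possibly
    finite, family is enumerated by \<open>J\<close> and padded with empty sets.\<close>
  define J where "J = to_nat_on C ` C"
  define g where "g = from_nat_into C"
  have g: "g k \<in> C" if "k \<in> J" for k
    using that C by (auto simp: J_def g_def)
  have g_ex: "\<exists>k\<in>J. g k = i" if "i \<in> C" for i
    using that C by (auto simp: J_def g_def)
  have g_inj: "k = l" if "k \<in> J" "l \<in> J" "g k = g l" for k l
    using that C by (auto simp: J_def g_def)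
  define B where "B k = (if k \<in> J then cball (a (g k)) (r (g k)) else {})" for k
  define E where "E k = (if k \<in> J then cball (a (g k)) (c * r (g k)) \<times> {b} else {})" for k
  have diam: "diameter (cball p R \<times> {b}) \<le> 2 * R" if "0 < R" for p :: 'a and R
  proof -
    have "diameter (cball p R \<times> {b}) \<le> diameter (cball p R)"
    proof (rule diameter_le_image)
      fix x y assume "x \<in> cball p R \<times> {b}" "y \<in> cball p R \<times> {b}"
      then show "\<exists>x'\<in>cball p R. \<exists>y'\<in>cball p R. dist x y \<le> dist x' y'"
        by (intro bexI[of _ "fst x"] bexI[of _ "fst y"]) (auto simp: dist_prod_def)
    qed simp
    then show ?thesis using that by simp
  qed
  have "hausdorff_pre (DIM('a)) \<delta> ((\<Union>i\<in>C. cball (a i) (c * r i)) \<times> {b})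
      \<le> (\<Sum>k. ennreal (unit_ball_vol (DIM('a)) * (diameter (E k) / 2) powr (DIM('a))))"
  proof (rule hausdorff_pre_le)
    show "(\<Union>i\<in>C. cball (a i) (c * r i)) \<times> {b} \<subseteq> (\<Union>k. E k)"
    proof
      fix z assume "z \<in> (\<Union>i\<in>C. cball (a i) (c * r i)) \<times> {b}"
      then obtain i where i: "i \<in> C" "z \<in> cball (a i) (c * r i) \<times> {b}" by blast
      obtain k where "k \<in> J" "g k = i" using g_ex[OF i(1)] by blast
      then have "z \<in> E k" using i by (simp add: E_def)
      then show "z \<in> (\<Union>k. E k)" by blast
    qed
    show "bounded (E k)" for k by (auto simp: E_def intro!: bounded_Times)
    show "diameter (E k) \<le> \<delta>" for k
    proof (cases "k \<in> J")
      case True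
      then show ?thesis
        using diam[of "c * r (g k)" "a (g k)"] r[OF g[OF True]] c by (simp add: E_def)
    qed (simp add: E_def \<delta>)
  qed
  also have "\<dots> \<le> (\<Sum>k. ennreal (c ^ DIM('a)) * emeasure lborel (B k))"
  proof (intro suminf_le summableI)
    fix k
    show "ennreal (unit_ball_vol (DIM('a)) * (diameter (E k) / 2) powr (DIM('a)))
        \<le> ennreal (c ^ DIM('a)) * emeasure lborel (B k)"
    proof (cases "k \<in> J")
      case True
      have r0: "0 < r (g k)" using r[OF g[OF True]] by simp
      have "diameter (E k) / 2 \<le> c * r (g k)"
        using diam[of "c * r (g k)" "a (g k)"] r0 c True by (simp add: E_def)
      moreover have "0 \<le> diameter (E k)"
        by (intro diameter_ge_0) (auto simp: E_def intro!: bounded_Times)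
      ultimately have "(diameter (E k) / 2) powr (DIM('a)) \<le> (c * r (g k)) powr (DIM('a))"
        by (intro powr_mono2) auto
      also have "\<dots> = c ^ DIM('a) * r (g k) ^ DIM('a)"
        using r0 c by (simp add: powr_realpow power_mult_distrib)
      finally have "unit_ball_vol (DIM('a)) * (diameter (E k) / 2) powr (DIM('a))
          \<le> c ^ DIM('a) * (unit_ball_vol (DIM('a)) * r (g k) ^ DIM('a))"
        by (simp add: mult_left_mono mult.left_commute)
      then show ?thesis
        using True r0 c by (simp add: B_def emeasure_cball ennreal_leI flip: ennreal_mult)
    qed (simp add: E_def)
  qed
  also have "\<dots> = ennreal (c ^ DIM('a)) * (\<Sum>k. emeasure lborel (B k))"
    by (rule ennreal_suminf_cmult)
  also have "(\<Sum>k. emeasure lborel (B k)) = emeasure lborel (\<Union>k. B k)"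
  proof (rule suminf_emeasure)
    show "range B \<subseteq> sets lborel" by (auto simp: B_def)
    show "disjoint_family B"
      unfolding disjoint_family_on_def
    proof (intro ballI impI)
      fix k l :: nat assume "k \<noteq> l"
      then show "B k \<inter> B l = {}"
        using dis g[of k] g[of l] g_inj[of k l] by (auto simp: B_def pairwise_def disjnt_def)
    qed
  qed
  also have "emeasure lborel (\<Union>k. B k) \<le> emeasure lborel U"
    using r g U by (intro emeasure_mono) (auto simp: B_def split: if_splits)
  finally show ?thesis by (simp add: mult_left_mono)
qed

text \<open>Vitali's covering lemma inside an open set of measure at most e / 5^n: the fivefold
  enlargements of disjoint balls cover \<open>N\<close> and cost at most e.\<close>

lemma hausdorff_pre_negligible:
  fixes N :: "'a::euclidean_space set"
  assumes N: "negligible N" and \<delta>: "0 < \<delta>"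
  shows "hausdorff_pre (DIM('a)) \<delta> (N \<times> {b::real}) = 0"
proof -
  have "hausdorff_pre (DIM('a)) \<delta> (N \<times> {b}) \<le> 0 + ennreal e" if e: "0 < e" for e
  proof -
    define e' where "e' = e / 5 ^ DIM('a)"
    have e': "0 < e'" using e by (simp add: e'_def)
    have NS: "N \<in> sets lebesgue" "emeasure lebesgue N = 0"
      using N by (auto simp: negligible_iff_null_sets)
    obtain U where U: "open U" "N \<subseteq> U" "(U - N) \<in> lmeasurable" "emeasure lebesgue (U - N) < ennreal e'"
      using sets_lebesgue_outer_open[OF NS(1) e'] by metis
    have "emeasure lebesgue U = emeasure lebesgue (N \<union> (U - N))" using U(2) by (simp add: Un_absorb1)
    also have "\<dots> \<le> emeasure lebesgue N + emeasure lebesgue (U - N)"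
      using NS U(3) by (intro emeasure_subadditive) auto
    finally have Ue: "emeasure lborel U \<le> ennreal e'" using NS U(1,4) by simp
    \<comment> \<open>The bound 10 r \<le> \<delta> keeps the diameter of the fivefold enlarged
      balls below \<delta>.\<close>
    define K where "K = {(x, r). x \<in> N \<and> 0 < r \<and> 10 * r \<le> \<delta> \<and> cball x r \<subseteq> U}"
    have cov: "N \<subseteq> (\<Union>i\<in>K. cball (fst i) (snd i))"
    proof
      fix x assume x: "x \<in> N"
      then obtain r where r: "0 < r" "cball x r \<subseteq> U" using U(1,2) open_contains_cball by blast
      have "(x, min r (\<delta> / 10)) \<in> K" using x r \<delta> subset_cball[of "min r (\<delta> / 10)" r x] by (auto simp: K_def)
      then show "x \<in> (\<Union>i\<in>K. cball (fst i) (snd i))" using r(1) \<delta> by (force intro: UN_I)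
    qed
    have rB: "0 < snd i \<and> snd i \<le> \<delta> / 10" if "i \<in> K" for i
      using that by (auto simp: K_def)
    obtain C where C: "countable C" "C \<subseteq> K"
      "pairwise (\<lambda>i j. disjnt (cball (fst i) (snd i)) (cball (fst j) (snd j))) C"
      "N \<subseteq> (\<Union>i\<in>C. cball (fst i) (5 * snd i))"
      by (rule Vitali_covering_lemma_cballs[OF cov rB])
    have CK: "0 < snd i \<and> 10 * snd i \<le> \<delta> \<and> cball (fst i) (snd i) \<subseteq> U" if "i \<in> C" for i
      using subsetD[OF C(2) that] by (auto simp: K_def)
    have "hausdorff_pre (DIM('a)) \<delta> (N \<times> {b})
        \<le> hausdorff_pre (DIM('a)) \<delta> ((\<Union>i\<in>C. cball (fst i) (5 * snd i)) \<times> {b})"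
      using C(4) by (intro hausdorff_pre_mono) auto
    also have "\<dots> \<le> ennreal (5 ^ DIM('a)) * emeasure lborel U"
      using CK U(1) \<delta> by (intro hausdorff_pre_balls_le[OF C(1,3)]) auto
    also have "\<dots> \<le> ennreal (5 ^ DIM('a)) * ennreal e'" by (intro mult_left_mono Ue) simp
    also have "\<dots> = ennreal e" using e by (simp add: e'_def flip: ennreal_mult)
    finally show ?thesis by simp
  qed
  then have "hausdorff_pre (DIM('a)) \<delta> (N \<times> {b}) \<le> 0"
    by (rule ennreal_le_epsilon)
  then show ?thesis by simp
qed

text \<open>Vitali's covering theorem fills \<open>U\<close> with small disjoint balls up to a null
  set, and the null set costs nothing.\<close>

lemma hausdorff_pre_open:
  fixes U :: "'a::euclidean_space set"
  assumes U: "open U" and \<delta>: "0 < \<delta>"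
  shows "hausdorff_pre (DIM('a)) \<delta> (U \<times> {b::real}) \<le> emeasure lborel U"
proof -
  define K where "K = {(x, r). 0 < r \<and> 2 * r \<le> \<delta> \<and> cball x r \<subseteq> U}"
  have 1: "\<exists>i. i \<in> K \<and> x \<in> cball (fst i) (snd i) \<and> snd i < d" if x: "x \<in> U" and d: "0 < d" for x d
  proof -
    obtain r where r: "0 < r" "cball x r \<subseteq> U" using U x open_contains_cball by blast
    define t where "t = min r (min (\<delta> / 2) (d / 2))"
    have "0 < t" "t \<le> r" "t \<le> \<delta> / 2" "t < d" using r d \<delta> by (auto simp: t_def)
    moreover from this have "cball x t \<subseteq> U" using r(2) subset_cball[of t r x] by blast
    ultimately show ?thesis by (intro exI[of _ "(x, t)"]) (auto simp: K_def)
  qed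
  have r0: "0 < snd i" if "i \<in> K" for i
    using that by (auto simp: K_def)
  obtain C where C: "countable C" "C \<subseteq> K"
    "pairwise (\<lambda>i j. disjnt (cball (fst i) (snd i)) (cball (fst j) (snd j))) C"
    "negligible (U - (\<Union>i\<in>C. cball (fst i) (snd i)))"
    by (rule Vitali_covering_theorem_cballs[of K snd U fst, OF r0 1])
  have CK: "0 < snd i \<and> 2 * snd i \<le> \<delta> \<and> cball (fst i) (snd i) \<subseteq> U" if "i \<in> C" for i
    using subsetD[OF C(2) that] by (auto simp: K_def)
  let ?V = "\<Union>i\<in>C. cball (fst i) (1 * snd i)"
  have "hausdorff_pre (DIM('a)) \<delta> (U \<times> {b}) \<le> hausdorff_pre (DIM('a)) \<delta> (?V \<times> {b} \<union> (U - ?V) \<times> {b})"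
    by (intro hausdorff_pre_mono) auto
  also have "\<dots> \<le> hausdorff_pre (DIM('a)) \<delta> (?V \<times> {b}) + hausdorff_pre (DIM('a)) \<delta> ((U - ?V) \<times> {b})"
    using \<delta> by (intro hausdorff_pre_Un) simp
  also have "hausdorff_pre (DIM('a)) \<delta> ((U - ?V) \<times> {b}) = 0"
    using C(4) by (intro hausdorff_pre_negligible \<delta>) simp
  also have "hausdorff_pre (DIM('a)) \<delta> (?V \<times> {b}) \<le> ennreal (1 ^ DIM('a)) * emeasure lborel U"
    using CK U \<delta> by (intro hausdorff_pre_balls_le[OF C(1,3)]) auto
  finally show ?thesis by simp
qed

text \<open>The upper bound passes from open sets to Borel sets by outer regularity. For the lower
  bound a cover is projected to the first factor, which does not increase diameters, and the
  isodiametric inequality bounds the volume of each projection.\<close>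

lemma hausdorff_outer_slice:
  fixes A :: "'a::euclidean_space set"
  assumes A: "A \<in> sets borel"
  shows "hausdorff_outer (DIM('a)) (A \<times> {b::real}) = emeasure lborel A"
proof (rule antisym)
  show "hausdorff_outer (DIM('a)) (A \<times> {b}) \<le> emeasure lborel A"
    unfolding hausdorff_outer_def
  proof (rule SUP_least, rule ennreal_le_epsilon)
    fix \<delta> e :: real assume \<delta>: "\<delta> \<in> {0<..}" and e: "0 < e"
    obtain U where U: "open U" "A \<subseteq> U" "emeasure lborel (U - A) < e"
      using outer_regular_lborel[OF A e] by metis
    have "hausdorff_pre (DIM('a)) \<delta> (A \<times> {b}) \<le> hausdorff_pre (DIM('a)) \<delta> (U \<times> {b})"
      using U(2) by (intro hausdorff_pre_mono) auto
    also have "\<dots> \<le> emeasure lborel U" using U(1) \<delta> by (intro hausdorff_pre_open) auto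
    also have "\<dots> = emeasure lborel (A \<union> (U - A))" using U(2) by (simp add: Un_absorb1)
    also have "\<dots> \<le> emeasure lborel A + emeasure lborel (U - A)"
      using A U(1) by (intro emeasure_subadditive) auto
    also have "\<dots> \<le> emeasure lborel A + ennreal e" using U(3) by (intro add_left_mono) auto
    finally show "hausdorff_pre (DIM('a)) \<delta> (A \<times> {b}) \<le> emeasure lborel A + ennreal e" .
  qed
next
  have "emeasure lborel A \<le> hausdorff_pre (DIM('a)) 1 (A \<times> {b})"
    unfolding hausdorff_pre_def
  proof (rule INF_greatest)
    fix E :: "nat \<Rightarrow> ('a \<times> real) set"
    assume "E \<in> {E. A \<times> {b} \<subseteq> (\<Union>k. E k) \<and> (\<forall>k. bounded (E k) \<and> diameter (E k) \<le> 1)}"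
    then have E: "A \<times> {b} \<subseteq> (\<Union>k. E k)" "\<And>k. bounded (E k)" by auto
    define F where "F k = fst ` E k" for k
    have bF: "bounded (F k)" for k
      unfolding F_def by (intro bounded_fst E)
    have dF: "diameter (F k) \<le> diameter (E k)" for k
    proof (rule diameter_le_image[OF E(2)])
      fix x y assume "x \<in> F k" "y \<in> F k"
      then obtain p q where "p \<in> E k" "q \<in> E k" "x = fst p" "y = fst q" by (auto simp: F_def)
      then show "\<exists>x'\<in>E k. \<exists>y'\<in>E k. dist x y \<le> dist x' y'" using dist_fst_le by blast
    qed
    \<comment> \<open>The projections need not be measurable; their closures are, and the
      isodiametric inequality is stated for closures.\<close>
    have "A \<subseteq> (\<Union>k. closure (F k))"
    proof
      fix x assume "x \<in> A"
      then obtain k where "(x, b) \<in> E k" using E(1) by blast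
      then have "x \<in> F k" unfolding F_def by (metis fst_conv image_eqI)
      then show "x \<in> (\<Union>k. closure (F k))" using closure_subset by blast
    qed
    then have "emeasure lborel A \<le> emeasure lborel (\<Union>k. closure (F k))"
      by (intro emeasure_mono) auto
    also have "\<dots> \<le> (\<Sum>k. emeasure lborel (closure (F k)))"
      by (intro emeasure_subadditive_countably) auto
    also have "\<dots> \<le> (\<Sum>k. ennreal (unit_ball_vol (DIM('a)) * (diameter (E k) / 2) powr (DIM('a))))"
    proof (intro suminf_le summableI)
      fix k
      have "emeasure lborel (closure (F k)) = ennreal (measure lebesgue (closure (F k)))"
        using emeasure_eq_ennreal_measure[of lborel "closure (F k)"] emeasure_bounded_finite[OF bounded_closure[OF bF]]
        by (metis closed_closure emeasure_lborel_cbox_finite infinity_ennreal_def lborelD less_irrefl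
            measure_completion sets_completionI_sets borel_closed sets_lborel top.not_eq_extremum)
      also have "\<dots> \<le> ennreal (unit_ball_vol (DIM('a)) * (diameter (F k) / 2) ^ DIM('a))"
        by (intro ennreal_leI isodiametric bF)
      also have "\<dots> \<le> ennreal (unit_ball_vol (DIM('a)) * (diameter (E k) / 2) ^ DIM('a))"
        using dF diameter_ge_0[OF bF] by (intro ennreal_leI mult_left_mono power_mono) auto
      also have "(diameter (E k) / 2) ^ DIM('a) = (diameter (E k) / 2) powr (DIM('a))"
        using diameter_ge_0[OF E(2), of k] by (cases "diameter (E k) = 0") (auto simp: powr_realpow)
      finally show "emeasure lborel (closure (F k))
          \<le> ennreal (unit_ball_vol (DIM('a)) * (diameter (E k) / 2) powr (DIM('a)))" .
    qed
    finally show "emeasure lborel A \<le> \<dots>" .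
  qed
  also have "\<dots> \<le> hausdorff_outer (DIM('a)) (A \<times> {b})" by (intro hausdorff_pre_le_outer) simp
  finally show "emeasure lborel A \<le> hausdorff_outer (DIM('a)) (A \<times> {b})" .
qed

text \<open>Written as an identity between a density and a push-forward, so that null sets and
  integrals on the hyperplane can be transferred to Lebesgue measure on the first factor.\<close>

lemma density_borel_hausdorff_slice:
  "density (borel_hausdorff (DIM('a))) (indicator (UNIV \<times> {b})) =
    distr lborel borel (\<lambda>x::'a::euclidean_space. (x, b::real))"
proof (rule measure_eqI)
  have [measurable]: "(\<lambda>x::'a. (x, b)) \<in> borel_measurable borel" by (intro borel_measurable_continuous_onI continuous_intros)
  have pl: "(UNIV :: 'a set) \<times> {b} \<in> sets borel" by (intro borel_closed closed_Times) auto
  fix P assume "P \<in> sets (density (borel_hausdorff (DIM('a))) (indicator ((UNIV :: 'a set) \<times> {b})))"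
  then have P: "P \<in> sets borel" by simp
  have m: "(\<lambda>x. (x, b)) -` P \<in> sets borel"
    using measurable_sets[OF \<open>(\<lambda>x::'a. (x, b)) \<in> borel_measurable borel\<close> P] by simp
  have eq: "(UNIV \<times> {b}) \<inter> P = ((\<lambda>x. (x, b)) -` P) \<times> {b}" by auto
  have "emeasure (density (borel_hausdorff (DIM('a))) (indicator (UNIV \<times> {b}))) P
      = emeasure (borel_hausdorff (DIM('a))) ((UNIV \<times> {b}) \<inter> P)"
    using pl P by (intro emeasure_restricted) auto
  also have "\<dots> = hausdorff_outer (DIM('a)) ((UNIV \<times> {b}) \<inter> P)"
    using pl P by (intro emeasure_borel_hausdorff) auto
  also have "\<dots> = emeasure lborel ((\<lambda>x. (x, b)) -` P)"
    unfolding eq using m by (rule hausdorff_outer_slice)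
  also have "\<dots> = emeasure (distr lborel borel (\<lambda>x::'a. (x, b))) P"
    using P by (subst emeasure_distr) auto
  finally show "emeasure (density (borel_hausdorff (DIM('a))) (indicator (UNIV \<times> {b}))) P
      = emeasure (distr lborel borel (\<lambda>x::'a. (x, b))) P" .
qed (simp only: sets_density sets_distr sets_borel_hausdorff)

lemma borel_slice [measurable]: "(UNIV :: 'a::euclidean_space set) \<times> {b::real} \<in> sets borel"
  by (intro borel_closed closed_Times) auto

lemma borel_measurable_Pair_const [measurable]:
  "(\<lambda>x::'a::euclidean_space. (x, b::real)) \<in> borel_measurable borel"
  by (intro borel_measurable_continuous_onI continuous_intros)

lemma AE_hausdorff_slice:
  "(AE z in hausdorff_measure (DIM('a)). z \<in> UNIV \<times> {b} \<longrightarrow> P z) \<longleftrightarrow>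
    (AE x in lebesgue. P (x::'a::euclidean_space, b::real))"
proof -
  let ?H = "borel_hausdorff (DIM('a)) :: ('a \<times> real) measure"
  let ?D = "density ?H (indicator (UNIV \<times> {b}))"
  have e1: "(AE z in ?H. z \<in> UNIV \<times> {b} \<longrightarrow> P z) \<longleftrightarrow> (AE z in ?D. P z)"
    by (subst AE_density) (auto simp: indicator_def)
  also have "\<dots> \<longleftrightarrow> (AE x in lborel. P (x, b))"
  proof
    assume "AE z in ?D. P z"
    then have "AE z in distr lborel borel (\<lambda>x::'a. (x, b)). P z" unfolding density_borel_hausdorff_slice .
    then show "AE x in lborel. P (x, b)" by (rule AE_distrD[rotated]) simp
  next
    assume "AE x in lborel. P (x, b)"
    \<comment> \<open>The property \<open>P\<close> may fail to be measurable, so a Borel null set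
      containing all exceptions is carried to the hyperplane.\<close>
    then obtain N where N: "{x. \<not> P (x, b)} \<subseteq> N" "emeasure lborel N = 0" "N \<in> sets borel"
      by (auto elim!: AE_E)
    have "emeasure ?H (N \<times> {b}) = 0"
      using N by (subst emeasure_borel_hausdorff) (auto simp: hausdorff_outer_slice intro!: borel_Times)
    then have "N \<times> {b} \<in> null_sets ?H"
      using N by (auto simp: null_sets_def intro!: borel_Times)
    then have "AE z in ?H. z \<notin> N \<times> {b}" by (rule AE_not_in)
    then have "AE z in ?H. z \<in> UNIV \<times> {b} \<longrightarrow> P z"
      by eventually_elim (use N(1) in auto)
    then show "AE z in ?D. P z" by (rule iffD1[OF e1])
  qed
  finally show ?thesis unfolding hausdorff_measure_eq AE_completion_iff .
qed

lemma completion_borel_measurable_AE: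
  fixes f g :: "'a \<Rightarrow> 'b::topological_space"
  assumes f: "f \<in> borel_measurable (completion M)" and ae: "AE x in completion M. f x = g x"
  shows "g \<in> borel_measurable (completion M)"
proof (rule measurableI)
  fix A :: "'b set" assume A: "A \<in> sets borel"
  show "g -` A \<inter> space (completion M) \<in> sets (completion M)"
  proof (rule completion.in_sets_AE)
    show "f -` A \<inter> space (completion M) \<in> sets (completion M)" using f A by (rule measurable_sets)
    show "AE x in completion M. x \<in> f -` A \<inter> space (completion M) \<longleftrightarrow> x \<in> g -` A \<inter> space (completion M)"
      using ae by eventually_elim auto
  qed simp
qed simp

lemma has_bochner_integral_borel_hausdorff_slice:
  fixes F :: "'a::euclidean_space \<times> real \<Rightarrow> real"
  assumes F: "F \<in> borel_measurable borel"
  shows "has_bochner_integral (borel_hausdorff (DIM('a))) (\<lambda>z. indicator (UNIV \<times> {b}) z * F z) I \<longleftrightarrow>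
    has_bochner_integral lborel (\<lambda>x. F (x, b)) I"
proof -
  let ?H = "borel_hausdorff (DIM('a)) :: ('a \<times> real) measure"
  have e: "(indicator (UNIV \<times> {b}) :: 'a \<times> real \<Rightarrow> ennreal) = (\<lambda>z. ennreal (indicator (UNIV \<times> {b}) z))"
    by (auto simp: indicator_def)
  have "has_bochner_integral ?H (\<lambda>z. indicator (UNIV \<times> {b}) z * F z) I \<longleftrightarrow>
      has_bochner_integral (density ?H (indicator (UNIV \<times> {b}))) F I"
    unfolding has_bochner_integral_iff e using F by (subst integrable_density integral_density; simp)+
  also have "\<dots> \<longleftrightarrow> has_bochner_integral lborel (\<lambda>x. F (x, b)) I"
    unfolding has_bochner_integral_iff density_borel_hausdorff_slice
    using F by (simp add: integrable_distr_eq integral_distr)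
  finally show ?thesis .
qed

lemma has_bochner_integral_completion:
  fixes f :: "'a \<Rightarrow> real"
  assumes "f' \<in> borel_measurable M" "AE x in completion M. f x = f' x"
  shows "has_bochner_integral (completion M) f I \<longleftrightarrow> has_bochner_integral M f' I"
proof -
  have f': "f' \<in> borel_measurable (completion M)" using assms(1) by (rule measurable_completion)
  have "AE x in completion M. f' x = f x" using assms(2) by eventually_elim simp
  then have f: "f \<in> borel_measurable (completion M)"
    by (rule completion_borel_measurable_AE[OF f'])
  have "has_bochner_integral (completion M) f I \<longleftrightarrow> has_bochner_integral (completion M) f' I"
    by (rule has_bochner_integral_cong_AE[OF f f' assms(2)])
  also have "\<dots> \<longleftrightarrow> has_bochner_integral M f' I"
    using assms(1) by (simp add: has_bochner_integral_iff integrable_completion integral_completion)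
  finally show ?thesis .
qed

text \<open>\<open>has_bochner_integral\<close> transports integrability and value together. Either
  side makes the slice of \<open>f\<close> measurable and thus supplies the Borel representative for
  which the uncompleted statement applies.\<close>

lemma has_bochner_integral_hausdorff_slice:
  fixes f :: "'a::euclidean_space \<times> real \<Rightarrow> real"
  shows "has_bochner_integral (hausdorff_measure (DIM('a))) (\<lambda>z. indicator (UNIV \<times> {b}) z * f z) I \<longleftrightarrow>
    has_bochner_integral lebesgue (\<lambda>x. f (x, b)) I" (is "?l \<longleftrightarrow> ?r")
proof -
  let ?H = "borel_hausdorff (DIM('a)) :: ('a \<times> real) measure"
  have main: "?l \<longleftrightarrow> ?r" if F: "F \<in> borel_measurable borel" and ae: "AE x in lebesgue. f (x, b) = F (x, b)" for F
  proof -
    have "AE z in completion ?H. z \<in> UNIV \<times> {b} \<longrightarrow> f z = F z"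
      using ae unfolding AE_hausdorff_slice hausdorff_measure_eq[symmetric] .
    then have "AE z in completion ?H. indicator (UNIV \<times> {b}) z * f z = indicator (UNIV \<times> {b}) z * F z"
      by eventually_elim (auto simp: indicator_def)
    then have "?l \<longleftrightarrow> has_bochner_integral ?H (\<lambda>z. indicator (UNIV \<times> {b}) z * F z) I"
      unfolding hausdorff_measure_eq using F by (intro has_bochner_integral_completion) auto
    also have "\<dots> \<longleftrightarrow> has_bochner_integral lborel (\<lambda>x. F (x, b)) I"
      by (rule has_bochner_integral_borel_hausdorff_slice[OF F])
    also have "\<dots> \<longleftrightarrow> ?r"
      using F ae by (intro has_bochner_integral_completion[symmetric]) auto
    finally show ?thesis .
  qed
  show ?thesis
  proof
    assume l: ?l
    then have "(\<lambda>z. indicator (UNIV \<times> {b}) z * f z) \<in> borel_measurable (completion ?H)"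
      unfolding hausdorff_measure_eq by (auto simp: has_bochner_integral_iff)
    then obtain F where F: "F \<in> borel_measurable ?H" "AE z in ?H. indicator (UNIV \<times> {b}) z * f z = F z"
      by (blast dest: completion_ex_borel_measurable_real)
    then have "AE z in completion ?H. z \<in> UNIV \<times> {b} \<longrightarrow> f z = F z"
      unfolding AE_completion_iff by eventually_elim (auto simp: indicator_def)
    then have "AE x in lebesgue. f (x, b) = F (x, b)"
      unfolding AE_hausdorff_slice hausdorff_measure_eq[symmetric] .
    then show ?r using main[of F] F(1) l by simp
  next
    assume r: ?r
    then have "(\<lambda>x. f (x, b)) \<in> borel_measurable lebesgue" by (auto simp: has_bochner_integral_iff)
    then obtain g where g: "g \<in> borel_measurable lborel" "AE x in lborel. f (x, b) = g x"
      using completion_ex_borel_measurable_real by metis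
    have "(\<lambda>z::'a \<times> real. g (fst z)) \<in> borel_measurable borel"
      using g(1) by (intro measurable_compose[OF borel_measurable_continuous_onI[OF continuous_on_fst[OF continuous_on_id]]]) auto
    then show ?l using main[of "\<lambda>z. g (fst z)"] g(2) r by (simp add: AE_completion_iff)
  qed
qed

lemma strip_eq_Times: "strip bm bp = UNIV \<times> {bm<..<bp}"
  by (auto simp: strip_def)

lemma open_strip: "open (strip bm bp)"
  by (simp add: strip_eq_Times open_Times)

lemma closure_strip: "bm < bp \<Longrightarrow> closure (strip bm bp) = UNIV \<times> {bm..bp}"
  by (simp add: strip_eq_Times closure_Times)

lemma frontier_strip:
  assumes "bm < bp"
  shows "frontier (strip bm bp) = UNIV \<times> {bm} \<union> UNIV \<times> {bp}"
  unfolding frontier_def interior_open[OF open_strip] closure_strip[OF assms]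
  unfolding strip_eq_Times using assms by auto

lemma AE_frontier_strip:
  fixes P :: "(real^'n) \<times> real \<Rightarrow> bool"
  assumes "bm < bp"
  shows "(AE z\<in>frontier (strip bm bp) in surface_measure. P z) \<longleftrightarrow>
    (\<forall>b\<in>{bm, bp}. AE x in lebesgue. P (x, b))"
proof -
  have slice: "(AE z in surface_measure. z \<in> UNIV \<times> {b} \<longrightarrow> P z) \<longleftrightarrow> (AE x in lebesgue. P (x, b))" for b
    using AE_hausdorff_slice[where 'a="real^'n" and P=P and b=b] unfolding DIM_cart DIM_real mult_1_right .
  have "(AE z\<in>frontier (strip bm bp) in surface_measure. P z) \<longleftrightarrow>
      (AE z in surface_measure. (z \<in> UNIV \<times> {bm} \<longrightarrow> P z) \<and> (z \<in> UNIV \<times> {bp} \<longrightarrow> P z))"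
    unfolding frontier_strip[OF assms] by (intro AE_cong) auto
  also have "\<dots> \<longleftrightarrow> (\<forall>b\<in>{bm, bp}. AE z in surface_measure. z \<in> UNIV \<times> {b} \<longrightarrow> P z)"
    unfolding AE_conj_iff by (simp only: ball_simps) blast
  also have "\<dots> \<longleftrightarrow> (\<forall>b\<in>{bm, bp}. AE x in lebesgue. P (x, b))"
    unfolding slice ..
  finally show ?thesis .
qed

lemma has_bochner_integral_surface_slice:
  fixes f :: "(real^'n) \<times> real \<Rightarrow> real"
  shows "has_bochner_integral surface_measure (\<lambda>z. indicator (UNIV \<times> {b}) z * f z) I \<longleftrightarrow>
    has_bochner_integral lebesgue (\<lambda>x. f (x, b)) I"
  using has_bochner_integral_hausdorff_slice[of b f I] by simp

lemma integral_frontier_strip: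
  fixes f :: "(real^'n) \<times> real \<Rightarrow> real"
  assumes b: "bm < bp" and f: "\<And>b. b \<in> {bm, bp} \<Longrightarrow> integrable lebesgue (\<lambda>x. f (x, b))"
  shows "(LINT z:frontier (strip bm bp)|surface_measure. f z) =
    (\<integral>x. f (x, bm) \<partial>lebesgue) + (\<integral>x. f (x, bp) \<partial>lebesgue)"
proof -
  have *: "has_bochner_integral surface_measure (\<lambda>z. indicator (UNIV \<times> {b}) z * f z) (\<integral>x. f (x, b) \<partial>lebesgue)"
    if "b \<in> {bm, bp}" for b
    unfolding has_bochner_integral_surface_slice using f[OF that] by (simp add: has_bochner_integral_integrable)
  have "has_bochner_integral surface_measure
      (\<lambda>z. indicator (UNIV \<times> {bm}) z * f z + indicator (UNIV \<times> {bp}) z * f z)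
      ((\<integral>x. f (x, bm) \<partial>lebesgue) + (\<integral>x. f (x, bp) \<partial>lebesgue))"
    by (intro has_bochner_integral_add *) auto
  moreover have "(\<lambda>z. indicator (UNIV \<times> {bm}) z * f z + indicator (UNIV \<times> {bp}) z * f z) =
      (\<lambda>z. indicator (frontier (strip bm bp)) z *\<^sub>R f z)"
    using b by (auto simp: frontier_strip indicator_def)
  ultimately show ?thesis
    unfolding set_lebesgue_integral_def by (simp add: has_bochner_integral_integral_eq)
qed

text \<open>A compact subset of the boundary lies in the two slices over its compact
  projection.\<close>

lemma L1_loc_frontier_strip:
  fixes f :: "(real^'n) \<times> real \<Rightarrow> real"
  assumes b: "bm < bp"
  shows "f \<in> L1_loc surface_measure (frontier (strip bm bp)) \<longleftrightarrow>
    (\<forall>b\<in>{bm, bp}. (\<lambda>x. f (x, b)) \<in> L1_loc lebesgue UNIV)"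
proof -
  have slice: "set_integrable surface_measure (K \<times> {b}) f \<longleftrightarrow> set_integrable lebesgue K (\<lambda>x. f (x, b))"
    for K :: "(real^'n) set" and b
  proof -
    have eq: "(\<lambda>z. indicator (K \<times> {b}) z *\<^sub>R f z) = (\<lambda>z. indicator (UNIV \<times> {b}) z * (indicator K (fst z) * f z))"
      by (auto simp: indicator_def)
    show ?thesis
      unfolding set_integrable_def eq integrable.simps has_bochner_integral_surface_slice by simp
  qed
  show ?thesis
  proof
    assume f: "f \<in> L1_loc surface_measure (frontier (strip bm bp))"
    show "\<forall>b\<in>{bm, bp}. (\<lambda>x. f (x, b)) \<in> L1_loc lebesgue UNIV"
      unfolding L1_loc_def
    proof (intro ballI CollectI allI impI)
      fix b and K :: "(real^'n) set" assume bb: "b \<in> {bm, bp}" and K: "compact K \<and> K \<subseteq> UNIV"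
      have "compact (K \<times> {b})" "K \<times> {b} \<subseteq> frontier (strip bm bp)"
        using K bb by (auto simp: frontier_strip[OF b] intro!: compact_Times)
      then show "set_integrable lebesgue K (\<lambda>x. f (x, b))"
        using f unfolding L1_loc_def by (simp flip: slice)
    qed
  next
    assume f: "\<forall>b\<in>{bm, bp}. (\<lambda>x. f (x, b)) \<in> L1_loc lebesgue UNIV"
    show "f \<in> L1_loc surface_measure (frontier (strip bm bp))"
      unfolding L1_loc_def
    proof (intro CollectI allI impI)
      fix K :: "((real^'n) \<times> real) set" assume K: "compact K \<and> K \<subseteq> frontier (strip bm bp)"
      have K': "compact (fst ` K)"
        using K by (intro compact_continuous_image continuous_on_fst continuous_on_id) auto
      have "set_integrable surface_measure (fst ` K \<times> {b}) f" if "b \<in> {bm, bp}" for b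
        unfolding slice using f that K' by (auto simp: L1_loc_def)
      moreover have "fst ` K \<times> {b} \<in> sets (surface_measure :: ((real^'n) \<times> real) measure)" for b
      proof -
        have "fst ` K \<times> {b} \<in> sets borel"
          by (intro borel_closed closed_Times compact_imp_closed K') simp
        then show ?thesis
          unfolding hausdorff_measure_eq by (intro sets_completionI_sets) (simp only: sets_borel_hausdorff)
      qed
      ultimately have "set_integrable surface_measure (fst ` K \<times> {bm} \<union> fst ` K \<times> {bp}) f"
        by (intro set_integrable_Un) auto
      then show "set_integrable surface_measure K f"
      proof (rule set_integrable_subset)
        show "K \<in> sets surface_measure"
          unfolding hausdorff_measure_eq using K
          by (intro sets_completionI_sets) (auto intro!: borel_closed compact_imp_closed)
        show "K \<subseteq> fst ` K \<times> {bm} \<union> fst ` K \<times> {bp}"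
          using K unfolding frontier_strip[OF b] by force
      qed
    qed
  qed
qed

section \<open>The outward unit normal\<close>

lemma C_k_inner: "C_k k (\<lambda>y. e \<bullet> (y - z))" for e z :: "'a::euclidean_space"
  using C_k_linear[OF bounded_linear_inner_right, of k e "- (e \<bullet> z)"] by (simp add: inner_diff_right)

text \<open>The definite description needs uniqueness: the gradient of any admissible defining
  function makes no acute angle with vectors pointing strictly into the half-space, hence is a
  positive multiple of \<open>e\<close>.\<close>

lemma outward_unit_normal_eqI:
  fixes z e :: "'a::euclidean_space"
  assumes W: "open W" "z \<in> W" and e: "norm e = 1" and eq: "\<Omega> \<inter> W = {y\<in>W. e \<bullet> (y - z) < 0}"
  shows "outward_unit_normal \<Omega> z = e"
  unfolding outward_unit_normal_def
proof (rule the_equality)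
  have "GDERIV (\<lambda>y. e \<bullet> (y - z)) z :> e"
    unfolding gderiv_def by (auto intro!: derivative_eq_intros simp: inner_commute)
  then show "\<exists>U \<phi> d. open U \<and> z \<in> U \<and> C_k 1 \<phi> \<and> \<phi> z = 0 \<and>
     (GDERIV \<phi> z :> d) \<and> d \<noteq> 0 \<and> \<Omega> \<inter> U = {y\<in>U. \<phi> y < 0} \<and> e = d /\<^sub>R norm d"
    using W e eq C_k_inner[of 1 e z]
    by (intro exI[of _ W] exI[of _ "\<lambda>y. e \<bullet> (y - z)"] exI[of _ e]) auto
next
  fix n
  assume "\<exists>U \<phi> d. open U \<and> z \<in> U \<and> C_k 1 \<phi> \<and> \<phi> z = 0 \<and>
     (GDERIV \<phi> z :> d) \<and> d \<noteq> 0 \<and> \<Omega> \<inter> U = {y\<in>U. \<phi> y < 0} \<and> n = d /\<^sub>R norm d"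
  then obtain U \<phi> d where U: "open U" "z \<in> U" and \<phi>: "\<phi> z = 0" "GDERIV \<phi> z :> d"
    and d: "d \<noteq> 0" "n = d /\<^sub>R norm d" and U\<Omega>: "\<Omega> \<inter> U = {y\<in>U. \<phi> y < 0}"
    by blast
  \<comment> \<open>For small t > 0 the point z + t v lies in the domain, so the defining function
    is negative there; a positive derivative along v would make it positive.\<close>
  have le: "d \<bullet> v \<le> 0" if v: "e \<bullet> v < 0" for v
  proof (rule ccontr)
    assume "\<not> d \<bullet> v \<le> 0"
    have "((\<lambda>t::real. \<phi> (z + t *\<^sub>R v)) has_derivative (\<lambda>t. (t *\<^sub>R v) \<bullet> d)) (at 0)"
    proof (rule has_derivative_compose[of "\<lambda>t. z + t *\<^sub>R v" "\<lambda>t. t *\<^sub>R v" 0 UNIV \<phi> "\<lambda>h. h \<bullet> d"])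
      show "((\<lambda>t::real. z + t *\<^sub>R v) has_derivative (\<lambda>t. t *\<^sub>R v)) (at 0)"
        by (auto intro!: derivative_eq_intros)
      show "(\<phi> has_derivative (\<lambda>h. h \<bullet> d)) (at (z + 0 *\<^sub>R v))"
        using \<phi>(2) by (simp add: gderiv_def)
    qed
    then have "((\<lambda>t::real. \<phi> (z + t *\<^sub>R v)) has_real_derivative (d \<bullet> v)) (at 0)"
      unfolding has_field_derivative_def by (rule has_derivative_eq_rhs) (auto simp: inner_commute mult.commute)
    then obtain r where r: "0 < r" "\<And>t. 0 < t \<Longrightarrow> t < r \<Longrightarrow> 0 < \<phi> (z + t *\<^sub>R v)"
      using has_real_derivative_pos_inc_right[of "\<lambda>t. \<phi> (z + t *\<^sub>R v)" "d \<bullet> v" 0 UNIV] \<open>\<not> d \<bullet> v \<le> 0\<close> \<phi>(1)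
      by auto
    have "((\<lambda>t::real. z + t *\<^sub>R v) \<longlongrightarrow> z + 0 *\<^sub>R v) (at_right 0)"
      by (intro tendsto_intros)
    then have "\<forall>\<^sub>F t in at_right 0. z + t *\<^sub>R v \<in> U \<inter> W"
      using U W by (intro topological_tendstoD[of _ "z + 0 *\<^sub>R v"] open_Int) auto
    moreover have "\<forall>\<^sub>F t::real in at_right 0. 0 < t \<and> t < r"
      using r(1) by (auto simp: eventually_at_right_less eventually_conj_iff eventually_at_right_field)
    ultimately have "\<forall>\<^sub>F t::real in at_right 0. False"
    proof eventually_elim
      case (elim t)
      have "e \<bullet> (z + t *\<^sub>R v - z) < 0" using elim v by (simp add: mult_pos_neg)
      then have "z + t *\<^sub>R v \<in> \<Omega> \<inter> W" unfolding eq using elim by blast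
      then have "\<phi> (z + t *\<^sub>R v) < 0" using U\<Omega> elim by blast
      then show False using r(2)[of t] elim by simp
    qed
    then show False by simp
  qed
  define c where "c = e \<bullet> d"
  have ee: "e \<bullet> e = 1" using e by (simp add: dot_square_norm)
  have "d \<bullet> (- e) \<le> 0" by (rule le) (simp add: ee)
  then have c0: "0 \<le> c" by (simp add: c_def inner_commute)
  \<comment> \<open>The tested vector is the component of \<open>d\<close> orthogonal to
    \<open>e\<close>, tilted by \<eta> into the half-space. As \<eta> tends to 0 that component
    turns out to be zero.\<close>
  have eta: "d \<bullet> d - c * c \<le> \<eta> * c" if "0 < \<eta>" for \<eta>
  proof -
    have "d \<bullet> (d - c *\<^sub>R e - \<eta> *\<^sub>R e) \<le> 0"
      using that by (intro le) (simp add: inner_diff_right ee c_def)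
    then show ?thesis by (simp add: inner_diff_right c_def inner_commute)
  qed
  have "d \<bullet> d - c * c \<le> 0"
  proof (rule field_le_epsilon)
    fix r :: real assume r: "0 < r"
    have "r / (c + 1) * c \<le> r" using r c0 by (simp add: field_simps)
    moreover have "d \<bullet> d - c * c \<le> r / (c + 1) * c"
      using eta[of "r / (c + 1)"] r c0 by simp
    ultimately show "d \<bullet> d - c * c \<le> 0 + r" by linarith
  qed
  then have "(d - c *\<^sub>R e) \<bullet> (d - c *\<^sub>R e) \<le> 0"
    by (simp add: inner_diff_left inner_diff_right ee c_def inner_commute)
  then have dc: "d = c *\<^sub>R e" using inner_ge_zero[of "d - c *\<^sub>R e"] by (simp add: order_antisym_conv)
  with d(1) c0 have "0 < c" by (cases "c = 0") auto
  then show "n = e" unfolding d(2) dc using e by simp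
qed

lemma outward_unit_normal_strip:
  fixes x :: "real^'n"
  assumes "bm < bp"
  shows "outward_unit_normal (strip bm bp) (x, bp) = (0, 1)"
    and "outward_unit_normal (strip bm bp) (x, bm) = (0, - 1)"
proof -
  show "outward_unit_normal (strip bm bp) (x, bp) = (0, 1)"
  proof (rule outward_unit_normal_eqI)
    show "open (UNIV \<times> {bm<..} :: ((real^'n) \<times> real) set)" by (intro open_Times) auto
  qed (use assms in \<open>auto simp: strip_def\<close>)
  show "outward_unit_normal (strip bm bp) (x, bm) = (0, - 1)"
  proof (rule outward_unit_normal_eqI)
    show "open (UNIV \<times> {..<bp} :: ((real^'n) \<times> real) set)" by (intro open_Times) auto
  qed (use assms in \<open>auto simp: strip_def\<close>)
qed

section \<open>Difference quotients and weak gradients\<close>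

lemma distr_lborel_shift: "distr lborel borel (\<lambda>x. x + a) = (lborel :: 'a::euclidean_space measure)"
proof -
  have "(\<lambda>x. x + a) = (+) a" by (auto simp: add.commute)
  then show ?thesis using lborel_distr_plus[of a] by simp
qed

lemma measurable_shift [measurable]: "(\<lambda>x::'a::euclidean_space. x + a) \<in> borel_measurable lborel"
  by simp

lemma nn_integral_lborel_shift:
  fixes a :: "'a::euclidean_space"
  assumes "f \<in> borel_measurable borel"
  shows "(\<integral>\<^sup>+x. f (x + a) \<partial>lborel) = (\<integral>\<^sup>+x. f x \<partial>lborel)"
  using nn_integral_distr[OF measurable_shift[of a], of f] assms by (simp add: distr_lborel_shift)

lemma integrable_lborel_shift:
  fixes a :: "'a::euclidean_space" and f :: "'a \<Rightarrow> real"
  assumes "integrable lborel f"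
  shows "integrable lborel (\<lambda>x. f (x + a))"
  using integrable_distr[OF measurable_shift[of a], of f] assms by (simp add: distr_lborel_shift)

lemma integral_lborel_shift:
  fixes a :: "'a::euclidean_space" and f :: "'a \<Rightarrow> real"
  assumes "f \<in> borel_measurable borel"
  shows "(\<integral>x. f (x + a) \<partial>lborel) = (\<integral>x. f x \<partial>lborel)"
  using integral_distr[OF measurable_shift[of a], of f] assms by (simp add: distr_lborel_shift)

lemma AE_lborel_shift:
  fixes a :: "'a::euclidean_space"
  assumes "AE x in lborel. P x"
  shows "AE x in lborel. P (x + a)"
  using assms AE_distrD[OF measurable_shift[of a], of P] by (simp only: distr_lborel_shift)

text \<open>The product integrability behind the exchanges of the integral over the segment
  parameter with the integral over space: translation leaves the norm of \<open>F\<close> unchanged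
  for each \<open>s\<close>.\<close>

lemma integrable_shift_pair:
  fixes F :: "'a::euclidean_space \<Rightarrow> real" and k :: "real \<times> 'a \<Rightarrow> real"
  assumes F: "integrable lborel F" and k [measurable]: "k \<in> borel_measurable (borel \<Otimes>\<^sub>M borel)"
    and C: "\<And>s x. s \<in> {0..1} \<Longrightarrow> \<bar>k (s, x)\<bar> \<le> C"
  shows "integrable (lborel \<Otimes>\<^sub>M lborel) (\<lambda>(s, x). indicator {0..1} s * (F (x + s *\<^sub>R h) * k (s, x)))"
proof -
  have [measurable]: "F \<in> borel_measurable borel" using F by simp
  have base: "integrable (lborel \<Otimes>\<^sub>M lborel) (\<lambda>(s::real, x). indicator {0..1} s * F (x + s *\<^sub>R h))"
  proof (rule lborel_pair.Fubini_integrable)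
    have "(\<integral>x. norm (indicator {0..1} s * F (x + s *\<^sub>R h)) \<partial>lborel) = indicator {0..1} s * (\<integral>x. \<bar>F x\<bar> \<partial>lborel)"
      for s :: real
      using integral_lborel_shift[of "\<lambda>x. \<bar>F x\<bar>" "s *\<^sub>R h"] by (simp add: abs_mult)
    then show "integrable lborel (\<lambda>s. \<integral>x. norm (case (s::real, x) of (s, x) \<Rightarrow> indicator {0..1} s * F (x + s *\<^sub>R h)) \<partial>lborel)"
      by simp
    show "AE s in lborel. integrable lborel (\<lambda>x. case (s::real, x) of (s, x) \<Rightarrow> indicator {0..1} s * F (x + s *\<^sub>R h))"
      using integrable_lborel_shift[OF F] by simp
  qed measurable
  show ?thesis
  proof (rule Bochner_Integration.integrable_bound)
    show "integrable (lborel \<Otimes>\<^sub>M lborel) (\<lambda>z. C * (\<lambda>(s::real, x). indicator {0..1} s * F (x + s *\<^sub>R h)) z)"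
      using base by (rule integrable_mult_right)
    show "AE z in lborel \<Otimes>\<^sub>M lborel. norm (case z of (s, x) \<Rightarrow> indicator {0..1} s * (F (x + s *\<^sub>R h) * k (s, x)))
        \<le> norm (C * (\<lambda>(s::real, x). indicator {0..1} s * F (x + s *\<^sub>R h)) z)"
    proof (intro AE_I2, clarify)
      fix s :: real and x :: 'a
      show "norm (indicator {0..1} s * (F (x + s *\<^sub>R h) * k (s, x))) \<le> norm (C * (indicator {0..1} s * F (x + s *\<^sub>R h)))"
      proof (cases "s \<in> {0..1}")
        case True
        have "\<bar>k (s, x)\<bar> * \<bar>F (x + s *\<^sub>R h)\<bar> \<le> \<bar>C\<bar> * \<bar>F (x + s *\<^sub>R h)\<bar>"
          using C[OF True, of x] by (intro mult_right_mono) auto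
        then show ?thesis using True by (simp add: abs_mult mult.commute)
      qed simp
    qed
  qed measurable
qed

lemma integrable_real_mult_bounded:
  fixes f k :: "'a \<Rightarrow> real"
  assumes "integrable M f" "k \<in> borel_measurable M" "\<And>x. \<bar>k x\<bar> \<le> C"
  shows "integrable M (\<lambda>x. f x * k x)"
proof (rule Bochner_Integration.integrable_bound)
  show "integrable M (\<lambda>x. C * f x)" using assms(1) by (rule integrable_mult_right)
  show "(\<lambda>x. f x * k x) \<in> borel_measurable M" using assms(1,2) by simp
  have "\<bar>f x\<bar> * \<bar>k x\<bar> \<le> \<bar>f x\<bar> * \<bar>C\<bar>" for x using assms(3)[of x] by (intro mult_left_mono) auto
  then show "AE x in M. norm (f x * k x) \<le> norm (C * f x)" by (simp add: abs_mult mult.commute)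
qed

lemma test_functions_imp_C_c: "\<phi> \<in> test_functions \<Omega> \<Longrightarrow> \<phi> \<in> C_c 1"
  unfolding test_functions_def C_c_def by blast

context
  fixes \<psi> :: "'a::euclidean_space \<Rightarrow> real"
  assumes \<psi>: "\<psi> \<in> C_c 1"
begin

lemma C_c_compact: "compact (closure {x. \<psi> x \<noteq> 0})"
  using \<psi> by (simp add: C_c_def)

lemma C_c_has_derivative: "(\<psi> has_derivative frechet_derivative \<psi> (at x)) (at x)"
  using \<psi> C_k_SucD(1)[of 0 \<psi>] by (simp add: C_c_def)

lemma C_c_continuous: "continuous_on UNIV \<psi>"
  using \<psi> unfolding C_c_def by (blast intro: C_k_imp_continuous)

lemma C_c_borel: "\<psi> \<in> borel_measurable borel"
  by (rule borel_measurable_continuous_onI[OF C_c_continuous])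

lemma C_c_derivative_sum:
  "frechet_derivative \<psi> (at x) h = (\<Sum>i\<in>Basis. (h \<bullet> i) * frechet_derivative \<psi> (at x) i)"
proof -
  interpret bounded_linear "frechet_derivative \<psi> (at x)"
    using C_c_has_derivative by (rule has_derivative_bounded_linear)
  have "frechet_derivative \<psi> (at x) h = frechet_derivative \<psi> (at x) (\<Sum>i\<in>Basis. (h \<bullet> i) *\<^sub>R i)"
    by (simp add: euclidean_representation)
  then show ?thesis by (simp add: sum scaleR)
qed

lemma C_c_derivative_continuous: "continuous_on UNIV (\<lambda>x. frechet_derivative \<psi> (at x) h)"
proof -
  have "C_k 0 (\<lambda>x. frechet_derivative \<psi> (at x) i)" if "i \<in> Basis" for i
    using \<psi> C_k_SucD(2)[of 0 \<psi>] that by (simp add: C_c_def)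
  then show ?thesis
    unfolding C_c_derivative_sum[of _ h] by (intro continuous_intros) auto
qed

lemma C_c_derivative_borel: "(\<lambda>x. frechet_derivative \<psi> (at x) h) \<in> borel_measurable borel"
  by (rule borel_measurable_continuous_onI[OF C_c_derivative_continuous])

lemma C_c_derivative_eq_0:
  assumes "x \<notin> closure {x. \<psi> x \<noteq> 0}"
  shows "frechet_derivative \<psi> (at x) h = 0"
proof -
  have "((\<lambda>_. 0) has_derivative frechet_derivative \<psi> (at x)) (at x)"
    using C_c_has_derivative
  proof (rule has_derivative_transform_within_open[where s = "- closure {x. \<psi> x \<noteq> 0}"])
    fix y assume "y \<in> - closure {x. \<psi> x \<noteq> 0}"
    then show "\<psi> y = 0" using closure_subset[of "{x. \<psi> x \<noteq> 0}"] by auto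
  qed (use assms in auto)
  then have "frechet_derivative \<psi> (at x) = (\<lambda>_. 0)"
    using has_derivative_unique[OF _ has_derivative_const] by blast
  then show ?thesis by simp
qed

lemma bounded_of_compact_support:
  fixes f :: "'a \<Rightarrow> real"
  assumes "continuous_on UNIV f" "\<And>x. x \<notin> closure {x. \<psi> x \<noteq> 0} \<Longrightarrow> f x = 0"
  obtains C where "0 \<le> C" "\<And>x. \<bar>f x\<bar> \<le> C"
proof -
  have "compact (f ` closure {x. \<psi> x \<noteq> 0})"
    using C_c_compact assms(1) by (intro compact_continuous_image continuous_on_subset[OF assms(1)]) auto
  then obtain B where B: "\<And>y. y \<in> f ` closure {x. \<psi> x \<noteq> 0} \<Longrightarrow> norm y \<le> B"
    using compact_imp_bounded bounded_iff by metis
  have "\<bar>f x\<bar> \<le> \<bar>B\<bar>" for x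
    using B[of "f x"] assms(2)[of x] by (cases "x \<in> closure {x. \<psi> x \<noteq> 0}") force+
  then show thesis using that[of "\<bar>B\<bar>"] by simp
qed

lemma C_c_bounded: obtains C where "0 \<le> C" "\<And>x. \<bar>\<psi> x\<bar> \<le> C"
  using bounded_of_compact_support[OF C_c_continuous] closure_subset by (metis (mono_tags, lifting) mem_Collect_eq subset_iff)

lemma C_c_derivative_bounded: obtains C where "0 \<le> C" "\<And>x. \<bar>frechet_derivative \<psi> (at x) h\<bar> \<le> C"
  using bounded_of_compact_support[OF C_c_derivative_continuous C_c_derivative_eq_0] by metis

lemma C_c_FTC:
  "\<psi> (y + h) - \<psi> y = (\<integral>s. indicator {0..1} s * frechet_derivative \<psi> (at (y + s *\<^sub>R h)) h \<partial>lborel)"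
proof -
  have "(\<integral>s. indicator {0..1} s *\<^sub>R frechet_derivative \<psi> (at (y + s *\<^sub>R h)) h \<partial>lborel) = \<psi> (y + 1 *\<^sub>R h) - \<psi> (y + 0 *\<^sub>R h)"
  proof (rule integral_FTC_atLeastAtMost)
    fix s :: real
    have "((\<lambda>s. y + s *\<^sub>R h) has_derivative (\<lambda>s. s *\<^sub>R h)) (at s within {0..1})"
      by (auto intro!: derivative_eq_intros)
    then have "((\<lambda>s. \<psi> (y + s *\<^sub>R h)) has_derivative (\<lambda>t. frechet_derivative \<psi> (at (y + s *\<^sub>R h)) (t *\<^sub>R h))) (at s within {0..1})"
      by (rule has_derivative_compose[OF _ C_c_has_derivative])
    moreover have "frechet_derivative \<psi> (at (y + s *\<^sub>R h)) (t *\<^sub>R h) = t *\<^sub>R frechet_derivative \<psi> (at (y + s *\<^sub>R h)) h" for t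
      using linear_scale[OF has_derivative_linear[OF C_c_has_derivative]] .
    ultimately show "((\<lambda>s. \<psi> (y + s *\<^sub>R h)) has_vector_derivative frechet_derivative \<psi> (at (y + s *\<^sub>R h)) h) (at s within {0..1})"
      by (simp add: has_vector_derivative_def)
  next
    have "continuous_on UNIV (\<lambda>s. frechet_derivative \<psi> (at (y + s *\<^sub>R h)) h)"
      by (rule continuous_on_compose2[OF C_c_derivative_continuous]) (auto intro!: continuous_intros)
    then show "continuous_on {0..1} (\<lambda>s. frechet_derivative \<psi> (at (y + s *\<^sub>R h)) h)"
      by (rule continuous_on_subset) simp
  qed simp
  then show ?thesis by simp
qed

end

text \<open>
  Borel representatives, extended by zero, of a function on \<open>\<Omega>\<close> and of its integrable weak gradient.
\<close>

locale weak_gradient_rep =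
  fixes \<Omega> :: "'a::euclidean_space set" and u :: "'a \<Rightarrow> real" and G :: "'a \<Rightarrow> 'a"
  assumes open_dom: "open \<Omega>" and convex_dom: "convex \<Omega>"
    and u_borel [measurable]: "u \<in> borel_measurable borel"
    and u_loc: "\<And>K. compact K \<Longrightarrow> K \<subseteq> \<Omega> \<Longrightarrow> integrable lborel (\<lambda>x. indicator K x * u x)"
    and u_0: "\<And>x. x \<notin> \<Omega> \<Longrightarrow> u x = 0"
    and G_integrable: "integrable lborel G" and G_0: "\<And>x. x \<notin> \<Omega> \<Longrightarrow> G x = 0"
    and weak: "\<And>\<phi> i. \<phi> \<in> test_functions \<Omega> \<Longrightarrow> i \<in> Basis \<Longrightarrow>
      (\<integral>x. u x * frechet_derivative \<phi> (at x) i \<partial>lborel) = - (\<integral>x. (G x \<bullet> i) * \<phi> x \<partial>lborel)"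
begin

lemma G_borel [measurable]: "G \<in> borel_measurable borel"
  using G_integrable by simp

lemma G_inner_integrable: "integrable lborel (\<lambda>x. G x \<bullet> h)"
  using G_integrable by (rule integrable_inner_left)

lemma integrable_u_times:
  assumes "compact K" "K \<subseteq> \<Omega>" "f \<in> borel_measurable borel" "\<And>x. \<bar>f x\<bar> \<le> C" "\<And>x. x \<notin> K \<Longrightarrow> f x = 0"
  shows "integrable lborel (\<lambda>x. u x * f x)"
proof (rule Bochner_Integration.integrable_bound)
  show "integrable lborel (\<lambda>x. C * (indicator K x * u x))"
    using u_loc[OF assms(1,2)] by (rule integrable_mult_right)
  show "(\<lambda>x. u x * f x) \<in> borel_measurable lborel" using assms(3) by simp
  have "norm (u x * f x) \<le> norm (C * (indicator K x * u x))" for x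
  proof (cases "x \<in> K")
    case True
    have "\<bar>f x\<bar> * \<bar>u x\<bar> \<le> \<bar>C\<bar> * \<bar>u x\<bar>" using assms(4)[of x] by (intro mult_right_mono) auto
    then show ?thesis using True by (simp add: abs_mult mult.commute)
  qed (simp add: assms(5))
  then show "AE x in lborel. norm (u x * f x) \<le> norm (C * (indicator K x * u x))" by simp
qed

lemma weak_direction:
  assumes \<phi>: "\<phi> \<in> test_functions \<Omega>"
  shows "(\<integral>x. u x * frechet_derivative \<phi> (at x) h \<partial>lborel) = - (\<integral>x. (G x \<bullet> h) * \<phi> x \<partial>lborel)"
proof -
  have \<phi>c: "\<phi> \<in> C_c 1" using \<phi> by (rule test_functions_imp_C_c)
  have K: "compact (closure {x. \<phi> x \<noteq> 0})" "closure {x. \<phi> x \<noteq> 0} \<subseteq> \<Omega>"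
    using \<phi> by (auto simp: test_functions_def)
  have ui: "integrable lborel (\<lambda>x. u x * frechet_derivative \<phi> (at x) i)" for i
  proof -
    obtain C where "\<And>x. \<bar>frechet_derivative \<phi> (at x) i\<bar> \<le> C" using C_c_derivative_bounded[OF \<phi>c] by metis
    then show ?thesis
      using C_c_derivative_eq_0[OF \<phi>c] by (intro integrable_u_times[OF K C_c_derivative_borel[OF \<phi>c]]) auto
  qed
  have gi: "integrable lborel (\<lambda>x. (G x \<bullet> i) * \<phi> x)" for i
  proof -
    obtain C where "\<And>x. \<bar>\<phi> x\<bar> \<le> C" using C_c_bounded[OF \<phi>c] by metis
    then show ?thesis
      using C_c_borel[OF \<phi>c] by (intro integrable_real_mult_bounded[OF G_inner_integrable]) simp_all
  qed
  have "(\<integral>x. u x * frechet_derivative \<phi> (at x) h \<partial>lborel) =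
      (\<integral>x. (\<Sum>i\<in>Basis. (h \<bullet> i) * (u x * frechet_derivative \<phi> (at x) i)) \<partial>lborel)"
    unfolding C_c_derivative_sum[OF \<phi>c, of _ h] by (simp add: sum_distrib_left mult.left_commute)
  also have "\<dots> = (\<Sum>i\<in>Basis. (h \<bullet> i) * (\<integral>x. u x * frechet_derivative \<phi> (at x) i \<partial>lborel))"
    using ui by (subst Bochner_Integration.integral_sum) auto
  also have "\<dots> = - (\<Sum>i\<in>Basis. (h \<bullet> i) * (\<integral>x. (G x \<bullet> i) * \<phi> x \<partial>lborel))"
    using weak[OF \<phi>] by (simp add: sum_negf)
  also have "(\<Sum>i\<in>Basis. (h \<bullet> i) * (\<integral>x. (G x \<bullet> i) * \<phi> x \<partial>lborel)) =
      (\<integral>x. (\<Sum>i\<in>Basis. (h \<bullet> i) * ((G x \<bullet> i) * \<phi> x)) \<partial>lborel)"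
    using gi by (subst Bochner_Integration.integral_sum) auto
  also have "\<dots> = (\<integral>x. (G x \<bullet> h) * \<phi> x \<partial>lborel)"
  proof (rule Bochner_Integration.integral_cong[OF refl])
    fix x
    show "(\<Sum>i\<in>Basis. (h \<bullet> i) * ((G x \<bullet> i) * \<phi> x)) = (G x \<bullet> h) * \<phi> x"
      unfolding euclidean_inner[of "G x" h] sum_distrib_right by (intro sum.cong) auto
  qed
  finally show ?thesis .
qed

section \<open>Differences of u as integrals of the gradient along segments\<close>

text \<open>The candidate for u(x + h) - u(x). Where the integrand along the segment is not
  integrable the value is 0 by default, which concerns only a null set of \<open>x\<close>.\<close>

definition W :: "'a \<Rightarrow> 'a \<Rightarrow> real" where
  "W h x = (\<integral>s. indicator {0..1} s * (G (x + s *\<^sub>R h) \<bullet> h) \<partial>lborel)"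

lemma W_pair_integrable:
  assumes "k \<in> borel_measurable borel" "\<And>x. \<bar>k x\<bar> \<le> C"
  shows "integrable (lborel \<Otimes>\<^sub>M lborel) (\<lambda>(s::real, x). indicator {0..1} s * ((G (x + s *\<^sub>R h) \<bullet> h) * k x))"
  using integrable_shift_pair[OF G_inner_integrable, of "\<lambda>(s, x). k x" C h h] assms by simp

lemma W_integrable: "integrable lborel (W h)"
  using lborel_pair.integrable_snd[OF W_pair_integrable[of "\<lambda>_. 1" 1 h]] by (simp add: W_def[abs_def])

lemma W_times:
  assumes k: "k \<in> borel_measurable borel" "\<And>x. \<bar>k x\<bar> \<le> C"
  shows "(\<integral>x. W h x * k x \<partial>lborel) =
    (\<integral>s. indicator {0..1} s * (\<integral>x. (G x \<bullet> h) * k (x - s *\<^sub>R h) \<partial>lborel) \<partial>lborel)"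
proof -
  have "(\<integral>x. W h x * k x \<partial>lborel) =
      (\<integral>x. (\<integral>s. indicator {0..1} s * ((G (x + s *\<^sub>R h) \<bullet> h) * k x) \<partial>lborel) \<partial>lborel)"
    unfolding W_def integral_mult_left_zero[symmetric] by (simp add: mult.assoc)
  also have "\<dots> = (\<integral>s. (\<integral>x. indicator {0..1} s * ((G (x + s *\<^sub>R h) \<bullet> h) * k x) \<partial>lborel) \<partial>lborel)"
    using lborel_pair.Fubini_integral[OF W_pair_integrable[OF k, of h]] .
  also have "\<dots> = (\<integral>s. indicator {0..1} s * (\<integral>x. (G x \<bullet> h) * k (x - s *\<^sub>R h) \<partial>lborel) \<partial>lborel)"
  proof (rule Bochner_Integration.integral_cong[OF refl])
    fix s :: real
    have "(\<integral>x. (G (x + s *\<^sub>R h) \<bullet> h) * k x \<partial>lborel) = (\<integral>x. (G x \<bullet> h) * k (x - s *\<^sub>R h) \<partial>lborel)"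
      using integral_lborel_shift[of "\<lambda>x. (G x \<bullet> h) * k (x - s *\<^sub>R h)" "s *\<^sub>R h"] k(1) by simp
    then show "(\<integral>x. indicator {0..1} s * ((G (x + s *\<^sub>R h) \<bullet> h) * k x) \<partial>lborel) =
        indicator {0..1} s * (\<integral>x. (G x \<bullet> h) * k (x - s *\<^sub>R h) \<partial>lborel)"
      by simp
  qed
  finally show ?thesis .
qed

text \<open>The support lies where both x and x + h belong to the domain, so by convexity each
  intermediate translate of it stays inside.\<close>

lemma test_function_translate:
  assumes \<phi>: "\<phi> \<in> test_functions {x. x \<in> \<Omega> \<and> x + h \<in> \<Omega>}" and s: "s \<in> {0..1}"
  shows "(\<lambda>x. \<phi> (x - s *\<^sub>R h)) \<in> test_functions \<Omega>"
    and "frechet_derivative (\<lambda>x. \<phi> (x - s *\<^sub>R h)) (at y) = frechet_derivative \<phi> (at (y - s *\<^sub>R h))"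
proof -
  have \<phi>c: "\<phi> \<in> C_c 1" using \<phi> by (rule test_functions_imp_C_c)
  let ?K = "closure {x. \<phi> x \<noteq> 0}"
  have K: "compact ?K" "?K \<subseteq> {x. x \<in> \<Omega> \<and> x + h \<in> \<Omega>}" "\<And>k. C_k k \<phi>"
    using \<phi> by (auto simp: test_functions_def)
  have "{x. \<phi> (x - s *\<^sub>R h) \<noteq> 0} = (\<lambda>x. s *\<^sub>R h + x) ` {x. \<phi> x \<noteq> 0}"
    by (auto simp: image_iff intro!: exI[of _ "_ - s *\<^sub>R h"])
  then have cl: "closure {x. \<phi> (x - s *\<^sub>R h) \<noteq> 0} = (\<lambda>x. s *\<^sub>R h + x) ` ?K"
    by (simp add: closure_translation)
  have "s *\<^sub>R h + x \<in> \<Omega>" if "x \<in> ?K" for x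
  proof -
    have "x \<in> \<Omega>" "x + h \<in> \<Omega>" using that K by auto
    then have "(1 - s) *\<^sub>R x + s *\<^sub>R (x + h) \<in> \<Omega>"
      using s by (intro convexD[OF convex_dom]) auto
    then show ?thesis by (simp add: algebra_simps)
  qed
  moreover have "C_k k (\<lambda>x. \<phi> (x - s *\<^sub>R h))" for k
    using C_k_affine[OF bounded_linear_ident K(3), of k "- (s *\<^sub>R h)"] by simp
  ultimately show "(\<lambda>x. \<phi> (x - s *\<^sub>R h)) \<in> test_functions \<Omega>"
    unfolding test_functions_def mem_Collect_eq cl using compact_translation[OF K(1), of "s *\<^sub>R h"] by auto
  have "((\<lambda>x. x - s *\<^sub>R h) has_derivative (\<lambda>x. x)) (at y)"
    by (auto intro!: derivative_eq_intros)
  then have "((\<lambda>x. \<phi> (x - s *\<^sub>R h)) has_derivative frechet_derivative \<phi> (at (y - s *\<^sub>R h))) (at y)"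
    by (rule has_derivative_compose[OF _ C_c_has_derivative[OF \<phi>c]])
  then show "frechet_derivative (\<lambda>x. \<phi> (x - s *\<^sub>R h)) (at y) = frechet_derivative \<phi> (at (y - s *\<^sub>R h))"
    using frechet_derivative_at by metis
qed

text \<open>The shift is moved to the test function, whose difference is the integral of its
  derivative along the segment. After exchanging the integrals, the weak gradient can be used for
  each translate separately.\<close>

lemma integral_difference:
  assumes \<phi>: "\<phi> \<in> test_functions {x. x \<in> \<Omega> \<and> x + h \<in> \<Omega>}"
  shows "integrable lborel (\<lambda>x. u (x + h) * \<phi> x)" "integrable lborel (\<lambda>x. u x * \<phi> x)"
    and "(\<integral>x. u (x + h) * \<phi> x \<partial>lborel) - (\<integral>x. u x * \<phi> x \<partial>lborel) = (\<integral>x. W h x * \<phi> x \<partial>lborel)"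
proof -
  have \<phi>c: "\<phi> \<in> C_c 1" using \<phi> by (rule test_functions_imp_C_c)
  note [measurable] = C_c_borel[OF \<phi>c]
  let ?K = "closure {x. \<phi> x \<noteq> 0}"
  have K: "compact ?K" "?K \<subseteq> {x. x \<in> \<Omega> \<and> x + h \<in> \<Omega>}"
    using \<phi> by (auto simp: test_functions_def)
  \<comment> \<open>The compact set swept by the support along \<open>h\<close>; u is integrable on
    it, which controls all translates simultaneously.\<close>
  define K' where "K' = (\<lambda>(s, x). x + s *\<^sub>R h) ` ({0..1} \<times> ?K)"
  have K': "compact K'" "K' \<subseteq> \<Omega>"
  proof -
    show "compact K'" unfolding K'_def split_def
      by (intro compact_continuous_image continuous_intros compact_Times K(1)) auto
    show "K' \<subseteq> \<Omega>"
    proof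
      fix y assume "y \<in> K'"
      then obtain s x where sx: "s \<in> {0..1}" "x \<in> ?K" "y = x + s *\<^sub>R h" by (auto simp: K'_def)
      then have "x \<in> \<Omega>" "x + h \<in> \<Omega>" using K by auto
      then have "(1 - s) *\<^sub>R x + s *\<^sub>R (x + h) \<in> \<Omega>"
        using sx(1) by (intro convexD[OF convex_dom]) auto
      then show "y \<in> \<Omega>" by (simp add: sx(3) algebra_simps)
    qed
  qed
  have inK': "y \<in> K'" if "y - s *\<^sub>R h \<in> ?K" "s \<in> {0..1}" for y s
    using that unfolding K'_def by (intro image_eqI[of _ _ "(s, y - s *\<^sub>R h)"]) auto
  obtain C where C: "\<And>x. \<bar>\<phi> x\<bar> \<le> C" using C_c_bounded[OF \<phi>c] by metis
  have \<phi>0: "\<phi> x = 0" if "x \<notin> ?K" for x using that closure_subset[of "{x. \<phi> x \<noteq> 0}"] by auto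
  have z: "\<phi> (y - s *\<^sub>R h) = 0" if "y \<notin> K'" "s \<in> {0..1}" for y s
    using inK' \<phi>0 that by blast
  have i1: "integrable lborel (\<lambda>y. u y * \<phi> (y - s *\<^sub>R h))" if s: "s \<in> {0..1}" for s
    using C z[OF _ s] by (intro integrable_u_times[OF K', of _ C]) auto
  show i0: "integrable lborel (\<lambda>x. u x * \<phi> x)" using i1[of 0] by simp
  have i1': "integrable lborel (\<lambda>y. u y * \<phi> (y - h))" using i1[of 1] by simp
  show i2: "integrable lborel (\<lambda>x. u (x + h) * \<phi> x)"
    using integrable_lborel_shift[OF i1', of h] by simp
  obtain B where B: "\<And>x. \<bar>frechet_derivative \<phi> (at x) h\<bar> \<le> B" using C_c_derivative_bounded[OF \<phi>c] by metis
  note [measurable] = C_c_derivative_borel[OF \<phi>c]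
  define k where "k = (\<lambda>(s, y). frechet_derivative \<phi> (at (y - s *\<^sub>R h)) h)"
  \<comment> \<open>The translation sits in the bounded factor \<open>k\<close>, so the general
    lemma is applied with zero shift of u.\<close>
  have pair: "integrable (lborel \<Otimes>\<^sub>M lborel)
      (\<lambda>(s::real, y). indicator {0..1} s * ((indicator K' y * u y) * frechet_derivative \<phi> (at (y - s *\<^sub>R h)) h))"
    using integrable_shift_pair[OF u_loc[OF K'], of k B 0] B unfolding k_def by simp
  have eq: "indicator {0..1} s * ((indicator K' y * u y) * frechet_derivative \<phi> (at (y - s *\<^sub>R h)) h) =
      indicator {0..1} s * (u y * frechet_derivative \<phi> (at (y - s *\<^sub>R h)) h)" for s :: real and y
    using inK'[of y s] C_c_derivative_eq_0[OF \<phi>c, of "y - s *\<^sub>R h" h] by (auto simp: indicator_def)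
  have "(\<integral>x. u (x + h) * \<phi> x \<partial>lborel) = (\<integral>y. u y * \<phi> (y - h) \<partial>lborel)"
    using integral_lborel_shift[of "\<lambda>y. u y * \<phi> (y - h)" h] by simp
  then have "(\<integral>x. u (x + h) * \<phi> x \<partial>lborel) - (\<integral>x. u x * \<phi> x \<partial>lborel) =
      (\<integral>y. u y * (\<phi> (y - h) - \<phi> y) \<partial>lborel)"
    using i1' i0 by (simp add: right_diff_distrib)
  also have "\<dots> = (\<integral>y. - (\<integral>s. indicator {0..1} s * (u y * frechet_derivative \<phi> (at (y - s *\<^sub>R h)) h) \<partial>lborel) \<partial>lborel)"
  proof (rule Bochner_Integration.integral_cong[OF refl])
    fix y
    have "frechet_derivative \<phi> (at x) (- h) = - frechet_derivative \<phi> (at x) h" for x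
      using linear_neg[OF has_derivative_linear[OF C_c_has_derivative[OF \<phi>c]]] .
    then have "\<phi> (y - h) - \<phi> y = - (\<integral>s. indicator {0..1} s * frechet_derivative \<phi> (at (y - s *\<^sub>R h)) h \<partial>lborel)"
      using C_c_FTC[OF \<phi>c, of y "- h"] by simp
    then show "u y * (\<phi> (y - h) - \<phi> y) =
        - (\<integral>s. indicator {0..1} s * (u y * frechet_derivative \<phi> (at (y - s *\<^sub>R h)) h) \<partial>lborel)"
      by (simp add: mult.left_commute)
  qed
  also have "\<dots> = - (\<integral>s. (\<integral>y. indicator {0..1} s * (u y * frechet_derivative \<phi> (at (y - s *\<^sub>R h)) h) \<partial>lborel) \<partial>lborel)"
    using lborel_pair.Fubini_integral[OF pair] unfolding eq by simp
  \<comment> \<open>For each \<open>s\<close> in [0, 1] the translate is itself a test function, so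
    its derivative moves onto G.\<close>
  also have "\<dots> = - (\<integral>s. indicator {0..1} s * - (\<integral>x. (G x \<bullet> h) * \<phi> (x - s *\<^sub>R h) \<partial>lborel) \<partial>lborel)"
  proof (rule arg_cong[of _ _ uminus], rule Bochner_Integration.integral_cong[OF refl])
    fix s :: real
    show "(\<integral>y. indicator {0..1} s * (u y * frechet_derivative \<phi> (at (y - s *\<^sub>R h)) h) \<partial>lborel) =
        indicator {0..1} s * - (\<integral>x. (G x \<bullet> h) * \<phi> (x - s *\<^sub>R h) \<partial>lborel)"
    proof (cases "s \<in> {0..1}")
      case True
      then show ?thesis
        using weak_direction[OF test_function_translate(1)[OF \<phi> True], of h] test_function_translate(2)[OF \<phi> True]
        by simp
    qed simp
  qed
  also have "\<dots> = (\<integral>x. W h x * \<phi> x \<partial>lborel)"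
    using W_times[of \<phi> C h] C by simp
  finally show "(\<integral>x. u (x + h) * \<phi> x \<partial>lborel) - (\<integral>x. u x * \<phi> x \<partial>lborel) = (\<integral>x. W h x * \<phi> x \<partial>lborel)" .
qed

text \<open>The fundamental lemma is applied on the open set of points \<open>x\<close> for which
  both \<open>x\<close> and \<open>x + h\<close> lie in the domain.\<close>

lemma difference_eq_W: "AE x in lborel. x \<in> \<Omega> \<and> x + h \<in> \<Omega> \<longrightarrow> u (x + h) - u x = W h x"
proof -
  let ?D = "{x. x \<in> \<Omega> \<and> x + h \<in> \<Omega>}"
  have W_borel [measurable]: "W h \<in> borel_measurable borel" using W_integrable by simp
  have D_eq: "?D = \<Omega> \<inter> (\<lambda>x. x + h) -` \<Omega>" by auto
  have D: "open ?D"
    unfolding D_eq using open_dom by (intro open_Int open_vimage continuous_intros)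
  have "AE x in lebesgue. x \<in> ?D \<longrightarrow> (u (x + h) - u x) - W h x = 0"
  proof (rule fundamental_lemma_calculus_of_variations[OF D])
    show "(\<lambda>x. (u (x + h) - u x) - W h x) \<in> L1_loc lebesgue ?D"
      unfolding L1_loc_def
    proof (intro CollectI allI impI)
      fix K assume K: "compact K \<and> K \<subseteq> ?D"
      have K2: "compact ((\<lambda>x. x + h) ` K)" "(\<lambda>x. x + h) ` K \<subseteq> \<Omega>"
        using K by (auto intro!: compact_continuous_image continuous_intros)
      have "integrable lborel (\<lambda>x. indicator ((\<lambda>x. x + h) ` K) (x + h) * u (x + h))"
        by (rule integrable_lborel_shift[OF u_loc[OF K2]])
      moreover have "indicator ((\<lambda>x. x + h) ` K) (x + h) = (indicator K x :: real)" for x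
        by (auto simp: indicator_def)
      ultimately have "integrable lborel (\<lambda>x. indicator K x * u (x + h))" by simp
      moreover have "integrable lborel (\<lambda>x. indicator K x * u x)" using K by (intro u_loc) auto
      moreover have "integrable lborel (\<lambda>x. indicator K x * W h x)"
      proof -
        have "(indicator K :: 'a \<Rightarrow> real) \<in> borel_measurable lborel" using K by (intro borel_measurable_indicator) (simp add: borel_compact)
        then have "integrable lborel (\<lambda>x. W h x * indicator K x)"
          by (rule integrable_real_mult_bounded[OF W_integrable, where C = 1]) (simp add: indicator_def)
        then show ?thesis by (simp add: mult.commute)
      qed
      ultimately have "integrable lborel (\<lambda>x. indicator K x * ((u (x + h) - u x) - W h x))"
        by (simp add: right_diff_distrib)
      then show "set_integrable lebesgue K (\<lambda>x. (u (x + h) - u x) - W h x)"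
        unfolding set_integrable_def using K by (simp add: integrable_completion borel_compact)
    qed
  next
    fix \<phi> assume \<phi>: "\<phi> \<in> test_functions ?D"
    have \<phi>c: "\<phi> \<in> C_c 1" using \<phi> by (rule test_functions_imp_C_c)
    note [measurable] = C_c_borel[OF \<phi>c]
    obtain C where C: "\<And>x. \<bar>\<phi> x\<bar> \<le> C" using C_c_bounded[OF \<phi>c] by metis
    have "\<phi> x = 0" if "x \<notin> ?D" for x
      using \<phi> that closure_subset[of "{x. \<phi> x \<noteq> 0}"] by (auto simp: test_functions_def)
    then have "(LINT x:?D|lebesgue. (u (x + h) - u x - W h x) * \<phi> x) =
        (\<integral>x. (u (x + h) - u x - W h x) * \<phi> x \<partial>lebesgue)"
      unfolding set_lebesgue_integral_def by (intro Bochner_Integration.integral_cong) (auto simp: indicator_def)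
    also have "\<dots> = (\<integral>x. (u (x + h) * \<phi> x - u x * \<phi> x) - W h x * \<phi> x \<partial>lborel)"
      by (subst integral_completion) (auto simp: left_diff_distrib)
    also have "\<dots> = 0"
    proof -
      have "integrable lborel (\<lambda>x. W h x * \<phi> x)"
        using integrable_real_mult_bounded[OF W_integrable _ C] by simp
      then show ?thesis using integral_difference[OF \<phi>] by simp
    qed
    finally show "(LINT x:?D|lebesgue. (u (x + h) - u x - W h x) * \<phi> x) = 0" .
  qed
  then show ?thesis unfolding AE_completion_iff by eventually_elim auto
qed

end

section \<open>The strip\<close>

lemma AE_pairI:
  fixes P :: "'c::euclidean_space \<times> 'd::euclidean_space \<Rightarrow> bool"
  assumes "{z. P z} \<in> sets borel" "AE x in lborel. AE y in lborel. P (x, y)"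
  shows "AE z in lborel. P z"
proof -
  have "AE z in lborel \<Otimes>\<^sub>M lborel. P z"
  proof (rule lborel_pair.AE_pair_measure)
    show "{z \<in> space (lborel \<Otimes>\<^sub>M lborel). P z} \<in> sets (lborel \<Otimes>\<^sub>M lborel)"
      unfolding lborel_prod using assms(1) by simp
  qed (rule assms(2))
  then show ?thesis unfolding lborel_prod .
qed

lemma AE_pairD:
  fixes P :: "'c::euclidean_space \<times> 'd::euclidean_space \<Rightarrow> bool"
  assumes "AE z in lborel. P z"
  shows "AE x in lborel. AE y in lborel. P (x, y)"
  using assms unfolding lborel_prod[symmetric] by (rule lborel_pair.AE_pair)

lemma AE_fst:
  fixes P :: "'c::euclidean_space \<Rightarrow> bool"
  assumes "AE x in lborel. P x"
  shows "AE z in (lborel :: ('c \<times> 'd::euclidean_space) measure). P (fst z)"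
proof -
  obtain N where N: "{x. \<not> P x} \<subseteq> N" "emeasure lborel N = 0" "N \<in> sets borel"
    using assms by (auto elim!: AE_E)
  have "AE x in lborel. x \<notin> N" using N by (intro AE_not_in) (auto simp: null_sets_def)
  then have "AE x in lborel. AE y in (lborel :: 'd measure). fst (x, y) \<notin> N"
    by eventually_elim simp
  moreover have "{z :: 'c \<times> 'd. fst z \<notin> N} \<in> sets borel"
  proof -
    have "{z :: 'c \<times> 'd. fst z \<notin> N} = (- N) \<times> UNIV" by auto
    then show ?thesis using N(3) by (simp add: borel_Times)
  qed
  ultimately have "AE z in (lborel :: ('c \<times> 'd) measure). fst z \<notin> N" by (intro AE_pairI) auto
  then show ?thesis by eventually_elim (use N(1) in auto)
qed

lemma integrable_pair_times:
  fixes f :: "'c::euclidean_space \<Rightarrow> real" and k :: "'d::euclidean_space \<Rightarrow> real"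
  assumes f: "integrable lborel f" and k: "integrable lborel k"
  shows "integrable (lborel \<Otimes>\<^sub>M lborel) (\<lambda>(x, y). f x * k y)"
proof (rule lborel_pair.Fubini_integrable)
  have [measurable]: "f \<in> borel_measurable borel" "k \<in> borel_measurable borel" using f k by auto
  show "(\<lambda>(x, y). f x * k y) \<in> borel_measurable (lborel \<Otimes>\<^sub>M lborel)" by measurable
  have "(\<integral>y. norm (case (x, y) of (x, y) \<Rightarrow> f x * k y) \<partial>lborel) = \<bar>f x\<bar> * (\<integral>y. \<bar>k y\<bar> \<partial>lborel)" for x
    by (simp add: abs_mult)
  then show "integrable lborel (\<lambda>x. \<integral>y. norm (case (x, y) of (x, y) \<Rightarrow> f x * k y) \<partial>lborel)"
    using f by simp
qed (use k in auto)

lemma ennreal_abs_integral_le: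
  fixes f :: "'c \<Rightarrow> real"
  shows "ennreal \<bar>\<integral>x. f x \<partial>M\<bar> \<le> (\<integral>\<^sup>+x. ennreal \<bar>f x\<bar> \<partial>M)"
proof (cases "integrable M f")
  case True
  then show ?thesis using integral_norm_bound_ennreal[OF True] by simp
qed (simp add: not_integrable_integral_eq)

lemma nn_integral_strip:
  fixes \<phi> :: "'c::euclidean_space \<Rightarrow> ennreal" and I :: "real set"
  assumes [measurable]: "\<phi> \<in> borel_measurable borel" "I \<in> sets borel"
  shows "(\<integral>\<^sup>+z. indicator (UNIV \<times> I) z * \<phi> (fst z) \<partial>lborel) = emeasure lborel I * (\<integral>\<^sup>+x. \<phi> x \<partial>lborel)"
proof -
  have "(\<integral>\<^sup>+z. indicator (UNIV \<times> I) z * \<phi> (fst z) \<partial>lborel) =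
      (\<integral>\<^sup>+z. (case z of (x, t) \<Rightarrow> \<phi> x * indicator I t) \<partial>(lborel \<Otimes>\<^sub>M lborel))"
    unfolding lborel_prod by (intro nn_integral_cong) (auto simp: indicator_def)
  also have "\<dots> = (\<integral>\<^sup>+x. \<integral>\<^sup>+t. \<phi> x * indicator I t \<partial>lborel \<partial>lborel)"
    by (subst lborel.nn_integral_fst[symmetric]) auto
  also have "\<dots> = (\<integral>\<^sup>+x. \<phi> x * emeasure lborel I \<partial>lborel)"
    by (simp add: nn_integral_cmult_indicator)
  also have "\<dots> = emeasure lborel I * (\<integral>\<^sup>+x. \<phi> x \<partial>lborel)"
    by (subst nn_integral_multc) (auto simp: mult.commute)
  finally show ?thesis .
qed

section \<open>Vertical decomposition of u\<close>

locale strip_rep = weak_gradient_rep "UNIV \<times> {bm<..<bp}" u G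
  for bm bp :: real and u :: "'b::euclidean_space \<times> real \<Rightarrow> real" and G +
  assumes bm_less_bp: "bm < bp"
begin

definition g :: "'b \<times> real \<Rightarrow> real" where
  "g z = G z \<bullet> (0, 1)"

lemma g_integrable: "integrable lborel g"
  unfolding g_def[abs_def] by (rule G_inner_integrable)

lemma g_borel [measurable]: "g \<in> borel_measurable borel"
  using g_integrable by simp

lemma g_0: "t \<notin> {bm<..<bp} \<Longrightarrow> g (x, t) = 0"
  by (simp add: g_def G_0)

lemma g_pair_integrable: "integrable (lborel \<Otimes>\<^sub>M lborel) g"
  using g_integrable by (simp add: lborel_prod)

text \<open>The vertical antiderivative of \<open>g\<close>, started at minus infinity, which
  amounts to \<open>bm\<close> because \<open>g\<close> vanishes below. The conditional, in place of
  an indicator of a moving interval, lets joint measurability be derived automatically.\<close>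

definition V :: "'b \<times> real \<Rightarrow> real" where
  "V z = (\<integral>s. (if s \<le> snd z then g (fst z, s) else 0) \<partial>lborel)"

lemma V_borel [measurable]: "V \<in> borel_measurable borel"
proof -
  have "(\<lambda>z. \<integral>s. (if s \<le> snd z then g (fst z, s) else 0) \<partial>lborel) \<in> borel_measurable (borel \<Otimes>\<^sub>M borel)"
    by measurable
  then show ?thesis by (simp add: V_def[abs_def] borel_prod)
qed

abbreviation slice_integrable :: "'b \<Rightarrow> bool" where
  "slice_integrable x \<equiv> integrable lborel (\<lambda>t. g (x, t))"

lemma AE_slice_integrable: "AE x in lborel. slice_integrable x"
  using lborel_pair.AE_integrable_fst'[OF g_pair_integrable] .

lemma slice_if_integrable:
  assumes "slice_integrable x" "A \<in> sets borel"
  shows "integrable lborel (\<lambda>s. indicator A s * g (x, s))"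
  using assms by (intro Bochner_Integration.integrable_bound[OF assms(1)]) (auto simp: indicator_def)

lemma V_eq: "V (x, t) = (\<integral>s. indicator {..t} s * g (x, s) \<partial>lborel)"
  unfolding V_def by (intro Bochner_Integration.integral_cong) (auto simp: indicator_def)

lemma V_diff:
  assumes x: "slice_integrable x" and "a \<le> b"
  shows "V (x, b) - V (x, a) = (\<integral>s. indicator {a..b} s * g (x, s) \<partial>lborel)"
proof -
  have "V (x, b) - V (x, a) = (\<integral>s. indicator {..b} s * g (x, s) - indicator {..a} s * g (x, s) \<partial>lborel)"
    unfolding V_eq using slice_if_integrable[OF x] by (subst Bochner_Integration.integral_diff) auto
  also have "\<dots> = (\<integral>s. indicator {a..b} s * g (x, s) \<partial>lborel)"
  proof (rule integral_cong_AE)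
    have "AE s in lborel. s \<noteq> a" by (rule AE_lborel_singleton)
    then show "AE s in lborel. indicator {..b} s * g (x, s) - indicator {..a} s * g (x, s) = indicator {a..b} s * g (x, s)"
      by eventually_elim (use \<open>a \<le> b\<close> in \<open>auto simp: indicator_def\<close>)
  qed measurable
  finally show ?thesis .
qed

lemma V_bm: "V (x, bm) = 0"
proof -
  have "V (x, bm) = (\<integral>s. 0 \<partial>(lborel :: real measure))"
    unfolding V_eq by (intro Bochner_Integration.integral_cong) (auto simp: indicator_def g_0)
  then show ?thesis by simp
qed

lemma V_abs_le:
  assumes x: "slice_integrable x"
  shows "\<bar>V (x, t)\<bar> \<le> (\<integral>s. \<bar>g (x, s)\<bar> \<partial>lborel)"
proof -
  have "\<bar>V (x, t)\<bar> \<le> (\<integral>s. \<bar>indicator {..t} s * g (x, s)\<bar> \<partial>lborel)"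
    unfolding V_eq by (rule integral_abs_bound)
  also have "\<dots> \<le> (\<integral>s. \<bar>g (x, s)\<bar> \<partial>lborel)"
    using slice_if_integrable[OF x, of "{..t}"] x by (intro integral_mono) (auto simp: indicator_def)
  finally show ?thesis .
qed

text \<open>Substitution of t + r s for the segment parameter; a negative \<open>r\<close> reverses
  the orientation.\<close>

lemma W_vertical:
  assumes x: "slice_integrable x"
  shows "W (0, r) (x, t) = V (x, t + r) - V (x, t)"
proof -
  define f where "f \<sigma> = indicator {min t (t + r)..max t (t + r)} \<sigma> * g (x, \<sigma>)" for \<sigma>
  have W: "W (0, r) (x, t) = r * (\<integral>s. indicator {0..1} s * g (x, t + r * s) \<partial>lborel)"
    unfolding W_def integral_mult_right_zero[symmetric]
    by (intro Bochner_Integration.integral_cong refl) (simp add: g_def inner_Pair_0 inner_prod_def algebra_simps)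
  consider "r = 0" | "0 < r" | "r < 0" by linarith
  then show ?thesis
  proof cases
    case 2
    have eq: "f (t + r * s) = indicator {0..1} s * g (x, t + r * s)" for s
    proof -
      have "0 \<le> r * s \<longleftrightarrow> 0 \<le> s" "r * s \<le> r \<longleftrightarrow> s \<le> 1" using 2 by (auto simp: zero_le_mult_iff)
      then show ?thesis using 2 by (auto simp: f_def indicator_def min_def max_def)
    qed
    have "(\<integral>s. f s \<partial>lborel) = \<bar>r\<bar> *\<^sub>R (\<integral>s. f (t + r * s) \<partial>lborel)"
      using 2 by (intro lborel_integral_real_affine) simp
    then have "W (0, r) (x, t) = (\<integral>s. f s \<partial>lborel)" using 2 by (simp add: W eq)
    then show ?thesis using V_diff[OF x, of t "t + r"] 2 by (simp add: f_def[abs_def] min_def max_def)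
  next
    case 3
    have eq: "f (t + r * s) = indicator {0..1} s * g (x, t + r * s)" for s
    proof -
      have "r * s \<le> 0 \<longleftrightarrow> 0 \<le> s" "r \<le> r * s \<longleftrightarrow> s \<le> 1" using 3 by (auto simp: mult_le_0_iff)
      then show ?thesis using 3 by (auto simp: f_def indicator_def min_def max_def)
    qed
    have "(\<integral>s. f s \<partial>lborel) = \<bar>r\<bar> *\<^sub>R (\<integral>s. f (t + r * s) \<partial>lborel)"
      using 3 by (intro lborel_integral_real_affine) simp
    then have "W (0, r) (x, t) = - (\<integral>s. f s \<partial>lborel)" using 3 by (simp add: W eq)
    then show ?thesis using V_diff[OF x, of "t + r" t] 3 by (simp add: f_def[abs_def] min_def max_def)
  next
    case 1
    then show ?thesis using W by simp
  qed
qed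

definition Z :: "'b \<times> real \<Rightarrow> real" where
  "Z z = u z - V z"

lemma Z_borel [measurable]: "Z \<in> borel_measurable borel"
  unfolding Z_def[abs_def] by measurable

text \<open>\<open>Z = u - V\<close> does not depend on the last coordinate, by Fubini in the shift parameter.\<close>

lemma AE_Z_const: "AE x in lborel. \<exists>c. AE t in lborel. bm < t \<and> t < bp \<longrightarrow> Z (x, t) = c"
proof -
  let ?P = "\<lambda>(r::real) (z :: 'b \<times> real). bm < snd z \<and> snd z < bp \<and> bm < snd z + r \<and> snd z + r < bp \<longrightarrow>
      Z (fst z, snd z + r) = Z z"
  have "AE z in lborel. ?P r z" for r
    using difference_eq_W[of "(0, r)"] AE_fst[OF AE_slice_integrable]
  proof eventually_elim
    case (elim z)
    then show ?case using W_vertical[of "fst z" r "snd z"] by (cases z) (auto simp: Z_def)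
  qed
  then have "AE r in lborel. AE z in lborel. ?P r z" by simp
  \<comment> \<open>The exceptional null set depends on the shift \<open>r\<close>. Exchanging the
    quantifiers gives, for almost every x, one height in the interval from which almost every other
    height can be compared.\<close>
  also have "(AE r in lborel. AE z in lborel. ?P r z) \<longleftrightarrow> (AE z in lborel. AE r in lborel. ?P r z)"
  proof (rule lborel_pair.AE_commute)
    have [measurable]: "Z \<in> borel_measurable (borel \<Otimes>\<^sub>M borel)" using Z_borel by (simp add: borel_prod)
    have "Measurable.pred (borel \<Otimes>\<^sub>M (borel \<Otimes>\<^sub>M borel)) (\<lambda>p. ?P (fst p) (snd p))"
      by measurable
    then have "Measurable.pred (borel \<Otimes>\<^sub>M borel) (\<lambda>p. ?P (fst p) (snd p))"
      unfolding borel_prod .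
    then show "{p \<in> space (lborel \<Otimes>\<^sub>M lborel). ?P (fst p) (snd p)} \<in> sets (lborel \<Otimes>\<^sub>M lborel)"
      by (simp add: pred_def space_pair_measure cong: sets_pair_measure_cong)
  qed
  finally have "AE x in lborel. AE t in lborel. AE r in lborel. ?P r (x, t)"
    by (rule AE_pairD)
  then show ?thesis
  proof eventually_elim
    case (elim x)
    have "\<exists>t. bm < t \<and> t < bp \<and> (AE r in lborel. ?P r (x, t))"
    proof (rule ccontr)
      assume no: "\<not> ?thesis"
      have "AE t in lborel. t \<notin> {bm<..<bp}"
        using elim by eventually_elim (use no in auto)
      moreover have "(AE t in lborel. t \<notin> {bm<..<bp}) \<longleftrightarrow> emeasure lborel {bm<..<bp} = 0"
        by (rule AE_iff_measurable) auto
      ultimately have "emeasure lborel {bm<..<bp} = 0" by blast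
      then show False using bm_less_bp by simp
    qed
    then obtain t where t: "bm < t" "t < bp" "AE r in lborel. ?P r (x, t)" by blast
    have "AE s in lborel. ?P (s + - t) (x, t)" by (rule AE_lborel_shift[OF t(3)])
    then have "AE s in lborel. bm < s \<and> s < bp \<longrightarrow> Z (x, s) = Z (x, t)"
      by eventually_elim (use t in auto)
    then show ?case by blast
  qed
qed

text \<open>The closed middle half of the interval. It stays away from the boundary because u is so
  far integrable only on compact subsets of the open strip.\<close>

definition J :: "real set" where
  "J = {(3 * bm + bp) / 4..(bm + 3 * bp) / 4}"

lemma J_subset: "J \<subseteq> {bm<..<bp}"
  using bm_less_bp by (auto simp: J_def)

text \<open>The average of \<open>Z\<close> over \<open>J\<close>, whose length is half of bp - bm.
  Averaging selects the constant of each vertical line in a measurable way.\<close>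

definition w :: "'b \<Rightarrow> real" where
  "w x = 2 / (bp - bm) * (\<integral>s. indicator J s * Z (x, s) \<partial>lborel)"

lemma w_borel [measurable]: "w \<in> borel_measurable borel"
proof -
  have [measurable]: "J \<in> sets borel" by (simp add: J_def)
  show ?thesis unfolding w_def[abs_def] by measurable
qed

lemma u_decomposition: "AE x in lborel. AE t in lborel. bm < t \<and> t < bp \<longrightarrow> u (x, t) = w x + V (x, t)"
  using AE_Z_const
proof eventually_elim
  case (elim x)
  then obtain c where c: "AE t in lborel. bm < t \<and> t < bp \<longrightarrow> Z (x, t) = c" by blast
  have "(\<integral>s. indicator J s * Z (x, s) \<partial>lborel) = (\<integral>s. indicator J s * c \<partial>lborel)"
  proof (rule integral_cong_AE)
    show "AE s in lborel. indicator J s * Z (x, s) = indicator J s * c"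
      using c by eventually_elim (use J_subset in \<open>auto simp: indicator_def\<close>)
  qed (auto simp: J_def)
  also have "\<dots> = (bp - bm) / 2 * c"
    using bm_less_bp by (simp add: J_def field_simps)
  finally have "w x = c" using bm_less_bp by (simp add: w_def field_simps)
  show ?case using c by eventually_elim (use \<open>w x = c\<close> in \<open>auto simp: Z_def\<close>)
qed

text \<open>On a vertical line \<open>V\<close> is bounded by the integral of |g| over that line,
  which is an integrable function of x; a bounded set of heights adds only a finite factor.\<close>

lemma V_restrict_integrable:
  assumes "A \<in> sets borel" "bounded A"
  shows "integrable lborel (\<lambda>z. indicator (UNIV \<times> A) z * V z)"
proof -
  have [measurable]: "A \<in> sets borel" by fact
  have fin: "emeasure lborel A < \<infinity>" using emeasure_bounded_finite[OF assms(2)] .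
  define N where "N x = (\<integral>s. \<bar>g (x, s)\<bar> \<partial>lborel)" for x
  have N: "integrable lborel N"
    unfolding N_def[abs_def]
    using lborel_pair.integrable_fst'[OF integrable_abs[OF g_pair_integrable]] by simp
  have [measurable]: "N \<in> borel_measurable borel" using N by simp
  have "integrable (lborel \<Otimes>\<^sub>M lborel) (\<lambda>(x, t). N x * indicator A t)"
  proof (rule lborel_pair.Fubini_integrable)
    have "(\<integral>t. norm (case (x, t) of (x, t) \<Rightarrow> N x * indicator A t) \<partial>lborel) = \<bar>N x\<bar> * measure lborel A" for x
      using fin by (simp add: abs_mult)
    then show "integrable lborel (\<lambda>x. \<integral>t. norm (case (x, t) of (x, t) \<Rightarrow> N x * indicator A t) \<partial>lborel)"
      using N by simp
    show "AE x in lborel. integrable lborel (\<lambda>t. case (x, t) of (x, t) \<Rightarrow> N x * indicator A t)"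
      using fin by simp
  qed measurable
  then have i: "integrable lborel (\<lambda>(x, t). N x * indicator A t)" by (simp add: lborel_prod)
  show ?thesis
  proof (rule Bochner_Integration.integrable_bound[OF i])
    have "(UNIV :: 'b set) \<times> A \<in> sets borel" using assms(1) by (intro borel_Times) auto
    then show "(\<lambda>z. indicator (UNIV \<times> A) z * V z) \<in> borel_measurable lborel" by simp
    show "AE z in lborel. norm (indicator (UNIV \<times> A) z * V z) \<le> norm (case z of (x, t) \<Rightarrow> N x * indicator A t)"
      using AE_fst[OF AE_slice_integrable]
    proof eventually_elim
      case (elim z)
      have "\<bar>V z\<bar> \<le> \<bar>N (fst z)\<bar>" using V_abs_le[OF elim, of "snd z"] by (simp add: N_def)
      then show ?case by (cases z) (auto simp: indicator_def)
    qed
  qed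
qed

lemma w_loc_integrable:
  assumes K: "compact K"
  shows "integrable lborel (\<lambda>x. indicator K x * w x)"
proof -
  have JK: "compact (K \<times> J)" "K \<times> J \<subseteq> UNIV \<times> {bm<..<bp}"
    using K J_subset by (auto simp: J_def compact_Times)
  have "integrable lborel (\<lambda>z. indicator (K \<times> J) z * V z)"
  proof (rule Bochner_Integration.integrable_bound)
    show "integrable lborel (\<lambda>z. indicator (UNIV \<times> J) z * V z)"
      by (rule V_restrict_integrable) (auto simp: J_def)
    show "(\<lambda>z. indicator (K \<times> J) z * V z) \<in> borel_measurable lborel"
      using borel_compact[OF JK(1)] by simp
  qed (auto simp: indicator_def)
  then have "integrable lborel (\<lambda>z. indicator (K \<times> J) z * u z - indicator (K \<times> J) z * V z)"
    using u_loc[OF JK] by (intro Bochner_Integration.integrable_diff)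
  then have "integrable (lborel \<Otimes>\<^sub>M lborel) (\<lambda>z. indicator (K \<times> J) z * Z z)"
    by (simp add: Z_def right_diff_distrib lborel_prod)
  from lborel_pair.integrable_fst'[OF this]
  have "integrable lborel (\<lambda>x. \<integral>s. indicator K x * (indicator J s * Z (x, s)) \<partial>lborel)"
    by (simp add: indicator_times mult.assoc)
  then have "integrable lborel (\<lambda>x. 2 / (bp - bm) * (\<integral>s. indicator K x * (indicator J s * Z (x, s)) \<partial>lborel))"
    by (rule integrable_mult_right)
  then show ?thesis by (simp add: w_def mult.left_commute)
qed

lemma u_eq_AE: "AE z in lborel. u z = indicator (UNIV \<times> {bm<..<bp}) z * (w (fst z) + V z)"
proof (rule AE_pairI)
  show "{z. u z = indicator (UNIV \<times> {bm<..<bp}) z * (w (fst z) + V z)} \<in> sets borel"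
  proof -
    have "(UNIV :: 'b set) \<times> {bm<..<bp} \<in> sets borel" by (simp add: borel_Times)
    moreover have "(\<lambda>z. w (fst z)) \<in> borel_measurable (borel \<Otimes>\<^sub>M (borel :: real measure))" by measurable
    ultimately have "(\<lambda>z. u z - indicator (UNIV \<times> {bm<..<bp}) z * (w (fst z) + V z)) \<in> borel_measurable borel"
      by (simp add: borel_prod)
    from measurable_sets[OF this, of "{0}"] show ?thesis by (simp add: vimage_def)
  qed
  show "AE x in lborel. AE t in lborel. u (x, t) = indicator (UNIV \<times> {bm<..<bp}) (x, t) * (w (fst (x, t)) + V (x, t))"
    using u_decomposition
  proof eventually_elim
    case (elim x)
    then show ?case by eventually_elim (auto simp: indicator_def u_0)
  qed
qed

text \<open>Integrability up to the boundary, which the assumptions on u do not give directly: both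
  parts of the decomposition w + V are integrable over \<open>K\<close> times the whole interval.
  This makes testing with functions that do not vanish on the boundary possible.\<close>

lemma u_loc_horizontal:
  assumes K: "compact K"
  shows "integrable lborel (\<lambda>z. indicator (K \<times> UNIV) z * u z)"
proof -
  have [measurable]: "K \<in> sets borel" using K by (rule borel_compact)
  have "integrable (lborel \<Otimes>\<^sub>M lborel) (\<lambda>(x, t). (indicator K x * w x) * indicator {bm<..<bp} t)"
  proof (rule lborel_pair.Fubini_integrable)
    have "(\<integral>t. norm (case (x, t) of (x, t) \<Rightarrow> (indicator K x * w x) * indicator {bm<..<bp} t) \<partial>lborel) =
        \<bar>indicator K x * w x\<bar> * (bp - bm)" for x
      using bm_less_bp by (simp add: abs_mult)
    then show "integrable lborel (\<lambda>x. \<integral>t. norm (case (x, t) of (x, t) \<Rightarrow> (indicator K x * w x) * indicator {bm<..<bp} t) \<partial>lborel)"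
      using integrable_abs[OF w_loc_integrable[OF K]] by simp
  qed (use bm_less_bp in auto)
  then have wi: "integrable lborel (\<lambda>(x, t). (indicator K x * w x) * indicator {bm<..<bp} t)"
    by (simp add: lborel_prod)
  have KU: "K \<times> (UNIV :: real set) \<in> sets borel" by (simp add: borel_Times)
  have "integrable lborel (\<lambda>z. indicator (K \<times> UNIV) z * (indicator (UNIV \<times> {bm<..<bp}) z * V z))"
  proof (rule Bochner_Integration.integrable_bound)
    show "integrable lborel (\<lambda>z. indicator (UNIV \<times> {bm<..<bp}) z * V z)"
      by (rule V_restrict_integrable) auto
    have "(UNIV :: 'b set) \<times> {bm<..<bp} \<in> sets borel" by (intro borel_Times) auto
    with KU show "(\<lambda>z. indicator (K \<times> UNIV) z * (indicator (UNIV \<times> {bm<..<bp}) z * V z)) \<in> borel_measurable lborel"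
      by simp
  qed (auto simp: indicator_def)
  with wi have s: "integrable lborel (\<lambda>z. (case z of (x, t) \<Rightarrow> (indicator K x * w x) * indicator {bm<..<bp} t) +
      indicator (K \<times> UNIV) z * (indicator (UNIV \<times> {bm<..<bp}) z * V z))"
    by (rule Bochner_Integration.integrable_add)
  have ae: "AE z in lborel. (case z of (x, t) \<Rightarrow> (indicator K x * w x) * indicator {bm<..<bp} t) +
      indicator (K \<times> UNIV) z * (indicator (UNIV \<times> {bm<..<bp}) z * V z) = indicator (K \<times> UNIV) z * u z"
    using u_eq_AE by eventually_elim (auto simp: indicator_def)
  have m: "(\<lambda>z. indicator (K \<times> UNIV) z * u z) \<in> borel_measurable lborel" using KU by simp
  show ?thesis
    using integrable_cong_AE[OF borel_measurable_integrable[OF s] m ae] s by simp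
qed

section \<open>Boundary values and their estimates\<close>

definition T :: "real \<Rightarrow> 'b \<Rightarrow> real" where
  "T b x = w x + V (x, b)"

lemma T_borel [measurable]: "T b \<in> borel_measurable borel"
proof -
  have [measurable]: "V \<in> borel_measurable (borel \<Otimes>\<^sub>M borel)" using V_borel by (simp add: borel_prod)
  show ?thesis unfolding T_def[abs_def] by measurable
qed

lemma T_loc_integrable:
  assumes K: "compact K"
  shows "integrable lborel (\<lambda>x. indicator K x * T b x)"
proof -
  have [measurable]: "K \<in> sets borel" using K by (rule borel_compact)
  have [measurable]: "V \<in> borel_measurable (borel \<Otimes>\<^sub>M borel)" using V_borel by (simp add: borel_prod)
  have "integrable lborel (\<lambda>x. \<integral>s. \<bar>g (x, s)\<bar> \<partial>lborel)"
    using lborel_pair.integrable_fst'[OF integrable_abs[OF g_pair_integrable]] by simp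
  then have "integrable lborel (\<lambda>x. indicator K x * V (x, b))"
  proof (rule Bochner_Integration.integrable_bound)
    show "AE x in lborel. norm (indicator K x * V (x, b)) \<le> norm (\<integral>s. \<bar>g (x, s)\<bar> \<partial>lborel)"
      using AE_slice_integrable by eventually_elim (use V_abs_le in \<open>auto simp: indicator_def\<close>)
  qed measurable
  then have "integrable lborel (\<lambda>x. indicator K x * w x + indicator K x * V (x, b))"
    by (intro Bochner_Integration.integrable_add w_loc_integrable K)
  then show ?thesis by (simp add: T_def distrib_left)
qed

lemma V_diff_le:
  assumes x: "slice_integrable x"
  shows "ennreal \<bar>V (x, t) - V (x, b)\<bar> \<le> (\<integral>\<^sup>+s. indicator {min t b..max t b} s * ennreal \<bar>g (x, s)\<bar> \<partial>lborel)"
proof -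
  have "\<bar>V (x, t) - V (x, b)\<bar> = \<bar>\<integral>s. indicator {min t b..max t b} s * g (x, s) \<partial>lborel\<bar>"
  proof (cases "t \<le> b")
    case True
    then show ?thesis using V_diff[OF x True] by (simp add: min_def max_def abs_minus_commute)
  next
    case False
    then show ?thesis using V_diff[OF x, of b t] by (simp add: min_def max_def)
  qed
  also have "ennreal \<dots> \<le> (\<integral>\<^sup>+s. ennreal \<bar>indicator {min t b..max t b} s * g (x, s)\<bar> \<partial>lborel)"
    by (rule ennreal_abs_integral_le)
  also have "\<dots> = (\<integral>\<^sup>+s. indicator {min t b..max t b} s * ennreal \<bar>g (x, s)\<bar> \<partial>lborel)"
    by (intro nn_integral_cong) (auto simp: indicator_def)
  finally show ?thesis .
qed

lemma T_diff_estimate: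
  "(\<integral>\<^sup>+x. ennreal \<bar>T bp x - T bm x\<bar> \<partial>lborel) \<le> (\<integral>\<^sup>+z. ennreal \<bar>g z\<bar> \<partial>lborel)"
proof -
  have [measurable]: "g \<in> borel_measurable (borel \<Otimes>\<^sub>M borel)" using g_borel by (simp add: borel_prod)
  have "(\<integral>\<^sup>+x. ennreal \<bar>T bp x - T bm x\<bar> \<partial>lborel) \<le> (\<integral>\<^sup>+x. \<integral>\<^sup>+s. ennreal \<bar>g (x, s)\<bar> \<partial>lborel \<partial>lborel)"
  proof (rule nn_integral_mono_AE)
    show "AE x in lborel. ennreal \<bar>T bp x - T bm x\<bar> \<le> (\<integral>\<^sup>+s. ennreal \<bar>g (x, s)\<bar> \<partial>lborel)"
      using AE_slice_integrable
    proof eventually_elim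
      case (elim x)
      have "ennreal \<bar>T bp x - T bm x\<bar> \<le> (\<integral>\<^sup>+s. indicator {min bp bm..max bp bm} s * ennreal \<bar>g (x, s)\<bar> \<partial>lborel)"
        using V_diff_le[OF elim, of bp bm] by (simp add: T_def)
      also have "\<dots> \<le> (\<integral>\<^sup>+s. ennreal \<bar>g (x, s)\<bar> \<partial>lborel)"
        by (intro nn_integral_mono) (auto simp: indicator_def)
      finally show ?case .
    qed
  qed
  also have "\<dots> = (\<integral>\<^sup>+z. ennreal \<bar>g z\<bar> \<partial>(lborel \<Otimes>\<^sub>M lborel))"
    by (subst lborel.nn_integral_fst[symmetric]) auto
  finally show ?thesis by (simp only: lborel_prod)
qed

text \<open>Here \<open>I\<close> is a layer of thickness \<epsilon> on one side of height
  \<open>b\<close>: the segment from a height in \<open>I\<close> to \<open>b\<close> stays in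
  \<open>I\<close> except for its end \<open>b\<close>. Integrating the pointwise bound over
  \<open>I\<close> puts a factor \<epsilon> on the left and on each of three terms on the right, the
  two vertical integrals and the horizontal difference; it cancels and leaves the constant
  3.\<close>

lemma T_translation_estimate:
  fixes h :: 'b and I :: "real set"
  assumes I: "I \<in> sets borel" "I \<subseteq> {bm<..<bp}" "emeasure lborel I = ennreal \<epsilon>" and \<epsilon>: "0 < \<epsilon>"
    and b: "b \<in> {bm, bp}" "\<And>t. t \<in> I \<Longrightarrow> {min t b..max t b} \<subseteq> insert b I" and h: "norm h \<le> \<epsilon>"
  shows "(\<integral>\<^sup>+x. ennreal \<bar>T b (x + h) - T b x\<bar> \<partial>lborel) \<le>
    3 * (\<integral>\<^sup>+z. indicator (UNIV \<times> I) z * ennreal (norm (G z)) \<partial>lborel)"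
proof -
  note [measurable] = I(1)
  have [measurable]: "(UNIV :: 'b set) \<times> I \<in> sets borel" using I(1) by (intro borel_Times) auto
  define F where "F z = indicator (UNIV \<times> I) z * ennreal (norm (G z))" for z
  have F_borel [measurable]: "F \<in> borel_measurable borel" unfolding F_def[abs_def] by measurable
  have F_pair [measurable]: "F \<in> borel_measurable (borel \<Otimes>\<^sub>M borel)" using F_borel by (simp add: borel_prod)
  define Y where "Y = (\<integral>\<^sup>+z. F z \<partial>lborel)"
  define A where "A x = (\<integral>\<^sup>+s. F (x, s) \<partial>lborel)" for x
  have [measurable]: "A \<in> borel_measurable borel" unfolding A_def[abs_def] by measurable
  have A_int: "(\<integral>\<^sup>+x. A x \<partial>lborel) = Y"
    unfolding A_def Y_def lborel_prod[symmetric] by (subst lborel.nn_integral_fst) auto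
  let ?h = "(h, 0::real)"
  \<comment> \<open>The average of \<open>F\<close> along the horizontal segment from z to z + h; by
    translation invariance it has the same total integral \<open>Y\<close> as
    \<open>F\<close>.\<close>
  define B where "B z = (\<integral>\<^sup>+s. indicator {0..1} s * F (z + s *\<^sub>R ?h) \<partial>lborel)" for z
  have [measurable]: "(\<lambda>p. F (snd p + fst p *\<^sub>R ?h)) \<in> borel_measurable (borel \<Otimes>\<^sub>M borel)"
    by measurable
  have B_borel [measurable]: "B \<in> borel_measurable borel"
    unfolding B_def[abs_def] by measurable
  have B_int: "(\<integral>\<^sup>+z. B z \<partial>lborel) = Y"
  proof -
    have "(\<integral>\<^sup>+z. B z \<partial>lborel) = (\<integral>\<^sup>+s. \<integral>\<^sup>+z. indicator {0..1} s * F (z + s *\<^sub>R ?h) \<partial>lborel \<partial>lborel)"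
      unfolding B_def
      using lborel_pair.Fubini[of "\<lambda>(s::real, z). indicator {0..1} s * F (z + s *\<^sub>R ?h)"] by simp
    also have "\<dots> = (\<integral>\<^sup>+s. indicator {0..1} s * Y \<partial>(lborel :: real measure))"
      by (intro nn_integral_cong) (simp add: nn_integral_cmult nn_integral_lborel_shift Y_def)
    also have "\<dots> = Y" by (simp add: nn_integral_multc)
    finally show ?thesis .
  qed
  have V_le: "ennreal \<bar>V (x, t) - V (x, b)\<bar> \<le> A x" if x: "slice_integrable x" and t: "t \<in> I" for x t
  proof -
    have "ennreal \<bar>V (x, t) - V (x, b)\<bar> \<le> (\<integral>\<^sup>+s. indicator {min t b..max t b} s * ennreal \<bar>g (x, s)\<bar> \<partial>lborel)"
      by (rule V_diff_le[OF x])
    also have "\<dots> \<le> A x"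
      unfolding A_def
    proof (rule nn_integral_mono)
      fix s
      have "\<bar>g (x, s)\<bar> \<le> norm (G (x, s))"
        using Cauchy_Schwarz_ineq2[of "G (x, s)" "(0, 1)"] by (simp add: g_def norm_Pair)
      \<comment> \<open>The closed range of integration contains \<open>b\<close>, which is not in
        \<open>I\<close>; there \<open>g\<close> vanishes by the extension by zero.\<close>
      moreover have "g (x, b) = 0" using b(1) by (auto intro: g_0)
      ultimately show "indicator {min t b..max t b} s * ennreal \<bar>g (x, s)\<bar> \<le> F (x, s)"
        using b(2)[OF t] by (cases "s = b") (auto simp: F_def indicator_def intro: ennreal_leI)
    qed
    finally show ?thesis .
  qed
  have W_le: "ennreal \<bar>W ?h z\<bar> \<le> ennreal \<epsilon> * B z" if z: "z \<in> UNIV \<times> I" for z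
  proof -
    have "ennreal \<bar>W ?h z\<bar> \<le> (\<integral>\<^sup>+s. ennreal \<bar>indicator {0..1} s * (G (z + s *\<^sub>R ?h) \<bullet> ?h)\<bar> \<partial>lborel)"
      unfolding W_def by (rule ennreal_abs_integral_le)
    also have "\<dots> \<le> (\<integral>\<^sup>+s. ennreal \<epsilon> * (indicator {0..1} s * F (z + s *\<^sub>R ?h)) \<partial>lborel)"
    proof (rule nn_integral_mono)
      fix s :: real
      have zs: "z + s *\<^sub>R ?h \<in> UNIV \<times> I" using z by (cases z) auto
      have "\<bar>G (z + s *\<^sub>R ?h) \<bullet> ?h\<bar> \<le> norm (G (z + s *\<^sub>R ?h)) * norm ?h"
        by (rule Cauchy_Schwarz_ineq2)
      also have "\<dots> \<le> \<epsilon> * norm (G (z + s *\<^sub>R ?h))"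
        using h by (simp add: norm_Pair mult.commute mult_right_mono)
      finally have "ennreal \<bar>G (z + s *\<^sub>R ?h) \<bullet> ?h\<bar> \<le> ennreal \<epsilon> * ennreal (norm (G (z + s *\<^sub>R ?h)))"
        using \<epsilon> by (simp add: ennreal_leI flip: ennreal_mult)
      then show "ennreal \<bar>indicator {0..1} s * (G (z + s *\<^sub>R ?h) \<bullet> ?h)\<bar> \<le> ennreal \<epsilon> * (indicator {0..1} s * F (z + s *\<^sub>R ?h))"
        using zs by (auto simp: F_def indicator_def)
    qed
    also have "\<dots> = ennreal \<epsilon> * B z" unfolding B_def by (rule nn_integral_cmult) measurable
    finally show ?thesis .
  qed
  have decomp: "AE z in lborel. z \<in> UNIV \<times> {bm<..<bp} \<longrightarrow> slice_integrable (fst z) \<and> u z = T b (fst z) + (V z - V (fst z, b))"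
    using u_eq_AE AE_fst[OF AE_slice_integrable] by eventually_elim (auto simp: T_def)
  \<comment> \<open>The left side does not depend on the height, so averaging over the layer is
    multiplication by its thickness.\<close>
  have "ennreal \<epsilon> * (\<integral>\<^sup>+x. ennreal \<bar>T b (x + h) - T b x\<bar> \<partial>lborel) =
      (\<integral>\<^sup>+z. indicator (UNIV \<times> I) z * ennreal \<bar>T b (fst z + h) - T b (fst z)\<bar> \<partial>lborel)"
    using nn_integral_strip[of "\<lambda>x. ennreal \<bar>T b (x + h) - T b x\<bar>" I] I(3) by simp
  also have "\<dots> \<le> (\<integral>\<^sup>+z. indicator (UNIV \<times> I) z * A (fst z + h) + indicator (UNIV \<times> I) z * A (fst z) + ennreal \<epsilon> * B z \<partial>lborel)"
  proof (rule nn_integral_mono_AE)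
    show "AE z in lborel. indicator (UNIV \<times> I) z * ennreal \<bar>T b (fst z + h) - T b (fst z)\<bar> \<le>
        indicator (UNIV \<times> I) z * A (fst z + h) + indicator (UNIV \<times> I) z * A (fst z) + ennreal \<epsilon> * B z"
      using decomp AE_lborel_shift[OF decomp, of ?h] difference_eq_W[of ?h]
    proof eventually_elim
      case (elim z)
      show ?case
      proof (cases "z \<in> UNIV \<times> I")
        case True
        obtain x t where z: "z = (x, t)" "t \<in> I" using True by auto
        have t: "bm < t" "t < bp" using I(2) z(2) by auto
        have s: "slice_integrable x" "slice_integrable (x + h)"
          and u1: "u (x, t) = T b x + (V (x, t) - V (x, b))"
          and u2: "u (x + h, t) = T b (x + h) + (V (x + h, t) - V (x + h, b))"
          and W: "u (x + h, t) - u (x, t) = W ?h z"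
          using elim t z(1) by auto
        have "\<bar>T b (x + h) - T b x\<bar> \<le> \<bar>V (x + h, t) - V (x + h, b)\<bar> + \<bar>V (x, t) - V (x, b)\<bar> + \<bar>W ?h z\<bar>"
          using u1 u2 W by linarith
        then have "ennreal \<bar>T b (x + h) - T b x\<bar> \<le>
            ennreal \<bar>V (x + h, t) - V (x + h, b)\<bar> + ennreal \<bar>V (x, t) - V (x, b)\<bar> + ennreal \<bar>W ?h z\<bar>"
          by (simp add: ennreal_leI flip: ennreal_plus)
        also have "\<dots> \<le> A (x + h) + A x + ennreal \<epsilon> * B z"
          by (intro add_mono V_le s z(2) W_le True)
        finally show ?thesis using z by simp
      qed simp
    qed
  qed
  also have "\<dots> = ennreal \<epsilon> * Y + ennreal \<epsilon> * Y + ennreal \<epsilon> * Y"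
  proof -
    have m1: "(\<lambda>z. indicator (UNIV \<times> I) z * A (fst z + h)) \<in> borel_measurable lborel"
      "(\<lambda>z. indicator (UNIV \<times> I) z * A (fst z)) \<in> borel_measurable lborel"
    proof -
      have "(\<lambda>z. A (fst z + h)) \<in> borel_measurable (borel \<Otimes>\<^sub>M (borel :: real measure))"
        "(\<lambda>z. A (fst z)) \<in> borel_measurable (borel \<Otimes>\<^sub>M (borel :: real measure))" by measurable
      then show "(\<lambda>z. indicator (UNIV \<times> I) z * A (fst z + h)) \<in> borel_measurable lborel"
        "(\<lambda>z. indicator (UNIV \<times> I) z * A (fst z)) \<in> borel_measurable lborel"
        by (auto simp: borel_prod)
    qed
    have "(\<integral>\<^sup>+z. indicator (UNIV \<times> I) z * A (fst z + h) \<partial>lborel) = ennreal \<epsilon> * Y"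
      using nn_integral_strip[of "\<lambda>x. A (x + h)" I] I(3) nn_integral_lborel_shift[of A h] A_int by simp
    moreover have "(\<integral>\<^sup>+z. indicator (UNIV \<times> I) z * A (fst z) \<partial>lborel) = ennreal \<epsilon> * Y"
      using nn_integral_strip[of A I] I(3) A_int by simp
    moreover have "(\<integral>\<^sup>+z. ennreal \<epsilon> * B z \<partial>lborel) = ennreal \<epsilon> * Y"
      by (subst nn_integral_cmult) (auto simp: B_int)
    ultimately show ?thesis
      using m1 by (simp add: nn_integral_add)
  qed
  also have "\<dots> = ennreal \<epsilon> * (3 * Y)"
  proof -
    have three: "(3 :: ennreal) = 1 + 1 + 1" by simp
    show ?thesis unfolding three by (simp only: distrib_left distrib_right mult_1_left)
  qed
  finally have "(\<integral>\<^sup>+x. ennreal \<bar>T b (x + h) - T b x\<bar> \<partial>lborel) \<le> 3 * Y"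
    using \<epsilon> by (subst (asm) ennreal_mult_le_mult_iff) auto
  then show ?thesis by (simp add: Y_def F_def)
qed

text \<open>Continuity of an indefinite integral: the indicators of the half-lines converge except
  at the single height \<open>b\<close>.\<close>

lemma V_tendsto:
  assumes x: "slice_integrable x" and t: "t \<longlonglongrightarrow> b"
  shows "(\<lambda>k. V (x, t k)) \<longlonglongrightarrow> V (x, b)"
  unfolding V_eq
proof (rule integral_dominated_convergence[where w = "\<lambda>s. \<bar>g (x, s)\<bar>"])
  show "integrable lborel (\<lambda>s. \<bar>g (x, s)\<bar>)" using x by simp
  have gx [measurable]: "(\<lambda>s. g (x, s)) \<in> borel_measurable borel" using x by simp
  show "(\<lambda>s. indicator {..b} s * g (x, s)) \<in> borel_measurable lborel" by measurable
  show "(\<lambda>s. indicator {..t k} s * g (x, s)) \<in> borel_measurable lborel" for k by measurable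
  show "AE s in lborel. norm (indicator {..t k} s * g (x, s)) \<le> \<bar>g (x, s)\<bar>" for k
    by (auto simp: indicator_def)
  have "AE s in lborel. s \<noteq> b" by (rule AE_lborel_singleton)
  then show "AE s in lborel. (\<lambda>k. indicator {..t k} s * g (x, s)) \<longlonglongrightarrow> indicator {..b} s * g (x, s)"
  proof eventually_elim
    case (elim s)
    have "\<forall>\<^sub>F k in sequentially. indicator {..t k} s * g (x, s) = indicator {..b} s * g (x, s)"
    proof (cases "s < b")
      case True
      show ?thesis using order_tendstoD(1)[OF t True] by eventually_elim (use True in \<open>auto simp: indicator_def\<close>)
    next
      case False
      then have "b < s" using elim by simp
      show ?thesis using order_tendstoD(2)[OF t \<open>b < s\<close>] by eventually_elim (use \<open>b < s\<close> in \<open>auto simp: indicator_def\<close>)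
    qed
    then show ?case by (rule tendsto_eventually)
  qed
qed

text \<open>On almost every vertical line v equals w + V at almost every height. Along heights of
  equality tending to \<open>b\<close> both sides converge, and v is continuous up to the
  boundary.\<close>

lemma T_eq_continuous:
  assumes v: "continuous_on (UNIV \<times> {bm..bp}) v" "AE z in lborel. z \<in> UNIV \<times> {bm<..<bp} \<longrightarrow> v z = u z"
    and b: "b \<in> {bm, bp}"
  shows "AE x in lborel. T b x = v (x, b)"
  using u_decomposition AE_slice_integrable AE_pairD[OF v(2)]
proof eventually_elim
  case (elim x)
  have ae: "AE t in lborel. bm < t \<and> t < bp \<longrightarrow> v (x, t) = w x + V (x, t)"
    using elim(1,3) by eventually_elim auto
  \<comment> \<open>The part of the interval within distance (bp - bm) / (k + 1) of \<open>b\<close>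
    has positive length, so it cannot consist of exceptional heights only.\<close>
  have "\<exists>t. bm < t \<and> t < bp \<and> \<bar>t - b\<bar> < (bp - bm) / (real k + 1) \<and> v (x, t) = w x + V (x, t)" for k
  proof (rule ccontr)
    assume no: "\<not> ?thesis"
    define r where "r = (bp - bm) / (real k + 1)"
    define lo hi where "lo = max bm (b - r)" and "hi = min bp (b + r)"
    have "0 < r" using bm_less_bp by (simp add: r_def)
    then have lohi: "lo < hi" using b bm_less_bp by (auto simp: lo_def hi_def max_def min_def)
    have "AE t in lborel. t \<notin> {lo<..<hi}"
      using ae by eventually_elim (use no in \<open>auto simp: lo_def hi_def r_def abs_less_iff\<close>)
    moreover have "(AE t in lborel. t \<notin> {lo<..<hi}) \<longleftrightarrow> emeasure lborel {lo<..<hi} = 0"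
      by (rule AE_iff_measurable) auto
    ultimately show False using lohi by simp
  qed
  then obtain t where t: "\<And>k. bm < t k" "\<And>k. t k < bp" "\<And>k. \<bar>t k - b\<bar> < (bp - bm) / (real k + 1)"
    "\<And>k. v (x, t k) = w x + V (x, t k)" by metis
  have tb: "t \<longlonglongrightarrow> b"
  proof (rule LIM_zero_cancel, rule Lim_null_comparison)
    show "\<forall>\<^sub>F k in sequentially. norm (t k - b) \<le> (bp - bm) * inverse (real (Suc k))"
      using t(3) by (intro always_eventually allI) (simp add: divide_inverse less_imp_le add.commute)
    show "(\<lambda>k. (bp - bm) * inverse (real (Suc k))) \<longlonglongrightarrow> 0"
      by (rule tendsto_mult_right_zero[OF LIMSEQ_inverse_real_of_nat])
  qed
  have "(\<lambda>k. v (x, t k)) \<longlonglongrightarrow> v (x, b)"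
  proof (rule continuous_on_tendsto_compose[OF v(1)])
    show "(\<lambda>k. (x, t k)) \<longlonglongrightarrow> (x, b)" by (intro tendsto_Pair tendsto_const tb)
    show "(x, b) \<in> UNIV \<times> {bm..bp}" using b bm_less_bp by auto
  qed (use t(1,2) in \<open>auto simp: less_imp_le\<close>)
  moreover have "(\<lambda>k. v (x, t k)) \<longlonglongrightarrow> w x + V (x, b)"
    unfolding t(4) by (intro tendsto_add tendsto_const V_tendsto elim(2) tb)
  ultimately show ?case unfolding T_def using LIMSEQ_unique by blast
qed

lemma u_times_integrable:
  assumes K: "compact K" and k: "k \<in> borel_measurable borel" "\<And>z. \<bar>k z\<bar> \<le> C" "\<And>z. fst z \<notin> K \<Longrightarrow> k z = 0"
  shows "integrable lborel (\<lambda>z. u z * k z)"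
proof -
  have "integrable lborel (\<lambda>z. (indicator (K \<times> UNIV) z * u z) * k z)"
    using k by (intro integrable_real_mult_bounded[OF u_loc_horizontal[OF K]]) auto
  moreover have "(indicator (K \<times> UNIV) z * u z) * k z = u z * k z" for z
    using k(3)[of z] by (cases z) (auto simp: indicator_def)
  ultimately show ?thesis by simp
qed

section \<open>Integration by parts on the strip\<close>

context
  fixes \<psi> :: "'b \<times> real \<Rightarrow> real"
  assumes \<psi>: "\<psi> \<in> C_c 1"
begin

definition K\<psi> :: "'b set" where
  "K\<psi> = fst ` closure {z. \<psi> z \<noteq> 0}"

lemma compact_K: "compact K\<psi>"
  unfolding K\<psi>_def by (intro compact_continuous_image continuous_on_fst continuous_on_id C_c_compact[OF \<psi>])

lemma notin_K: "fst z \<notin> K\<psi> \<Longrightarrow> z \<notin> closure {z. \<psi> z \<noteq> 0}"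
  by (auto simp: K\<psi>_def)

lemma \<psi>_outside_K: "fst z \<notin> K\<psi> \<Longrightarrow> \<psi> z = 0"
  using notin_K[of z] closure_subset[of "{z. \<psi> z \<noteq> 0}"] by auto

lemma u_derivative_integrable: "integrable lborel (\<lambda>z. u z * frechet_derivative \<psi> (at z) i)"
proof -
  obtain C where "\<And>z. \<bar>frechet_derivative \<psi> (at z) i\<bar> \<le> C" using C_c_derivative_bounded[OF \<psi>] by metis
  then show ?thesis
    using C_c_derivative_borel[OF \<psi>] C_c_derivative_eq_0[OF \<psi> notin_K]
    by (intro u_times_integrable[OF compact_K]) auto
qed

lemma T_times_integrable: "integrable lborel (\<lambda>x. \<psi> (x, b) * T b x)"
proof -
  obtain C where C: "\<And>z. \<bar>\<psi> z\<bar> \<le> C" using C_c_bounded[OF \<psi>] by metis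
  have "continuous_on UNIV (\<lambda>x. \<psi> (x, b))"
    by (rule continuous_on_compose2[OF C_c_continuous[OF \<psi>]]) (auto intro!: continuous_intros)
  then have "integrable lborel (\<lambda>x. (indicator K\<psi> x * T b x) * \<psi> (x, b))"
    using C borel_measurable_continuous_onI
    by (intro integrable_real_mult_bounded[OF T_loc_integrable[OF compact_K]]) auto
  moreover have "(indicator K\<psi> x * T b x) * \<psi> (x, b) = \<psi> (x, b) * T b x" for x
    using \<psi>_outside_K[of "(x, b)"] by (auto simp: indicator_def)
  ultimately show ?thesis by simp
qed

text \<open>One-dimensional integration by parts for the antiderivative w + V. The term with V is a
  double integral of g(x, s) p'(t) over s \<le> t; integrating in t first gives g(x, s) times p(bp)
  - p(s).\<close>

lemma vertical_line_integral:
  assumes x: "slice_integrable x"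
  shows "(\<integral>t. indicator {bm<..<bp} t * ((w x + V (x, t)) * frechet_derivative \<psi> (at (x, t)) (0, 1)) \<partial>lborel) =
    \<psi> (x, bp) * T bp x - \<psi> (x, bm) * T bm x - (\<integral>t. \<psi> (x, t) * g (x, t) \<partial>lborel)"
proof -
  define p where "p t = \<psi> (x, t)" for t
  define p' where "p' t = frechet_derivative \<psi> (at (x, t)) (0, 1)" for t
  have cp': "continuous_on UNIV p'"
    unfolding p'_def by (rule continuous_on_compose2[OF C_c_derivative_continuous[OF \<psi>]]) (auto intro!: continuous_intros)
  have cp: "continuous_on UNIV p"
    unfolding p_def by (rule continuous_on_compose2[OF C_c_continuous[OF \<psi>]]) (auto intro!: continuous_intros)
  have [measurable]: "p' \<in> borel_measurable borel" "p \<in> borel_measurable borel"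
    using cp' cp by (auto intro: borel_measurable_continuous_onI)
  obtain C where C: "\<And>t. \<bar>p' t\<bar> \<le> C" using C_c_derivative_bounded[OF \<psi>] unfolding p'_def by metis
  obtain C0 where C0: "\<And>t. \<bar>p t\<bar> \<le> C0" using C_c_bounded[OF \<psi>] unfolding p_def by metis
  have gx [measurable]: "(\<lambda>s. g (x, s)) \<in> borel_measurable borel" using x by simp
  have der: "(p has_vector_derivative p' t) (at t within S)" for t S
  proof -
    have "((\<lambda>t. (x, t)) has_derivative (\<lambda>t. (0, t))) (at t within S)"
      by (auto intro!: derivative_eq_intros)
    then have "(p has_derivative (\<lambda>s. frechet_derivative \<psi> (at (x, t)) (0, s))) (at t within S)"
      unfolding p_def by (rule has_derivative_compose[OF _ C_c_has_derivative[OF \<psi>]])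
    moreover have "frechet_derivative \<psi> (at (x, t)) (0, s) = s *\<^sub>R p' t" for s
      using linear_scale[OF has_derivative_linear[OF C_c_has_derivative[OF \<psi>]], of _ s "(0, 1)"] by (simp add: p'_def)
    ultimately show ?thesis by (simp add: has_vector_derivative_def)
  qed
  have FTC: "(\<integral>t. indicator {a..b} t * p' t \<partial>lborel) = p b - p a" if "a \<le> b" for a b
    using integral_FTC_atLeastAtMost[OF that der continuous_on_subset[OF cp']] by simp
  have FTC': "(\<integral>t. indicator {bm<..<bp} t * (indicator {s..} t * p' t) \<partial>lborel) = p bp - p s"
    if s: "bm \<le> s" "s \<le> bp" for s
  proof -
    have "(\<integral>t. indicator {bm<..<bp} t * (indicator {s..} t * p' t) \<partial>lborel) = (\<integral>t. indicator {s..bp} t * p' t \<partial>lborel)"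
    proof (rule integral_cong_AE)
      have "AE t in lborel. t \<noteq> bm" "AE t in lborel. t \<noteq> bp" by (rule AE_lborel_singleton)+
      then show "AE t in lborel. indicator {bm<..<bp} t * (indicator {s..} t * p' t) = indicator {s..bp} t * p' t"
        by eventually_elim (use s in \<open>auto simp: indicator_def\<close>)
    qed measurable
    then show ?thesis using FTC[OF s(2)] by simp
  qed
  have ip: "integrable lborel (\<lambda>t. indicator {bm<..<bp} t * p' t)"
  proof (rule Bochner_Integration.integrable_bound)
    show "integrable lborel (\<lambda>t. C * indicator {bm<..<bp} t)" using bm_less_bp by simp
    have "norm (indicator {bm<..<bp} t * p' t) \<le> norm (C * indicator {bm<..<bp} t)" for t
      using C[of t] by (auto simp: indicator_def)
    then show "AE t in lborel. norm (indicator {bm<..<bp} t * p' t) \<le> norm (C * indicator {bm<..<bp} t)" by simp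
  qed measurable
  \<comment> \<open>The integrand on the triangle s \<le> t. The equivalent form \<open>q_if\<close>
    replaces the moving indicator by a conditional, again for the sake of measurability.\<close>
  define q where "q = (\<lambda>(s, t). g (x, s) * (indicator {bm<..<bp} t * (indicator {s..} t * p' t)))"
  have q_if: "q = (\<lambda>(s, t). g (x, s) * (indicator {bm<..<bp} t * (if s \<le> t then p' t else 0)))"
    by (auto simp: q_def fun_eq_iff indicator_def)
  have qi: "integrable (lborel \<Otimes>\<^sub>M lborel) q"
  proof (rule Bochner_Integration.integrable_bound)
    show "integrable (lborel \<Otimes>\<^sub>M lborel) (\<lambda>(s, t). g (x, s) * (indicator {bm<..<bp} t * p' t))"
      by (rule integrable_pair_times[OF x ip])
    show "q \<in> borel_measurable (lborel \<Otimes>\<^sub>M lborel)" unfolding q_if by measurable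
    show "AE z in lborel \<Otimes>\<^sub>M lborel. norm (q z) \<le> norm (case z of (s, t) \<Rightarrow> g (x, s) * (indicator {bm<..<bp} t * p' t))"
      by (auto simp: q_def indicator_def)
  qed
  have Vi: "(\<lambda>t. \<integral>s. q (s, t) \<partial>lborel) = (\<lambda>t. indicator {bm<..<bp} t * (V (x, t) * p' t))"
  proof
    fix t
    have "(\<integral>s. q (s, t) \<partial>lborel) = (\<integral>s. (indicator {bm<..<bp} t * p' t) * (indicator {..t} s * g (x, s)) \<partial>lborel)"
      by (intro Bochner_Integration.integral_cong) (auto simp: q_def indicator_def)
    also have "\<dots> = (indicator {bm<..<bp} t * p' t) * V (x, t)"
      unfolding V_eq by (rule integral_mult_right_zero)
    finally show "(\<integral>s. q (s, t) \<partial>lborel) = indicator {bm<..<bp} t * (V (x, t) * p' t)"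
      by (simp only: mult_ac)
  qed
  have Vint: "integrable lborel (\<lambda>t. indicator {bm<..<bp} t * (V (x, t) * p' t))"
    using lborel_pair.integrable_snd[of "\<lambda>s t. q (s, t)"] qi unfolding Vi by simp
  have "(\<integral>t. indicator {bm<..<bp} t * (V (x, t) * p' t) \<partial>lborel) = (\<integral>s. (\<integral>t. q (s, t) \<partial>lborel) \<partial>lborel)"
    using lborel_pair.Fubini_integral[of "\<lambda>s t. q (s, t)"] qi unfolding Vi by simp
  also have "\<dots> = (\<integral>s. g (x, s) * (p bp - p s) \<partial>lborel)"
  proof (rule Bochner_Integration.integral_cong[OF refl])
    fix s
    show "(\<integral>t. q (s, t) \<partial>lborel) = g (x, s) * (p bp - p s)"
      using FTC'[of s] g_0[of s x] by (cases "s \<in> {bm<..<bp}") (auto simp: q_def)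
  qed
  also have "\<dots> = (\<integral>s. g (x, s) * p bp - g (x, s) * p s \<partial>lborel)"
    by (simp add: right_diff_distrib)
  also have "\<dots> = V (x, bp) * p bp - (\<integral>s. g (x, s) * p s \<partial>lborel)"
  proof -
    have "integrable lborel (\<lambda>s. g (x, s) * p s)"
      using C0 by (intro integrable_real_mult_bounded[OF x]) auto
    moreover have "V (x, bp) = (\<integral>s. g (x, s) \<partial>lborel)"
      unfolding V_def using g_0[of _ x] by (intro Bochner_Integration.integral_cong) auto
    ultimately show ?thesis using x by simp
  qed
  finally have Vp: "(\<integral>t. indicator {bm<..<bp} t * (V (x, t) * p' t) \<partial>lborel) =
      V (x, bp) * p bp - (\<integral>s. g (x, s) * p s \<partial>lborel)" .
  have wp: "(\<integral>t. indicator {bm<..<bp} t * p' t \<partial>lborel) = p bp - p bm"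
  proof -
    have eq: "indicator {bm<..<bp} t * (indicator {bm..} t * p' t) = indicator {bm<..<bp} t * p' t" for t
      by (auto simp: indicator_def)
    show ?thesis using FTC'[of bm] bm_less_bp unfolding eq by simp
  qed
  have "(\<integral>t. indicator {bm<..<bp} t * ((w x + V (x, t)) * p' t) \<partial>lborel) =
      (\<integral>t. w x * (indicator {bm<..<bp} t * p' t) + indicator {bm<..<bp} t * (V (x, t) * p' t) \<partial>lborel)"
    by (intro Bochner_Integration.integral_cong) (auto simp: algebra_simps)
  also have "\<dots> = w x * (p bp - p bm) + (V (x, bp) * p bp - (\<integral>s. g (x, s) * p s \<partial>lborel))"
    using ip Vint by (simp add: wp Vp)
  also have "\<dots> = p bp * T bp x - p bm * T bm x - (\<integral>s. p s * g (x, s) \<partial>lborel)"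
    by (simp add: T_def V_bm algebra_simps)
  finally show ?thesis by (simp add: p_def p'_def)
qed

lemma integration_by_parts_vertical:
  "(\<integral>z. u z * frechet_derivative \<psi> (at z) (0, 1) \<partial>lborel) =
    - (\<integral>z. \<psi> z * g z \<partial>lborel) + ((\<integral>x. \<psi> (x, bp) * T bp x \<partial>lborel) - (\<integral>x. \<psi> (x, bm) * T bm x \<partial>lborel))"
proof -
  let ?D = "\<lambda>z. frechet_derivative \<psi> (at z) (0, 1)"
  obtain C0 where C0: "\<And>z. \<bar>\<psi> z\<bar> \<le> C0" using C_c_bounded[OF \<psi>] by metis
  have gi: "integrable lborel (\<lambda>z. \<psi> z * g z)"
    using integrable_real_mult_bounded[OF g_integrable, of \<psi> C0] C0 C_c_borel[OF \<psi>] by (simp add: mult.commute)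
  then have gp: "integrable (lborel \<Otimes>\<^sub>M lborel) (\<lambda>z. \<psi> z * g z)" by (simp add: lborel_prod)
  have up: "integrable (lborel \<Otimes>\<^sub>M lborel) (\<lambda>z. u z * ?D z)"
    using u_derivative_integrable by (simp add: lborel_prod)
  have "(\<integral>z. u z * ?D z \<partial>lborel) = (\<integral>x. (\<integral>t. u (x, t) * ?D (x, t) \<partial>lborel) \<partial>lborel)"
    using lborel_pair.integral_fst'[OF up] by (simp add: lborel_prod)
  also have "\<dots> = (\<integral>x. \<psi> (x, bp) * T bp x - \<psi> (x, bm) * T bm x - (\<integral>t. \<psi> (x, t) * g (x, t) \<partial>lborel) \<partial>lborel)"
  proof (rule integral_cong_AE)
    show "(\<lambda>x. \<integral>t. u (x, t) * ?D (x, t) \<partial>lborel) \<in> borel_measurable lborel"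
      using lborel_pair.integrable_fst'[OF up] by simp
    show "(\<lambda>x. \<psi> (x, bp) * T bp x - \<psi> (x, bm) * T bm x - (\<integral>t. \<psi> (x, t) * g (x, t) \<partial>lborel)) \<in> borel_measurable lborel"
      using T_times_integrable lborel_pair.integrable_fst'[OF gp] by simp
    show "AE x in lborel. (\<integral>t. u (x, t) * ?D (x, t) \<partial>lborel) =
        \<psi> (x, bp) * T bp x - \<psi> (x, bm) * T bm x - (\<integral>t. \<psi> (x, t) * g (x, t) \<partial>lborel)"
      using u_decomposition AE_slice_integrable lborel_pair.AE_integrable_fst'[OF up]
    proof eventually_elim
      case (elim x)
      have "(\<integral>t. u (x, t) * ?D (x, t) \<partial>lborel) =
          (\<integral>t. indicator {bm<..<bp} t * ((w x + V (x, t)) * ?D (x, t)) \<partial>lborel)"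
      proof (rule integral_cong_AE)
        show "(\<lambda>t. u (x, t) * ?D (x, t)) \<in> borel_measurable lborel" using elim(3) by simp
        have [measurable]: "V \<in> borel_measurable (borel \<Otimes>\<^sub>M borel)" "?D \<in> borel_measurable (borel \<Otimes>\<^sub>M borel)"
          using V_borel C_c_derivative_borel[OF \<psi>] by (simp_all add: borel_prod)
        show "(\<lambda>t. indicator {bm<..<bp} t * ((w x + V (x, t)) * ?D (x, t))) \<in> borel_measurable lborel"
          by measurable
        show "AE t in lborel. u (x, t) * ?D (x, t) = indicator {bm<..<bp} t * ((w x + V (x, t)) * ?D (x, t))"
          using elim(1) by eventually_elim (auto simp: indicator_def u_0)
      qed
      then show ?case using vertical_line_integral[OF elim(2)] by simp
    qed
  qed
  also have "\<dots> = (\<integral>x. \<psi> (x, bp) * T bp x \<partial>lborel) - (\<integral>x. \<psi> (x, bm) * T bm x \<partial>lborel) -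
      (\<integral>x. (\<integral>t. \<psi> (x, t) * g (x, t) \<partial>lborel) \<partial>lborel)"
    using T_times_integrable lborel_pair.integrable_fst'[OF gp] by simp
  also have "(\<integral>x. (\<integral>t. \<psi> (x, t) * g (x, t) \<partial>lborel) \<partial>lborel) = (\<integral>z. \<psi> z * g z \<partial>lborel)"
    using lborel_pair.integral_fst'[OF gp] by (simp add: lborel_prod)
  finally show ?thesis by simp
qed

text \<open>Horizontal translations preserve the strip, so the derivative can be moved by difference quotients.\<close>

lemma integration_by_parts_horizontal:
  "(\<integral>z. u z * frechet_derivative \<psi> (at z) (e, 0) \<partial>lborel) = - (\<integral>z. \<psi> z * (G z \<bullet> (e, 0)) \<partial>lborel)"
proof -
  define ee where "ee = (e, 0::real)"
  have fst_ee [simp]: "fst ee = e" and snd_ee [simp]: "snd ee = 0" by (simp_all add: ee_def)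
  let ?D = "\<lambda>z. frechet_derivative \<psi> (at z) ee"
  obtain C0 where C0: "\<And>z. \<bar>\<psi> z\<bar> \<le> C0" using C_c_bounded[OF \<psi>] by metis
  obtain C where C: "0 \<le> C" "\<And>z. \<bar>?D z\<bar> \<le> C" using C_c_derivative_bounded[OF \<psi>] by metis
  have \<psi>_borel [measurable]: "\<psi> \<in> borel_measurable borel" by (rule C_c_borel[OF \<psi>])
  have D_borel [measurable]: "?D \<in> borel_measurable borel" by (rule C_c_derivative_borel[OF \<psi>])
  define \<tau> where "\<tau> k = inverse (real (Suc k))" for k
  have \<tau>: "0 < \<tau> k" "\<tau> k \<le> 1" for k by (auto simp: \<tau>_def field_simps)
  have \<tau>0: "\<tau> \<longlonglongrightarrow> 0" unfolding \<tau>_def by (rule LIMSEQ_inverse_real_of_nat)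
  \<comment> \<open>Since all steps \<open>\<tau> k\<close> are at most 1, this compact set contains
    the projected supports of all the translated functions used below.\<close>
  define K' where "K' = (\<lambda>(s, x). x + s *\<^sub>R e) ` ({0..1} \<times> K\<psi>)"
  have K': "compact K'" unfolding K'_def split_def
    by (intro compact_continuous_image continuous_intros compact_Times compact_K) auto
  have K'_out: "\<psi> (z - s *\<^sub>R ee) = 0" if "fst z \<notin> K'" "s \<in> {0..1}" for z s
  proof -
    have "fst z - s *\<^sub>R e \<notin> K\<psi>"
      using that unfolding K'_def by (metis (no_types, lifting) SigmaI case_prod_conv diff_add_cancel image_eqI)
    then show ?thesis by (intro \<psi>_outside_K) simp
  qed
  \<comment> \<open>A difference quotient with the test function shifted by a subtraction, so that
    translation invariance turns it into a forward difference of u. Its limit is minus the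
    derivative.\<close>
  define q where "q k z = (\<psi> (z - \<tau> k *\<^sub>R ee) - \<psi> z) / \<tau> k" for k z
  have q_borel [measurable]: "q k \<in> borel_measurable borel" for k
  proof -
    have "continuous_on UNIV (\<lambda>z. \<psi> (z - \<tau> k *\<^sub>R ee))"
      by (rule continuous_on_compose2[OF C_c_continuous[OF \<psi>]]) (auto intro!: continuous_intros)
    then have "(\<lambda>z. \<psi> (z - \<tau> k *\<^sub>R ee)) \<in> borel_measurable borel" by (rule borel_measurable_continuous_onI)
    then show ?thesis unfolding q_def by simp
  qed
  \<comment> \<open>The bound is uniform in \<open>k\<close> and thus provides the dominating
    function for the limit.\<close>
  have q_le: "\<bar>q k z\<bar> \<le> C" for k z
  proof -
    have neg: "frechet_derivative \<psi> (at y) (- (\<tau> k *\<^sub>R ee)) = - (\<tau> k * ?D y)" for y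
    proof -
      have lin: "linear (frechet_derivative \<psi> (at y))" by (rule has_derivative_linear[OF C_c_has_derivative[OF \<psi>]])
      show ?thesis using linear_neg[OF lin, of "\<tau> k *\<^sub>R ee"] linear_scale[OF lin, of "\<tau> k" ee] by simp
    qed
    have "\<psi> (z + - (\<tau> k *\<^sub>R ee)) - \<psi> z = (\<integral>s. indicator {0..1} s * - (\<tau> k * ?D (z + s *\<^sub>R - (\<tau> k *\<^sub>R ee))) \<partial>lborel)"
      unfolding C_c_FTC[OF \<psi>, of z "- (\<tau> k *\<^sub>R ee)"] neg ..
    also have "\<bar>\<dots>\<bar> \<le> (\<integral>s. \<bar>indicator {0..1} s * - (\<tau> k * ?D (z + s *\<^sub>R - (\<tau> k *\<^sub>R ee)))\<bar> \<partial>lborel)"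
      by (rule integral_abs_bound)
    also have "\<dots> \<le> (\<integral>s. indicator {0..1::real} s * (\<tau> k * C) \<partial>lborel)"
    proof (rule integral_mono')
      show "integrable lborel (\<lambda>s::real. indicator {0..1} s * (\<tau> k * C))" by simp
      fix s :: real
      show "\<bar>indicator {0..1} s * - (\<tau> k * ?D (z + s *\<^sub>R - (\<tau> k *\<^sub>R ee)))\<bar> \<le> indicator {0..1} s * (\<tau> k * C)"
        using C(2)[of "z + s *\<^sub>R - (\<tau> k *\<^sub>R ee)"] \<tau>(1)[of k]
        by (auto simp: indicator_def abs_mult intro!: mult_left_mono)
      show "0 \<le> indicator {0..1} s * (\<tau> k * C)" using C(1) \<tau>(1)[of k] by simp
    qed
    also have "\<dots> = \<tau> k * C" by simp
    finally show ?thesis using \<tau>(1)[of k] by (simp add: q_def abs_divide pos_divide_le_eq mult.commute)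
  qed
  have q_out: "q k z = 0" if "fst z \<notin> K'" for k z
    using K'_out[OF that, of "\<tau> k"] K'_out[OF that, of 0] \<tau>[of k] by (simp add: q_def less_imp_le)
  have q_lim: "(\<lambda>k. q k z) \<longlonglongrightarrow> - ?D z" for z
  proof -
    have "((\<lambda>s. z - s *\<^sub>R ee) has_derivative (\<lambda>s. - (s *\<^sub>R ee))) (at 0)"
      by (auto intro!: derivative_eq_intros)
    then have D1: "((\<lambda>s. \<psi> (z - s *\<^sub>R ee)) has_derivative (\<lambda>s. frechet_derivative \<psi> (at (z - 0 *\<^sub>R ee)) (- (s *\<^sub>R ee)))) (at 0)"
      by (rule has_derivative_compose[OF _ C_c_has_derivative[OF \<psi>]])
    have D2: "frechet_derivative \<psi> (at (z - 0 *\<^sub>R ee)) (- (s *\<^sub>R ee)) = - ?D z * s" for s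
    proof -
      have lin: "linear (frechet_derivative \<psi> (at z))" by (rule has_derivative_linear[OF C_c_has_derivative[OF \<psi>]])
      show ?thesis using linear_neg[OF lin, of "s *\<^sub>R ee"] linear_scale[OF lin, of s ee] by simp
    qed
    from D1 have "((\<lambda>s. \<psi> (z - s *\<^sub>R ee)) has_real_derivative - ?D z) (at 0)"
      unfolding D2 has_field_derivative_def .
    then have "((\<lambda>s. (\<psi> (z - (0 + s) *\<^sub>R ee) - \<psi> (z - 0 *\<^sub>R ee)) / s) \<longlongrightarrow> - ?D z) (at 0)"
      by (simp only: DERIV_def)
    then have "(\<lambda>k. (\<psi> (z - (0 + \<tau> k) *\<^sub>R ee) - \<psi> (z - 0 *\<^sub>R ee)) / \<tau> k) \<longlonglongrightarrow> - ?D z"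
      by (rule filterlim_compose) (use \<tau>0 \<tau>(1) in \<open>auto simp: filterlim_at intro!: always_eventually less_imp_neq[symmetric]\<close>)
    then show ?thesis by (simp add: q_def)
  qed
  have uq_int: "integrable lborel (\<lambda>z. u z * q k z)" for k
    by (rule u_times_integrable[OF K' q_borel q_le q_out])
  define R where "R k s = (\<integral>z. (G z \<bullet> ee) * \<psi> (z - s *\<^sub>R (\<tau> k *\<^sub>R ee)) \<partial>lborel)" for k and s :: real
  \<comment> \<open>The exact formula for a fixed step, with the translate of the test function
    averaged over the segment; both sides are then passed to the limit.\<close>
  have id: "(\<integral>z. u z * q k z \<partial>lborel) = (\<integral>s. indicator {0..1} s * R k s \<partial>lborel)" for k
  proof -
    let ?h = "\<tau> k *\<^sub>R ee"
    have i0: "integrable lborel (\<lambda>z. u z * \<psi> z)"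
      using C0 \<psi>_outside_K by (intro u_times_integrable[OF compact_K]) auto
    have i1: "integrable lborel (\<lambda>z. u z * \<psi> (z - ?h))"
    proof (rule u_times_integrable[OF K'])
      have "continuous_on UNIV (\<lambda>z. \<psi> (z - ?h))"
        by (rule continuous_on_compose2[OF C_c_continuous[OF \<psi>]]) (auto intro!: continuous_intros)
      then show "(\<lambda>z. \<psi> (z - ?h)) \<in> borel_measurable borel" by (rule borel_measurable_continuous_onI)
      show "\<psi> (z - ?h) = 0" if "fst z \<notin> K'" for z using K'_out[OF that, of "\<tau> k"] \<tau>[of k] by (simp add: less_imp_le)
    qed (rule C0)
    have i2: "integrable lborel (\<lambda>z. u (z + ?h) * \<psi> z)" using integrable_lborel_shift[OF i1, of ?h] by simp
    \<comment> \<open>A horizontal segment lies entirely inside or entirely outside the strip.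
      Outside, both sides vanish by the extension by zero, so the identity holds almost everywhere
      in the whole space and the test function may reach the boundary.\<close>
    have ae: "AE z in lborel. u (z + ?h) - u z = W ?h z"
      using difference_eq_W[of ?h]
    proof eventually_elim
      case (elim z)
      show ?case
      proof (cases "z \<in> UNIV \<times> {bm<..<bp}")
        case True
        then have "z + ?h \<in> UNIV \<times> {bm<..<bp}" by (auto simp: mem_Times_iff)
        with elim True show ?thesis by blast
      next
        case False
        then have out: "z + s *\<^sub>R ?h \<notin> UNIV \<times> {bm<..<bp}" for s by (auto simp: mem_Times_iff)
        then have "W ?h z = 0" using G_0 by (simp add: W_def)
        moreover have "u (z + ?h) = 0" using u_0 out[of 1] by simp
        ultimately show ?thesis using u_0[OF False] by simp
      qed
    qed
    have "\<tau> k * (\<integral>z. u z * q k z \<partial>lborel) = (\<integral>z. u z * \<psi> (z - ?h) - u z * \<psi> z \<partial>lborel)"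
      unfolding integral_mult_right_zero[symmetric] q_def using \<tau>(1)[of k]
      by (intro Bochner_Integration.integral_cong) (auto simp: field_simps)
    also have "\<dots> = (\<integral>z. u (z + ?h) * \<psi> z \<partial>lborel) - (\<integral>z. u z * \<psi> z \<partial>lborel)"
      using i0 i1 integral_lborel_shift[of "\<lambda>z. u z * \<psi> (z - ?h)" ?h] borel_measurable_integrable[OF i1] by simp
    also have "\<dots> = (\<integral>z. (u (z + ?h) - u z) * \<psi> z \<partial>lborel)"
      using i0 i2 by (simp add: left_diff_distrib)
    also have "\<dots> = (\<integral>z. W ?h z * \<psi> z \<partial>lborel)"
    proof (rule integral_cong_AE)
      show "AE z in lborel. (u (z + ?h) - u z) * \<psi> z = W ?h z * \<psi> z" using ae by eventually_elim simp
      have [measurable]: "W ?h \<in> borel_measurable borel" using W_integrable[of ?h] by simp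
      show "(\<lambda>z. W ?h z * \<psi> z) \<in> borel_measurable lborel" by measurable
    qed measurable
    also have "\<dots> = (\<integral>s. indicator {0..1} s * (\<integral>z. (G z \<bullet> ?h) * \<psi> (z - s *\<^sub>R ?h) \<partial>lborel) \<partial>lborel)"
      by (rule W_times[OF \<psi>_borel C0])
    also have "\<dots> = \<tau> k * (\<integral>s. indicator {0..1} s * R k s \<partial>lborel)"
    proof -
      have "(\<integral>z. (G z \<bullet> ?h) * \<psi> (z - s *\<^sub>R ?h) \<partial>lborel) = \<tau> k * R k s" for s
        unfolding R_def integral_mult_right_zero[symmetric] by (simp add: mult.assoc)
      then show ?thesis by (simp only: mult.left_commute[of _ "\<tau> k"] integral_mult_right_zero)
    qed
    finally show ?thesis using \<tau>(1)[of k] by simp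
  qed
  have lim1: "(\<lambda>k. \<integral>z. u z * q k z \<partial>lborel) \<longlonglongrightarrow> (\<integral>z. u z * - ?D z \<partial>lborel)"
  proof (rule integral_dominated_convergence)
    show "integrable lborel (\<lambda>z. C * \<bar>indicator (K' \<times> UNIV) z * u z\<bar>)"
      using u_loc_horizontal[OF K'] by (intro integrable_mult_right integrable_abs)
    show "AE z in lborel. (\<lambda>k. u z * q k z) \<longlonglongrightarrow> u z * - ?D z"
      by (intro AE_I2 tendsto_mult tendsto_const q_lim)
    have "norm (u z * q k z) \<le> C * \<bar>indicator (K' \<times> UNIV) z * u z\<bar>" for k z
    proof (cases "fst z \<in> K'")
      case True
      have "\<bar>u z\<bar> * \<bar>q k z\<bar> \<le> \<bar>u z\<bar> * C" by (intro mult_left_mono q_le) simp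
      then show ?thesis using True by (cases z) (simp add: abs_mult mult.commute)
    qed (simp add: q_out C(1))
    then show "AE z in lborel. norm (u z * q k z) \<le> C * \<bar>indicator (K' \<times> UNIV) z * u z\<bar>" for k by simp
  qed simp_all
  define M where "M = (\<integral>z. \<bar>G z \<bullet> ee\<bar> * \<bar>C0\<bar> \<partial>lborel)"
  have GC: "integrable lborel (\<lambda>z. \<bar>G z \<bullet> ee\<bar> * \<bar>C0\<bar>)" using G_inner_integrable by simp
  have G\<psi>_le: "norm ((G z \<bullet> ee) * \<psi> y) \<le> \<bar>G z \<bullet> ee\<bar> * \<bar>C0\<bar>" for z y
    using C0[of y] by (simp add: abs_mult mult_left_mono)
  have shift_borel: "(\<lambda>z. \<psi> (z - c)) \<in> borel_measurable borel" for c
  proof -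
    have "continuous_on UNIV (\<lambda>z. \<psi> (z - c))"
      by (rule continuous_on_compose2[OF C_c_continuous[OF \<psi>]]) (auto intro!: continuous_intros)
    then show ?thesis by (rule borel_measurable_continuous_onI)
  qed
  have lim2: "(\<lambda>k. R k s) \<longlonglongrightarrow> (\<integral>z. (G z \<bullet> ee) * \<psi> z \<partial>lborel)" for s
    unfolding R_def
  proof (rule integral_dominated_convergence[OF _ _ GC])
    have "(\<lambda>k. \<psi> (z - s *\<^sub>R (\<tau> k *\<^sub>R ee))) \<longlonglongrightarrow> \<psi> z" for z
    proof -
      have "(\<lambda>k. z - s *\<^sub>R (\<tau> k *\<^sub>R ee)) \<longlonglongrightarrow> z - s *\<^sub>R (0 *\<^sub>R ee)"
        by (intro tendsto_intros \<tau>0)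
      then show ?thesis
        using continuous_on_tendsto_compose[OF C_c_continuous[OF \<psi>], of "\<lambda>k. z - s *\<^sub>R (\<tau> k *\<^sub>R ee)" z] by simp
    qed
    then show "AE z in lborel. (\<lambda>k. (G z \<bullet> ee) * \<psi> (z - s *\<^sub>R (\<tau> k *\<^sub>R ee))) \<longlonglongrightarrow> (G z \<bullet> ee) * \<psi> z"
      by (intro AE_I2 tendsto_mult tendsto_const)
    show "AE z in lborel. norm ((G z \<bullet> ee) * \<psi> (z - s *\<^sub>R (\<tau> k *\<^sub>R ee))) \<le> \<bar>G z \<bullet> ee\<bar> * \<bar>C0\<bar>" for k
      by (intro AE_I2 G\<psi>_le)
    show "(\<lambda>z. (G z \<bullet> ee) * \<psi> (z - s *\<^sub>R (\<tau> k *\<^sub>R ee))) \<in> borel_measurable lborel" for k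
      using shift_borel[of "s *\<^sub>R (\<tau> k *\<^sub>R ee)"] by simp
  qed simp
  have R_borel: "R k \<in> borel_measurable borel" for k
  proof -
    have "continuous_on UNIV (\<lambda>p. \<psi> (snd p - fst p *\<^sub>R (\<tau> k *\<^sub>R ee)))"
      by (rule continuous_on_compose2[OF C_c_continuous[OF \<psi>]]) (auto intro!: continuous_intros)
    then have "(\<lambda>p. \<psi> (snd p - fst p *\<^sub>R (\<tau> k *\<^sub>R ee))) \<in> borel_measurable borel" by (rule borel_measurable_continuous_onI)
    then have [measurable]: "(\<lambda>p. \<psi> (snd p - fst p *\<^sub>R (\<tau> k *\<^sub>R ee))) \<in> borel_measurable (borel \<Otimes>\<^sub>M borel)"
      by (simp only: borel_prod)
    show ?thesis unfolding R_def[abs_def] by measurable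
  qed
  have R_le: "\<bar>R k s\<bar> \<le> M" for k s
  proof -
    have "\<bar>R k s\<bar> \<le> (\<integral>z. \<bar>(G z \<bullet> ee) * \<psi> (z - s *\<^sub>R (\<tau> k *\<^sub>R ee))\<bar> \<partial>lborel)"
      unfolding R_def by (rule integral_abs_bound)
    also have "\<dots> \<le> M" unfolding M_def
      by (rule integral_mono'[OF GC]) (use G\<psi>_le in auto)
    finally show ?thesis .
  qed
  have lim3: "(\<lambda>k. \<integral>s. indicator {0..1} s * R k s \<partial>lborel) \<longlonglongrightarrow>
      (\<integral>s. indicator {0..1::real} s * (\<integral>z. (G z \<bullet> ee) * \<psi> z \<partial>lborel) \<partial>lborel)"
  proof (rule integral_dominated_convergence)
    show "integrable lborel (\<lambda>s::real. indicator {0..1} s * M)" by simp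
    show "AE s in lborel. (\<lambda>k. indicator {0..1} s * R k s) \<longlonglongrightarrow> indicator {0..1} s * (\<integral>z. (G z \<bullet> ee) * \<psi> z \<partial>lborel)"
      by (intro AE_I2 tendsto_mult tendsto_const lim2)
    show "AE s in lborel. norm (indicator {0..1} s * R k s) \<le> indicator {0..1} s * M" for k
      using R_le by (intro AE_I2) (auto simp: indicator_def)
    show "(\<lambda>s. indicator {0..1} s * R k s) \<in> borel_measurable lborel" for k using R_borel[of k] by simp
  qed simp
  have "(\<integral>z. u z * - ?D z \<partial>lborel) = (\<integral>z. (G z \<bullet> ee) * \<psi> z \<partial>lborel)"
    using LIMSEQ_unique[OF lim1] lim3 unfolding id by simp
  then show ?thesis by (simp add: mult.commute ee_def)
qed

end

section \<open>The modulus of continuity and the shrinking layer\<close>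

definition layer :: "real \<Rightarrow> real set" where
  "layer \<epsilon> = {bm<..<bm + \<epsilon>} \<union> {bp - \<epsilon><..<bp}"

lemma T_modulus_estimate:
  assumes \<epsilon>: "0 < \<epsilon>" "\<epsilon> < bp - bm" and b: "b \<in> {bm, bp}" and h: "norm h \<le> \<epsilon>"
  shows "(\<integral>\<^sup>+x. ennreal \<bar>T b (x + h) - T b x\<bar> \<partial>lborel) \<le>
    3 * (\<integral>\<^sup>+z. indicator (UNIV \<times> layer \<epsilon>) z * ennreal (norm (G z)) \<partial>lborel)"
proof -
  define I where "I = (if b = bm then {bm<..<bm + \<epsilon>} else {bp - \<epsilon><..<bp})"
  have "(\<integral>\<^sup>+x. ennreal \<bar>T b (x + h) - T b x\<bar> \<partial>lborel) \<le>
      3 * (\<integral>\<^sup>+z. indicator (UNIV \<times> I) z * ennreal (norm (G z)) \<partial>lborel)"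
    by (rule T_translation_estimate[of I \<epsilon>]) (use \<epsilon> b h in \<open>auto simp: I_def min_def max_def split: if_splits\<close>)
  also have "\<dots> \<le> 3 * (\<integral>\<^sup>+z. indicator (UNIV \<times> layer \<epsilon>) z * ennreal (norm (G z)) \<partial>lborel)"
    by (intro mult_left_mono nn_integral_mono) (auto simp: I_def layer_def indicator_def)
  finally show ?thesis .
qed

text \<open>Every point of the open strip leaves the layer once it is thin enough, and the
  integrable gradient dominates. This is what makes the translation modulus of the boundary values
  tend to 0.\<close>

lemma layer_integral_tendsto:
  "((\<lambda>\<epsilon>. \<integral>\<^sup>+z. indicator (UNIV \<times> layer \<epsilon>) z * ennreal (norm (G z)) \<partial>lborel) \<longlongrightarrow> 0) (at_right 0)"
proof (rule tendsto_at_right_sequentially[of 0 1])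
  fix S :: "nat \<Rightarrow> real"
  assume S: "\<And>n. 0 < S n" "S \<longlonglongrightarrow> 0"
  have "(\<lambda>n. \<integral>\<^sup>+z. indicator (UNIV \<times> layer (S n)) z * ennreal (norm (G z)) \<partial>lborel) \<longlonglongrightarrow>
      (\<integral>\<^sup>+z. 0 \<partial>(lborel :: ('b \<times> real) measure))"
  proof (rule nn_integral_dominated_convergence[where w = "\<lambda>z. ennreal (norm (G z))"])
    have "(UNIV :: 'b set) \<times> layer \<epsilon> \<in> sets borel" for \<epsilon>
      unfolding layer_def by (intro borel_Times) auto
    then show "(\<lambda>z. indicator (UNIV \<times> layer (S n)) z * ennreal (norm (G z))) \<in> borel_measurable lborel" for n
      by simp
    show "(\<integral>\<^sup>+z. ennreal (norm (G z)) \<partial>lborel) < \<infinity>"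
      using G_integrable by (simp add: integrable_iff_bounded)
    show "AE z in lborel. (\<lambda>n. indicator (UNIV \<times> layer (S n)) z * ennreal (norm (G z))) \<longlonglongrightarrow> 0"
    proof (intro AE_I2)
      fix z :: "'b \<times> real"
      show "(\<lambda>n. indicator (UNIV \<times> layer (S n)) z * ennreal (norm (G z))) \<longlonglongrightarrow> 0"
      proof (cases "z \<in> UNIV \<times> {bm<..<bp}")
        case True
        obtain x t where z: "z = (x, t)" "bm < t" "t < bp" using True by auto
        have "\<forall>\<^sub>F n in sequentially. S n < t - bm" "\<forall>\<^sub>F n in sequentially. S n < bp - t"
          using z by (auto intro!: order_tendstoD(2)[OF S(2)])
        then have "\<forall>\<^sub>F n in sequentially. indicator (UNIV \<times> layer (S n)) z * ennreal (norm (G z)) = 0"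
          by eventually_elim (use z in \<open>auto simp: layer_def indicator_def\<close>)
        then show ?thesis by (rule tendsto_eventually)
      qed (simp add: G_0)
    qed
  qed (auto simp: indicator_def)
  then show "(\<lambda>n. \<integral>\<^sup>+z. indicator (UNIV \<times> layer (S n)) z * ennreal (norm (G z)) \<partial>lborel) \<longlonglongrightarrow> 0"
    by simp
qed simp

end

section \<open>Borel representatives\<close>

lemma completion_rep:
  fixes f :: "'a \<Rightarrow> real"
  assumes "f' \<in> borel_measurable M" "AE x in completion M. f x = f' x"
  shows "integrable (completion M) f \<longleftrightarrow> integrable M f'"
    and "integral\<^sup>L (completion M) f = integral\<^sup>L M f'"
proof -
  note * = has_bochner_integral_completion[OF assms]
  show i: "integrable (completion M) f \<longleftrightarrow> integrable M f'"
    unfolding integrable.simps * ..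
  show "integral\<^sup>L (completion M) f = integral\<^sup>L M f'"
  proof (cases "integrable M f'")
    case True
    then show ?thesis using * has_bochner_integral_integrable has_bochner_integral_integral_eq by metis
  next
    case False
    then show ?thesis using i by (simp add: not_integrable_integral_eq)
  qed
qed

text \<open>Local integrability gives measurability on each box of a countable family of closed
  boxes exhausting the domain; a Lebesgue measurable function then has a Borel
  representative.\<close>

lemma L1_loc_borel_rep:
  fixes f :: "'a::euclidean_space \<Rightarrow> real"
  assumes \<Omega>: "open \<Omega>" and f: "f \<in> L1_loc lebesgue \<Omega>"
  shows "\<exists>f0. f0 \<in> borel_measurable borel \<and> (\<forall>x. x \<notin> \<Omega> \<longrightarrow> f0 x = 0) \<and>
    (AE x in lebesgue. x \<in> \<Omega> \<longrightarrow> f x = f0 x)"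
proof -
  obtain D where D: "countable D" "D \<subseteq> Pow \<Omega>" "\<And>X. X \<in> D \<Longrightarrow> \<exists>a b. X = cbox a b" "\<Union>D = \<Omega>"
    using open_countable_Union_open_cbox[OF \<Omega>] by metis
  have X: "(\<lambda>x. indicator X x * f x) \<in> borel_measurable lebesgue" if "X \<in> D" for X
  proof -
    obtain a b where "X = cbox a b" using D(3)[OF \<open>X \<in> D\<close>] by blast
    then have "set_integrable lebesgue X f" using f D(2) that by (auto simp: L1_loc_def)
    then show ?thesis by (auto simp: set_integrable_def)
  qed
  have "(\<lambda>x. indicator \<Omega> x * f x) \<in> borel_measurable lebesgue"
  proof (rule borel_measurableI)
    fix S :: "real set" assume "open S"
    \<comment> \<open>The preimage is assembled box by box; outside the domain the value is 0, so
      the complement enters exactly when 0 belongs to \<open>S\<close>.\<close>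
    have "(\<lambda>x. indicator \<Omega> x * f x) -` S \<inter> space lebesgue =
        (\<Union>X\<in>D. X \<inter> ((\<lambda>x. indicator X x * f x) -` S \<inter> space lebesgue)) \<union> (if 0 \<in> S then - \<Omega> else {})"
    proof (rule set_eqI)
      fix x
      show "x \<in> (\<lambda>x. indicator \<Omega> x * f x) -` S \<inter> space lebesgue \<longleftrightarrow>
          x \<in> (\<Union>X\<in>D. X \<inter> ((\<lambda>x. indicator X x * f x) -` S \<inter> space lebesgue)) \<union> (if 0 \<in> S then - \<Omega> else {})"
        using D(4) by (cases "x \<in> \<Omega>") (auto simp: indicator_def)
    qed
    also have "\<dots> \<in> sets lebesgue"
    proof (intro sets.Un sets.countable_UN'' D(1))
      fix X assume "X \<in> D"
      then obtain a b where "X = cbox a b" using D(3) by blast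
      then have "X \<in> sets lebesgue" by simp
      moreover have "(\<lambda>x. indicator X x * f x) -` S \<inter> space lebesgue \<in> sets lebesgue"
        using X[OF \<open>X \<in> D\<close>] \<open>open S\<close> by (intro measurable_sets) auto
      ultimately show "X \<inter> ((\<lambda>x. indicator X x * f x) -` S \<inter> space lebesgue) \<in> sets lebesgue" by (rule sets.Int)
    qed (use \<Omega> in auto)
    finally show "(\<lambda>x. indicator \<Omega> x * f x) -` S \<inter> space lebesgue \<in> sets lebesgue" .
  qed
  then obtain f1 where f1: "f1 \<in> borel_measurable lborel" "AE x in lborel. indicator \<Omega> x * f x = f1 x"
    using completion_ex_borel_measurable_real by blast
  have [measurable]: "f1 \<in> borel_measurable borel" "\<Omega> \<in> sets borel" using f1(1) \<Omega> by auto
  show ?thesis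
  proof (intro exI conjI allI impI)
    show "(\<lambda>x. indicator \<Omega> x * f1 x) \<in> borel_measurable borel" by measurable
    show "AE x in lebesgue. x \<in> \<Omega> \<longrightarrow> f x = indicator \<Omega> x * f1 x"
      using f1(2) unfolding AE_completion_iff by eventually_elim (auto simp: indicator_def)
  qed simp
qed

lemma set_integral_rep:
  fixes f k :: "'a::euclidean_space \<Rightarrow> real"
  assumes "f0 \<in> borel_measurable borel" "\<And>x. x \<notin> \<Omega> \<Longrightarrow> f0 x = 0" "AE x in lebesgue. x \<in> \<Omega> \<longrightarrow> f x = f0 x"
    and "k \<in> borel_measurable borel"
  shows "set_integrable lebesgue \<Omega> (\<lambda>x. f x * k x) \<longleftrightarrow> integrable lborel (\<lambda>x. f0 x * k x)"
    and "(LINT x:\<Omega>|lebesgue. f x * k x) = (\<integral>x. f0 x * k x \<partial>lborel)"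
proof -
  have m: "(\<lambda>x. f0 x * k x) \<in> borel_measurable lborel" using assms(1,4) by simp
  have ae: "AE x in lebesgue. indicator \<Omega> x *\<^sub>R (f x * k x) = f0 x * k x"
    using assms(3) by eventually_elim (use assms(2) in \<open>auto simp: indicator_def\<close>)
  show "set_integrable lebesgue \<Omega> (\<lambda>x. f x * k x) \<longleftrightarrow> integrable lborel (\<lambda>x. f0 x * k x)"
    unfolding set_integrable_def by (rule completion_rep(1)[OF m ae])
  show "(LINT x:\<Omega>|lebesgue. f x * k x) = (\<integral>x. f0 x * k x \<partial>lborel)"
    unfolding set_lebesgue_integral_def by (rule completion_rep(2)[OF m ae])
qed

lemma L1_loc_times_test_integrable:
  fixes f \<phi> :: "'a::euclidean_space \<Rightarrow> real"
  assumes f: "f \<in> L1_loc lebesgue \<Omega>" and \<phi>: "\<phi> \<in> test_functions \<Omega>"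
    and k: "k \<in> borel_measurable borel" "\<And>x. \<bar>k x\<bar> \<le> C" "\<And>x. x \<notin> closure {x. \<phi> x \<noteq> 0} \<Longrightarrow> k x = 0"
  shows "set_integrable lebesgue \<Omega> (\<lambda>x. f x * k x)"
proof -
  let ?K = "closure {x. \<phi> x \<noteq> 0}"
  have K: "compact ?K" "?K \<subseteq> \<Omega>" using \<phi> by (auto simp: test_functions_def)
  then have "integrable lebesgue (\<lambda>x. indicator ?K x * f x)"
    using f by (auto simp: L1_loc_def set_integrable_def)
  then have "integrable lebesgue (\<lambda>x. (indicator ?K x * f x) * k x)"
    by (rule integrable_real_mult_bounded[where C = C]) (use k(1,2) in \<open>auto intro: measurable_completion\<close>)
  moreover have "(\<lambda>x. (indicator ?K x * f x) * k x) = (\<lambda>x. indicator \<Omega> x *\<^sub>R (f x * k x))"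
    using K(2) k(3) by (fastforce simp: indicator_def)
  ultimately show ?thesis by (simp add: set_integrable_def)
qed

lemma L1_loc_times_test_integrable':
  fixes f \<phi> :: "'a::euclidean_space \<Rightarrow> real"
  assumes f: "f \<in> L1_loc lebesgue \<Omega>" and \<phi>: "\<phi> \<in> test_functions \<Omega>"
  shows "set_integrable lebesgue \<Omega> (\<lambda>x. f x * \<phi> x)"
    and "set_integrable lebesgue \<Omega> (\<lambda>x. f x * frechet_derivative \<phi> (at x) i)"
proof -
  have \<phi>c: "\<phi> \<in> C_c 1" using \<phi> by (rule test_functions_imp_C_c)
  obtain C where C: "\<And>x. \<bar>\<phi> x\<bar> \<le> C" using C_c_bounded[OF \<phi>c] by metis
  show "set_integrable lebesgue \<Omega> (\<lambda>x. f x * \<phi> x)"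
    using closure_subset[of "{x. \<phi> x \<noteq> 0}"]
    by (intro L1_loc_times_test_integrable[OF f \<phi> C_c_borel[OF \<phi>c] C]) auto
  obtain B where B: "\<And>x. \<bar>frechet_derivative \<phi> (at x) i\<bar> \<le> B" using C_c_derivative_bounded[OF \<phi>c] by metis
  show "set_integrable lebesgue \<Omega> (\<lambda>x. f x * frechet_derivative \<phi> (at x) i)"
    by (rule L1_loc_times_test_integrable[OF f \<phi> C_c_derivative_borel[OF \<phi>c] B C_c_derivative_eq_0[OF \<phi>c]])
qed

section \<open>Linearity and uniqueness of weak derivatives\<close>

lemma L1_loc_add: "f \<in> L1_loc M S \<Longrightarrow> f' \<in> L1_loc M S \<Longrightarrow> (\<lambda>x. f x + f' x) \<in> L1_loc M S"
  by (auto simp: L1_loc_def intro: set_integral_add)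

lemma L1_loc_cmult: "f \<in> L1_loc M S \<Longrightarrow> (\<lambda>x. a * f x) \<in> L1_loc M S"
  by (auto simp: L1_loc_def)

lemma has_weak_partial_add:
  assumes u: "has_weak_partial \<Omega> i u g" and v: "has_weak_partial \<Omega> i v g'"
  shows "has_weak_partial \<Omega> i (\<lambda>x. u x + v x) (\<lambda>x. g x + g' x)"
  unfolding has_weak_partial_def
proof (intro conjI ballI)
  have L: "u \<in> L1_loc lebesgue \<Omega>" "v \<in> L1_loc lebesgue \<Omega>" "g \<in> L1_loc lebesgue \<Omega>" "g' \<in> L1_loc lebesgue \<Omega>"
    using u v by (auto simp: has_weak_partial_def)
  then show "(\<lambda>x. u x + v x) \<in> L1_loc lebesgue \<Omega>" "(\<lambda>x. g x + g' x) \<in> L1_loc lebesgue \<Omega>"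
    by (auto intro: L1_loc_add)
  fix \<phi> assume \<phi>: "\<phi> \<in> test_functions \<Omega>"
  have "(LINT x:\<Omega>|lebesgue. u x * frechet_derivative \<phi> (at x) i + v x * frechet_derivative \<phi> (at x) i) =
      - (LINT x:\<Omega>|lebesgue. g x * \<phi> x + g' x * \<phi> x)"
    using u v \<phi> L1_loc_times_test_integrable'[OF L(1) \<phi>] L1_loc_times_test_integrable'[OF L(2) \<phi>]
      L1_loc_times_test_integrable'[OF L(3) \<phi>] L1_loc_times_test_integrable'[OF L(4) \<phi>]
    by (simp add: has_weak_partial_def set_integral_add)
  then show "(LINT x:\<Omega>|lebesgue. (u x + v x) * frechet_derivative \<phi> (at x) i) =
      - (LINT x:\<Omega>|lebesgue. (g x + g' x) * \<phi> x)"
    by (simp add: distrib_right)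
qed

lemma has_weak_partial_cmult:
  assumes u: "has_weak_partial \<Omega> i u g"
  shows "has_weak_partial \<Omega> i (\<lambda>x. a * u x) (\<lambda>x. a * g x)"
  using u unfolding has_weak_partial_def by (auto simp: L1_loc_cmult mult.assoc)

lemma has_weak_partial_unique:
  fixes g g' :: "'a::euclidean_space \<Rightarrow> real"
  assumes \<Omega>: "open \<Omega>" and g: "has_weak_partial \<Omega> i u g" and g': "has_weak_partial \<Omega> i u g'"
  shows "AE x in lebesgue. x \<in> \<Omega> \<longrightarrow> g x = g' x"
proof -
  have d: "has_weak_partial \<Omega> i (\<lambda>x. u x + -1 * u x) (\<lambda>x. g x + -1 * g' x)"
    by (intro has_weak_partial_add has_weak_partial_cmult g g')
  have "AE x in lebesgue. x \<in> \<Omega> \<longrightarrow> g x + -1 * g' x = 0"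
  proof (rule fundamental_lemma_calculus_of_variations[OF \<Omega>])
    show "(\<lambda>x. g x + -1 * g' x) \<in> L1_loc lebesgue \<Omega>" using d by (simp add: has_weak_partial_def)
    fix \<phi> assume "\<phi> \<in> test_functions \<Omega>"
    then show "(LINT x:\<Omega>|lebesgue. (g x + -1 * g' x) * \<phi> x) = 0"
      using d by (simp add: has_weak_partial_def set_lebesgue_integral_def)
  qed
  then show ?thesis by eventually_elim simp
qed

lemma W11_dot_add: "u \<in> W11_dot \<Omega> \<Longrightarrow> v \<in> W11_dot \<Omega> \<Longrightarrow> (\<lambda>x. u x + v x) \<in> W11_dot \<Omega>"
  unfolding W11_dot_def using has_weak_partial_add set_integral_add(1) L1_loc_add by blast

lemma W11_dot_cmult: "u \<in> W11_dot \<Omega> \<Longrightarrow> (\<lambda>x. a * u x) \<in> W11_dot \<Omega>"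
  unfolding W11_dot_def using has_weak_partial_cmult L1_loc_cmult set_integrable_mult_right by blast

text \<open>The passage from Lebesgue measurable functions to the Borel setting of the locale. The
  last conclusion covers every weak partial derivative, not only the chosen one, since weak
  derivatives are unique almost everywhere.\<close>

lemma W11_dot_strip_rep:
  fixes u :: "(real^'n) \<times> real \<Rightarrow> real"
  assumes b: "bm < bp" and u: "u \<in> W11_dot (strip bm bp)"
  obtains u0 G0 where "strip_rep bm bp u0 G0" "AE z in lebesgue. z \<in> strip bm bp \<longrightarrow> u z = u0 z"
    "\<And>i g. i \<in> Basis \<Longrightarrow> has_weak_partial (strip bm bp) i u g \<Longrightarrow>
      AE z in lebesgue. z \<in> strip bm bp \<longrightarrow> g z = G0 z \<bullet> i"
proof -
  let ?\<Omega> = "strip bm bp :: ((real^'n) \<times> real) set"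
  have \<Omega>: "open ?\<Omega>" by (rule open_strip)
  have uL: "u \<in> L1_loc lebesgue ?\<Omega>" using u by (simp add: W11_dot_def)
  obtain u0 where u0: "u0 \<in> borel_measurable borel" "\<And>x. x \<notin> ?\<Omega> \<Longrightarrow> u0 x = 0"
    "AE x in lebesgue. x \<in> ?\<Omega> \<longrightarrow> u x = u0 x"
    using L1_loc_borel_rep[OF \<Omega> uL] by blast
  define P where "P i g g0 \<longleftrightarrow> has_weak_partial ?\<Omega> i u g \<and> g0 \<in> borel_measurable borel \<and> (\<forall>x. x \<notin> ?\<Omega> \<longrightarrow> g0 x = 0) \<and>
      (AE x in lebesgue. x \<in> ?\<Omega> \<longrightarrow> g x = g0 x) \<and> integrable lborel g0" for i g g0
  have "\<exists>p. P i (fst p) (snd p)" if "i \<in> Basis" for i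
  proof -
    obtain g where g: "has_weak_partial ?\<Omega> i u g" "set_integrable lebesgue ?\<Omega> g"
      using u \<open>i \<in> Basis\<close> by (auto simp: W11_dot_def)
    obtain g0 where g0: "g0 \<in> borel_measurable borel" "\<And>x. x \<notin> ?\<Omega> \<Longrightarrow> g0 x = 0"
      "AE x in lebesgue. x \<in> ?\<Omega> \<longrightarrow> g x = g0 x"
      using L1_loc_borel_rep[OF \<Omega>, of g] g(1) unfolding has_weak_partial_def by blast
    have "integrable lborel g0"
      using set_integral_rep(1)[OF g0, of "\<lambda>_. 1"] g(2) by simp
    then have "P i g g0" using g(1) g0 by (simp add: P_def)
    then show ?thesis by (intro exI[of _ "(g, g0)"]) simp
  qed
  then obtain p where p: "\<And>i. i \<in> Basis \<Longrightarrow> P i (fst (p i)) (snd (p i))"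
    using bchoice[of Basis "\<lambda>i p. P i (fst p) (snd p)"] by blast
  define g g0 where "g i = fst (p i)" and "g0 i = snd (p i)" for i
  have g: "\<And>i. i \<in> Basis \<Longrightarrow> has_weak_partial ?\<Omega> i u (g i)"
    and g0: "\<And>i. i \<in> Basis \<Longrightarrow> g0 i \<in> borel_measurable borel" "\<And>i x. i \<in> Basis \<Longrightarrow> x \<notin> ?\<Omega> \<Longrightarrow> g0 i x = 0"
      "\<And>i. i \<in> Basis \<Longrightarrow> AE x in lebesgue. x \<in> ?\<Omega> \<longrightarrow> g i x = g0 i x"
      "\<And>i. i \<in> Basis \<Longrightarrow> integrable lborel (g0 i)"
    using p by (auto simp: P_def g_def g0_def)
  define G0 where "G0 x = (\<Sum>i\<in>Basis. g0 i x *\<^sub>R i)" for x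
  have G0i: "G0 x \<bullet> i = g0 i x" if "i \<in> Basis" for x i
    using that by (simp add: G0_def inner_sum_left inner_Basis if_distrib cong: if_cong)
  have "strip_rep bm bp u0 G0"
  proof (unfold_locales)
    show "bm < bp" by fact
    show "open ((UNIV :: (real^'n) set) \<times> {bm<..<bp})" using \<Omega> by (simp add: strip_eq_Times)
    show "convex ((UNIV :: (real^'n) set) \<times> {bm<..<bp})" by (intro convex_Times) auto
    show "u0 \<in> borel_measurable borel" by fact
    show "u0 x = 0" if "x \<notin> UNIV \<times> {bm<..<bp}" for x using u0(2) that by (simp add: strip_eq_Times)
    show "G0 x = 0" if "x \<notin> UNIV \<times> {bm<..<bp}" for x using g0(2) that by (simp add: G0_def strip_eq_Times)
    show "integrable lborel G0"
      unfolding G0_def[abs_def] using g0(4) by (intro Bochner_Integration.integrable_sum) auto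
    fix K :: "((real^'n) \<times> real) set" assume K: "compact K" "K \<subseteq> UNIV \<times> {bm<..<bp}"
    have Kb: "indicator K \<in> borel_measurable (borel :: ((real^'n) \<times> real) measure)"
      using K(1) by (intro borel_measurable_indicator) (simp add: borel_compact)
    have "set_integrable lebesgue K u" using uL K by (auto simp: L1_loc_def strip_eq_Times)
    moreover have "(\<lambda>x. indicator ?\<Omega> x *\<^sub>R (u x * indicator K x)) = (\<lambda>x. indicator K x *\<^sub>R u x)"
      using K(2) by (fastforce simp: indicator_def strip_eq_Times)
    ultimately have "set_integrable lebesgue ?\<Omega> (\<lambda>x. u x * indicator K x)"
      by (simp add: set_integrable_def)
    then show "integrable lborel (\<lambda>x. indicator K x * u0 x)"
      using set_integral_rep(1)[OF u0 Kb] by (simp add: mult.commute)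
  next
    fix \<phi> :: "(real^'n) \<times> real \<Rightarrow> real" and i :: "(real^'n) \<times> real"
    assume "\<phi> \<in> test_functions (UNIV \<times> {bm<..<bp})" and i: "i \<in> Basis"
    then have \<phi>: "\<phi> \<in> test_functions ?\<Omega>" by (simp add: strip_eq_Times)
    note \<phi>c = test_functions_imp_C_c[OF \<phi>]
    show "(\<integral>x. u0 x * frechet_derivative \<phi> (at x) i \<partial>lborel) = - (\<integral>x. (G0 x \<bullet> i) * \<phi> x \<partial>lborel)"
      using g[OF i] \<phi> set_integral_rep(2)[OF u0 C_c_derivative_borel[OF \<phi>c], of i]
        set_integral_rep(2)[OF g0(1,2,3)[OF i] C_c_borel[OF \<phi>c]]
      by (simp add: has_weak_partial_def G0i[OF i] i)
  qed
  then show thesis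
  proof (rule that[OF _ u0(3)])
    fix i g' assume i: "i \<in> Basis" and g': "has_weak_partial ?\<Omega> i u g'"
    show "AE z in lebesgue. z \<in> ?\<Omega> \<longrightarrow> g' z = G0 z \<bullet> i"
      using has_weak_partial_unique[OF \<Omega> g' g[OF i]] g0(3)[OF i]
      by eventually_elim (use G0i[OF i] in auto)
  qed
qed

section \<open>Boundary functions characterised by integration by parts\<close>

text \<open>Local integrability together with integration by parts already determines
  \<open>t\<close> almost everywhere on the boundary. Isolating the two lets uniqueness and
  linearity be proved for single functions, before an operator is chosen.\<close>

definition trace_function ::
  "real \<Rightarrow> real \<Rightarrow> ((real^'n) \<times> real \<Rightarrow> real) \<Rightarrow> ((real^'n) \<times> real \<Rightarrow> real) \<Rightarrow> bool" where
  "trace_function bm bp u t \<longleftrightarrow> t \<in> L1_loc surface_measure (frontier (strip bm bp)) \<and>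
    (\<forall>\<psi>\<in>C_c 1. \<forall>i\<in>Basis. \<forall>g. has_weak_partial (strip bm bp) i u g \<longrightarrow>
        set_integrable lebesgue (strip bm bp) (\<lambda>x. u x * frechet_derivative \<psi> (at x) i) \<and>
        (LINT x:strip bm bp|lebesgue. u x * frechet_derivative \<psi> (at x) i) =
        - (LINT x:strip bm bp|lebesgue. \<psi> x * g x) +
        (LINT x:frontier (strip bm bp)|surface_measure.
           \<psi> x * t x * (outward_unit_normal (strip bm bp) x \<bullet> i)))"

lemma C_c_slice_times_integrable:
  fixes t :: "(real^'n) \<times> real \<Rightarrow> real"
  assumes \<psi>: "\<psi> \<in> C_c 1" and t: "(\<lambda>x. t (x, b)) \<in> L1_loc lebesgue UNIV"
  shows "integrable lebesgue (\<lambda>x. \<psi> (x, b) * t (x, b))"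
proof -
  let ?K = "fst ` closure {z. \<psi> z \<noteq> 0}"
  have K: "compact ?K"
    by (intro compact_continuous_image continuous_on_fst continuous_on_id C_c_compact[OF \<psi>])
  obtain C where C: "\<And>z. \<bar>\<psi> z\<bar> \<le> C" using C_c_bounded[OF \<psi>] by metis
  have "continuous_on UNIV (\<lambda>x. \<psi> (x, b))"
    by (rule continuous_on_compose2[OF C_c_continuous[OF \<psi>]]) (auto intro!: continuous_intros)
  then have m: "(\<lambda>x. \<psi> (x, b)) \<in> borel_measurable lebesgue"
    by (intro measurable_completion) (simp add: borel_measurable_continuous_onI)
  have "integrable lebesgue (\<lambda>x. indicator ?K x * t (x, b))"
    using t K by (auto simp: L1_loc_def set_integrable_def)
  then have "integrable lebesgue (\<lambda>x. (indicator ?K x * t (x, b)) * \<psi> (x, b))"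
    by (rule integrable_real_mult_bounded[OF _ m C])
  moreover have "(indicator ?K x * t (x, b)) * \<psi> (x, b) = \<psi> (x, b) * t (x, b)" for x
  proof (cases "\<psi> (x, b) = 0")
    case False
    then have "x \<in> ?K" using closure_subset[of "{z. \<psi> z \<noteq> 0}"] by (force simp: image_iff)
    then show ?thesis by simp
  qed simp
  ultimately show ?thesis by simp
qed

lemma boundary_integral_strip:
  fixes t :: "(real^'n) \<times> real \<Rightarrow> real"
  assumes b: "bm < bp" and \<psi>: "\<psi> \<in> C_c 1" and t: "\<And>b. b \<in> {bm, bp} \<Longrightarrow> (\<lambda>x. t (x, b)) \<in> L1_loc lebesgue UNIV"
  shows "(LINT x:frontier (strip bm bp)|surface_measure. \<psi> x * t x * (outward_unit_normal (strip bm bp) x \<bullet> i)) =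
    snd i * ((\<integral>x. \<psi> (x, bp) * t (x, bp) \<partial>lebesgue) - (\<integral>x. \<psi> (x, bm) * t (x, bm) \<partial>lebesgue))"
proof -
  have n: "outward_unit_normal (strip bm bp) (x, bp) \<bullet> i = snd i"
    "outward_unit_normal (strip bm bp) (x, bm) \<bullet> i = - snd i" for x :: "real^'n"
    using outward_unit_normal_strip[OF b, of x] by (simp_all add: inner_prod_def)
  have "(LINT x:frontier (strip bm bp)|surface_measure. \<psi> x * t x * (outward_unit_normal (strip bm bp) x \<bullet> i)) =
      (\<integral>x. \<psi> (x, bm) * t (x, bm) * (outward_unit_normal (strip bm bp) (x, bm) \<bullet> i) \<partial>lebesgue) +
      (\<integral>x. \<psi> (x, bp) * t (x, bp) * (outward_unit_normal (strip bm bp) (x, bp) \<bullet> i) \<partial>lebesgue)"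
  proof (rule integral_frontier_strip[OF b])
    fix c assume c: "c \<in> {bm, bp}"
    have "integrable lebesgue (\<lambda>x. \<psi> (x, c) * t (x, c))" by (rule C_c_slice_times_integrable[OF \<psi> t[OF c]])
    then show "integrable lebesgue (\<lambda>x. \<psi> (x, c) * t (x, c) * (outward_unit_normal (strip bm bp) (x, c) \<bullet> i))"
      using c n by auto
  qed
  also have "\<dots> = snd i * ((\<integral>x. \<psi> (x, bp) * t (x, bp) \<partial>lebesgue) - (\<integral>x. \<psi> (x, bm) * t (x, bm) \<partial>lebesgue))"
    unfolding n by (simp add: algebra_simps)
  finally show ?thesis .
qed

text \<open>Testing with \<open>\<psi>(x', x\<^sub>N) = \<phi>(x') \<eta>(x\<^sub>N)\<close>, where \<open>\<eta>\<close> is a bump at one of the two heights.\<close>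

lemma boundary_integral_unique:
  fixes t t' :: "(real^'n) \<times> real \<Rightarrow> real"
  assumes b: "bm < bp" and t: "\<And>b. b \<in> {bm, bp} \<Longrightarrow> (\<lambda>x. t (x, b)) \<in> L1_loc lebesgue UNIV"
    and t': "\<And>b. b \<in> {bm, bp} \<Longrightarrow> (\<lambda>x. t' (x, b)) \<in> L1_loc lebesgue UNIV"
    and eq: "\<And>\<psi>. \<psi> \<in> C_c 1 \<Longrightarrow>
      (\<integral>x. \<psi> (x, bp) * t (x, bp) \<partial>lebesgue) - (\<integral>x. \<psi> (x, bm) * t (x, bm) \<partial>lebesgue) =
      (\<integral>x. \<psi> (x, bp) * t' (x, bp) \<partial>lebesgue) - (\<integral>x. \<psi> (x, bm) * t' (x, bm) \<partial>lebesgue)"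
    and c: "c \<in> {bm, bp}"
  shows "AE x in lebesgue. t (x, c) = t' (x, c)"
proof -
  let ?r = "bp - bm"
  have "AE x in lebesgue. x \<in> UNIV \<longrightarrow> t (x, c) + -1 * t' (x, c) = 0"
  proof (rule fundamental_lemma_calculus_of_variations[OF open_UNIV])
    show "(\<lambda>x. t (x, c) + -1 * t' (x, c)) \<in> L1_loc lebesgue UNIV"
      by (intro L1_loc_add L1_loc_cmult t t' c)
    fix \<phi> :: "real^'n \<Rightarrow> real" assume \<phi>: "\<phi> \<in> test_functions UNIV"
    \<comment> \<open>Centred at \<open>c\<close> with half-width bp - bm: positive at
      \<open>c\<close>, and zero at the other height, which is an endpoint of the open
      interval.\<close>
    define \<eta> where "\<eta> = box_bump (c - ?r) (c + ?r) 1"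
    have \<eta>c: "0 < \<eta> c" using b by (simp add: \<eta>_def box_bump_def smooth_step_eq)
    have \<eta>0: "\<eta> d = 0" if "d \<in> {bm, bp}" "d \<noteq> c" for d
      unfolding \<eta>_def by (rule box_bump_eq_0) (use that c in \<open>auto simp: box_real\<close>)
    define \<psi> where "\<psi> z = \<phi> (fst z) * \<eta> (snd z)" for z
    have \<psi>: "\<psi> \<in> C_c 1"
    proof -
      have "C_k k (\<lambda>z::(real^'n) \<times> real. \<phi> (fst z + 0))" "C_k k (\<lambda>z::(real^'n) \<times> real. \<eta> (snd z + 0))" for k
        using \<phi> C_k_box_bump unfolding \<eta>_def
        by (intro C_k_affine bounded_linear_fst bounded_linear_snd; simp add: test_functions_def)+
      then have C: "C_k k \<psi>" for k
        using C_k_mult[of k "\<lambda>z. \<phi> (fst z)" "\<lambda>z. \<eta> (snd z)"] by (simp add: \<psi>_def[abs_def])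
      have "{z. \<psi> z \<noteq> 0} \<subseteq> closure {x. \<phi> x \<noteq> 0} \<times> cbox (c - ?r) (c + ?r)"
      proof
        fix z assume "z \<in> {z. \<psi> z \<noteq> 0}"
        then have "\<phi> (fst z) \<noteq> 0" "\<eta> (snd z) \<noteq> 0" by (auto simp: \<psi>_def)
        then have "fst z \<in> closure {x. \<phi> x \<noteq> 0}" "snd z \<in> cbox (c - ?r) (c + ?r)"
          using closure_subset[of "{x. \<phi> x \<noteq> 0}"] box_bump_eq_0[of "snd z" "c - ?r" "c + ?r" 1] box_subset_cbox
          unfolding \<eta>_def by (blast, blast)
        then show "z \<in> closure {x. \<phi> x \<noteq> 0} \<times> cbox (c - ?r) (c + ?r)" by (simp add: mem_Times_iff)
      qed
      moreover have "compact (closure {x. \<phi> x \<noteq> 0} \<times> cbox (c - ?r) (c + ?r))"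
        using \<phi> by (intro compact_Times compact_cbox) (simp add: test_functions_def)
      ultimately have "compact (closure {z. \<psi> z \<noteq> 0})"
        by (meson bounded_subset compact_closure compact_imp_bounded)
      then show ?thesis using C[of 1] unfolding C_c_def by blast
    qed
    have E: "(\<integral>x. \<psi> (x, d) * s (x, d) \<partial>lebesgue) = (if d = c then \<eta> c * (\<integral>x. s (x, c) * \<phi> x \<partial>lebesgue) else 0)"
      if "d \<in> {bm, bp}" for d and s :: "(real^'n) \<times> real \<Rightarrow> real"
      using \<eta>0[OF that] by (auto simp: \<psi>_def mult_ac simp flip: integral_mult_right_zero)
    have "\<eta> c * (\<integral>x. t (x, c) * \<phi> x \<partial>lebesgue) = \<eta> c * (\<integral>x. t' (x, c) * \<phi> x \<partial>lebesgue)"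
      using eq[OF \<psi>] c b by (auto simp: E split: if_splits)
    then have "(\<integral>x. t (x, c) * \<phi> x \<partial>lebesgue) = (\<integral>x. t' (x, c) * \<phi> x \<partial>lebesgue)"
      using \<eta>c by simp
    moreover have "integrable lebesgue (\<lambda>x. t (x, c) * \<phi> x)" "integrable lebesgue (\<lambda>x. t' (x, c) * \<phi> x)"
      using L1_loc_times_test_integrable'(1)[OF t[OF c] \<phi>] L1_loc_times_test_integrable'(1)[OF t'[OF c] \<phi>]
      by (simp_all add: set_integrable_def)
    ultimately show "(LINT x:UNIV|lebesgue. (t (x, c) + -1 * t' (x, c)) * \<phi> x) = 0"
      by (simp add: set_lebesgue_integral_def left_diff_distrib)
  qed
  then show ?thesis by eventually_elim simp
qed

section \<open>The trace operator\<close>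

text \<open>All properties are claimed of one and the same \<open>t\<close>, so that a single choice
  for each u serves them simultaneously.\<close>

lemma trace_exists:
  fixes u :: "(real^'n) \<times> real \<Rightarrow> real"
  assumes b: "bm < bp" and u: "u \<in> W11_dot (strip bm bp)"
  shows "\<exists>t. trace_function bm bp u t \<and>
    (continuous_on (closure (strip bm bp)) u \<longrightarrow> (AE x\<in>frontier (strip bm bp) in surface_measure. t x = u x)) \<and>
    (\<forall>\<epsilon> G. 0 < \<epsilon> \<and> \<epsilon> < bp - bm \<and> has_weak_gradient (strip bm bp) u G \<longrightarrow>
        (\<integral>\<^sup>+x. ennreal \<bar>t (x, bp) - t (x, bm)\<bar> \<partial>lebesgue)
          \<le> (\<integral>\<^sup>+x\<in>strip bm bp. ennreal \<bar>G x \<bullet> (0, 1)\<bar> \<partial>lebesgue) \<and>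
        (\<forall>b\<in>{bm, bp}. L1_modulus t b \<epsilon>
          \<le> ennreal 3 * (\<integral>\<^sup>+x\<in>boundary_layer bm bp \<epsilon>. ennreal (norm (G x)) \<partial>lebesgue))) \<and>
    (\<forall>b\<in>{bm, bp}. (L1_modulus t b \<longlongrightarrow> 0) (at_right 0))"
proof -
  let ?\<Omega> = "strip bm bp :: ((real^'n) \<times> real) set"
  obtain u0 G0 where rep: "strip_rep bm bp u0 G0" and uu0: "AE z in lebesgue. z \<in> ?\<Omega> \<longrightarrow> u z = u0 z"
    and GG0: "\<And>i g. i \<in> Basis \<Longrightarrow> has_weak_partial ?\<Omega> i u g \<Longrightarrow> AE z in lebesgue. z \<in> ?\<Omega> \<longrightarrow> g z = G0 z \<bullet> i"
    using W11_dot_strip_rep[OF b u] by blast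
  interpret S: strip_rep bm bp u0 G0 by (rule rep)
  have u0: "u0 x = 0" and G0: "G0 x = 0" if "x \<notin> ?\<Omega>" for x
    using S.u_0 S.G_0 that by (auto simp: strip_eq_Times)
  define t where "t z = S.T (snd z) (fst z)" for z
  have t: "t (x, c) = S.T c x" for x c by (simp add: t_def)
  have tL: "(\<lambda>x. t (x, c)) \<in> L1_loc lebesgue UNIV" for c
    unfolding L1_loc_def
  proof (intro CollectI allI impI)
    fix K :: "(real^'n) set" assume K: "compact K \<and> K \<subseteq> UNIV"
    then have "integrable lborel (\<lambda>x. indicator K x * S.T c x)" by (intro S.T_loc_integrable) simp
    then show "set_integrable lebesgue K (\<lambda>x. t (x, c))"
      unfolding set_integrable_def t by (simp add: integrable_completion borel_measurable_integrable)
  qed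
  have tf: "trace_function bm bp u t"
    unfolding trace_function_def
  proof (intro conjI ballI allI impI)
    show "t \<in> L1_loc surface_measure (frontier (strip bm bp))"
      using tL by (simp add: L1_loc_frontier_strip[OF b])
    fix \<psi> :: "(real^'n) \<times> real \<Rightarrow> real" and i :: "(real^'n) \<times> real" and g
    assume \<psi>: "\<psi> \<in> C_c 1" and i: "i \<in> Basis" and g: "has_weak_partial ?\<Omega> i u g"
    show "set_integrable lebesgue ?\<Omega> (\<lambda>x. u x * frechet_derivative \<psi> (at x) i)"
      using set_integral_rep(1)[OF S.u_borel u0 uu0 C_c_derivative_borel[OF \<psi>]] S.u_derivative_integrable[OF \<psi>]
      by blast
    have L: "(LINT x:?\<Omega>|lebesgue. u x * frechet_derivative \<psi> (at x) i) =
        (\<integral>z. u0 z * frechet_derivative \<psi> (at z) i \<partial>lborel)"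
      by (rule set_integral_rep(2)[OF S.u_borel u0 uu0 C_c_derivative_borel[OF \<psi>]])
    have gi_borel: "(\<lambda>z. G0 z \<bullet> i) \<in> borel_measurable borel" by simp
    have R: "(LINT x:?\<Omega>|lebesgue. \<psi> x * g x) = (\<integral>z. \<psi> z * (G0 z \<bullet> i) \<partial>lborel)"
      using set_integral_rep(2)[OF gi_borel _ GG0[OF i g] C_c_borel[OF \<psi>]] G0 by (simp add: mult.commute)
    have B: "(LINT x:frontier ?\<Omega>|surface_measure. \<psi> x * t x * (outward_unit_normal ?\<Omega> x \<bullet> i)) =
        snd i * ((\<integral>x. \<psi> (x, bp) * S.T bp x \<partial>lborel) - (\<integral>x. \<psi> (x, bm) * S.T bm x \<partial>lborel))"
      unfolding boundary_integral_strip[OF b \<psi> tL] t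
      using borel_measurable_integrable[OF S.T_times_integrable[OF \<psi>]] by (simp add: integral_completion)
    \<comment> \<open>For horizontal directions the normal component vanishes and with it the
      boundary term; only the last direction sees the trace.\<close>
    consider e where "i = (e, 0)" | "i = (0, 1)"
      using i by (auto simp: Basis_prod_def)
    then show "(LINT x:?\<Omega>|lebesgue. u x * frechet_derivative \<psi> (at x) i) =
        - (LINT x:?\<Omega>|lebesgue. \<psi> x * g x) +
        (LINT x:frontier ?\<Omega>|surface_measure. \<psi> x * t x * (outward_unit_normal ?\<Omega> x \<bullet> i))"
    proof cases
      case 1
      then show ?thesis using S.integration_by_parts_horizontal[OF \<psi>, of e] unfolding L R B by simp
    next
      case 2
      then show ?thesis using S.integration_by_parts_vertical[OF \<psi>] unfolding L R B S.g_def by simp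
    qed
  qed
  have cont: "AE x\<in>frontier ?\<Omega> in surface_measure. t x = u x" if c: "continuous_on (closure ?\<Omega>) u"
    unfolding AE_frontier_strip[OF b]
  proof
    fix c assume "c \<in> {bm, bp}"
    moreover have "AE z in lborel. z \<in> UNIV \<times> {bm<..<bp} \<longrightarrow> u z = u0 z"
      using uu0 unfolding AE_completion_iff strip_eq_Times .
    ultimately have "AE x in lborel. S.T c x = u (x, c)"
      using c S.T_eq_continuous[of u c] by (simp add: closure_strip[OF b])
    then show "AE x in lebesgue. t (x, c) = u (x, c)" unfolding AE_completion_iff t .
  qed
  have modulus: "L1_modulus t c \<epsilon> \<le> ennreal 3 * (\<integral>\<^sup>+z. indicator (UNIV \<times> S.layer \<epsilon>) z * ennreal (norm (G0 z)) \<partial>lborel)"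
    if "0 < \<epsilon>" "\<epsilon> < bp - bm" "c \<in> {bm, bp}" for c \<epsilon>
    unfolding L1_modulus_def
  proof (rule SUP_least)
    fix h :: "real^'n" assume "h \<in> {h. norm h \<le> \<epsilon>}"
    then show "(\<integral>\<^sup>+x. ennreal \<bar>t (x + h, c) - t (x, c)\<bar> \<partial>lebesgue)
        \<le> ennreal 3 * (\<integral>\<^sup>+z. indicator (UNIV \<times> S.layer \<epsilon>) z * ennreal (norm (G0 z)) \<partial>lborel)"
      using S.T_modulus_estimate[OF that, of h] by (simp add: t nn_integral_completion)
  qed
  have est: "(\<integral>\<^sup>+x. ennreal \<bar>t (x, bp) - t (x, bm)\<bar> \<partial>lebesgue)
          \<le> (\<integral>\<^sup>+x\<in>?\<Omega>. ennreal \<bar>G x \<bullet> (0, 1)\<bar> \<partial>lebesgue)"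
      "L1_modulus t c \<epsilon> \<le> ennreal 3 * (\<integral>\<^sup>+x\<in>boundary_layer bm bp \<epsilon>. ennreal (norm (G x)) \<partial>lebesgue)"
    if \<epsilon>: "0 < \<epsilon>" "\<epsilon> < bp - bm" and G: "has_weak_gradient ?\<Omega> u G" and c: "c \<in> {bm, bp}" for \<epsilon> G c
  proof -
    have "AE z in lebesgue. \<forall>i\<in>Basis. z \<in> ?\<Omega> \<longrightarrow> G z \<bullet> i = G0 z \<bullet> i"
      using GG0 G by (intro AE_finite_allI) (auto simp: has_weak_gradient_def)
    then have ae: "AE z in lebesgue. z \<in> ?\<Omega> \<longrightarrow> G z = G0 z"
      by eventually_elim (auto intro: euclidean_eqI)
    have "(\<integral>\<^sup>+x. ennreal \<bar>t (x, bp) - t (x, bm)\<bar> \<partial>lebesgue) \<le> (\<integral>\<^sup>+z. ennreal \<bar>S.g z\<bar> \<partial>lebesgue)"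
      using S.T_diff_estimate by (simp add: t nn_integral_completion)
    also have "\<dots> = (\<integral>\<^sup>+x\<in>?\<Omega>. ennreal \<bar>G x \<bullet> (0, 1)\<bar> \<partial>lebesgue)"
      by (rule nn_integral_cong_AE, use ae in eventually_elim)
        (use G0 in \<open>auto simp: S.g_def indicator_def\<close>)
    finally show "(\<integral>\<^sup>+x. ennreal \<bar>t (x, bp) - t (x, bm)\<bar> \<partial>lebesgue)
        \<le> (\<integral>\<^sup>+x\<in>?\<Omega>. ennreal \<bar>G x \<bullet> (0, 1)\<bar> \<partial>lebesgue)" .
    have lay: "boundary_layer bm bp \<epsilon> = (UNIV :: (real^'n) set) \<times> S.layer \<epsilon>"
      by (simp add: boundary_layer_def S.layer_def)
    have sub: "boundary_layer bm bp \<epsilon> \<subseteq> ?\<Omega>" using \<epsilon> by (auto simp: boundary_layer_def strip_def)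
    have "(\<integral>\<^sup>+z. indicator (UNIV \<times> S.layer \<epsilon>) z * ennreal (norm (G0 z)) \<partial>lebesgue) =
        (\<integral>\<^sup>+x\<in>boundary_layer bm bp \<epsilon>. ennreal (norm (G x)) \<partial>lebesgue)"
      unfolding lay[symmetric]
      by (rule nn_integral_cong_AE, use ae in eventually_elim)
        (use sub in \<open>auto simp: indicator_def\<close>)
    then show "L1_modulus t c \<epsilon> \<le> ennreal 3 * (\<integral>\<^sup>+x\<in>boundary_layer bm bp \<epsilon>. ennreal (norm (G x)) \<partial>lebesgue)"
      using modulus[OF \<epsilon> c] by (simp add: nn_integral_completion)
  qed
  have lim: "(L1_modulus t c \<longlongrightarrow> 0) (at_right 0)" if c: "c \<in> {bm, bp}" for c
  proof (rule tendsto_sandwich[where f = "\<lambda>_. 0" and h = "\<lambda>\<epsilon>. ennreal 3 *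
        (\<integral>\<^sup>+z. indicator (UNIV \<times> S.layer \<epsilon>) z * ennreal (norm (G0 z)) \<partial>lborel)"])
    show "((\<lambda>\<epsilon>. ennreal 3 * (\<integral>\<^sup>+z. indicator (UNIV \<times> S.layer \<epsilon>) z * ennreal (norm (G0 z)) \<partial>lborel)) \<longlongrightarrow> 0) (at_right 0)"
      using ennreal_tendsto_cmult[OF _ S.layer_integral_tendsto, of "ennreal 3"] by simp
    have "\<forall>\<^sub>F \<epsilon> in at_right 0. 0 < \<epsilon> \<and> \<epsilon> < bp - bm"
      using b by (auto simp: eventually_at_right_field intro!: exI[of _ "bp - bm"])
    then show "\<forall>\<^sub>F \<epsilon> in at_right 0. L1_modulus t c \<epsilon> \<le>
        ennreal 3 * (\<integral>\<^sup>+z. indicator (UNIV \<times> S.layer \<epsilon>) z * ennreal (norm (G0 z)) \<partial>lborel)"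
      by eventually_elim (use modulus c in blast)
  qed (auto intro: tendsto_const)
  show ?thesis
    by (intro exI[of _ t] conjI tf impI allI ballI) (use cont est lim in blast)+
qed

lemma trace_function_unique:
  fixes t t' :: "(real^'n) \<times> real \<Rightarrow> real"
  assumes b: "bm < bp" and u: "u \<in> W11_dot (strip bm bp)"
    and t: "trace_function bm bp u t" and t': "trace_function bm bp u t'"
  shows "AE x\<in>frontier (strip bm bp) in surface_measure. t x = t' x"
  unfolding AE_frontier_strip[OF b]
proof (rule ballI, rule boundary_integral_unique[OF b])
  \<comment> \<open>The last direction is the one in which the normal component is 1 or -1, so
    testing with it recovers both boundary integrals.\<close>
  let ?e = "(0, 1) :: (real^'n) \<times> real"
  have e: "?e \<in> Basis" by (simp add: Basis_prod_def)
  obtain g where g: "has_weak_partial (strip bm bp) ?e u g" using u e by (auto simp: W11_dot_def)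
  have L: "(\<lambda>x. t (x, c)) \<in> L1_loc lebesgue UNIV" "(\<lambda>x. t' (x, c)) \<in> L1_loc lebesgue UNIV"
    if "c \<in> {bm, bp}" for c
    using t t' that unfolding trace_function_def L1_loc_frontier_strip[OF b] by blast+
  then show "(\<lambda>x. t (x, c)) \<in> L1_loc lebesgue UNIV" "(\<lambda>x. t' (x, c)) \<in> L1_loc lebesgue UNIV"
    if "c \<in> {bm, bp}" for c using that by blast+
  fix \<psi> :: "(real^'n) \<times> real \<Rightarrow> real" assume \<psi>: "\<psi> \<in> C_c 1"
  have "(LINT x:frontier (strip bm bp)|surface_measure. \<psi> x * t x * (outward_unit_normal (strip bm bp) x \<bullet> ?e)) =
      (LINT x:frontier (strip bm bp)|surface_measure. \<psi> x * t' x * (outward_unit_normal (strip bm bp) x \<bullet> ?e))"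
  proof -
    have "(LINT x:strip bm bp|lebesgue. u x * frechet_derivative \<psi> (at x) ?e) =
        - (LINT x:strip bm bp|lebesgue. \<psi> x * g x) + (LINT x:frontier (strip bm bp)|surface_measure.
           \<psi> x * t x * (outward_unit_normal (strip bm bp) x \<bullet> ?e))"
      using t \<psi> e g unfolding trace_function_def by blast
    moreover have "(LINT x:strip bm bp|lebesgue. u x * frechet_derivative \<psi> (at x) ?e) =
        - (LINT x:strip bm bp|lebesgue. \<psi> x * g x) + (LINT x:frontier (strip bm bp)|surface_measure.
           \<psi> x * t' x * (outward_unit_normal (strip bm bp) x \<bullet> ?e))"
      using t' \<psi> e g unfolding trace_function_def by blast
    ultimately show ?thesis by simp
  qed
  then show "(\<integral>x. \<psi> (x, bp) * t (x, bp) \<partial>lebesgue) - (\<integral>x. \<psi> (x, bm) * t (x, bm) \<partial>lebesgue) =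
      (\<integral>x. \<psi> (x, bp) * t' (x, bp) \<partial>lebesgue) - (\<integral>x. \<psi> (x, bm) * t' (x, bm) \<partial>lebesgue)"
    using boundary_integral_strip[OF b \<psi> L(1), of ?e] boundary_integral_strip[OF b \<psi> L(2), of ?e] by simp
qed

lemma C_c_times_set_integrable:
  fixes g :: "'a::euclidean_space \<Rightarrow> real"
  assumes "\<psi> \<in> C_c 1" "set_integrable lebesgue \<Omega> g"
  shows "set_integrable lebesgue \<Omega> (\<lambda>x. \<psi> x * g x)"
proof -
  obtain C where C: "\<And>z. \<bar>\<psi> z\<bar> \<le> C" using C_c_bounded[OF assms(1)] by metis
  have "\<psi> \<in> borel_measurable lebesgue"
    using C_c_borel[OF assms(1)] by (intro measurable_completion) simp
  then have "integrable lebesgue (\<lambda>x. (indicator \<Omega> x *\<^sub>R g x) * \<psi> x)"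
    using assms(2) C unfolding set_integrable_def by (intro integrable_real_mult_bounded)
  then show ?thesis by (simp add: set_integrable_def mult_ac)
qed

text \<open>The weak partial derivative of the sum is given arbitrarily. Integrable weak partials of
  the summands are chosen, and uniqueness identifies their sum with the given one almost
  everywhere.\<close>

lemma trace_function_add:
  fixes t t' :: "(real^'n) \<times> real \<Rightarrow> real"
  assumes b: "bm < bp" and u: "u \<in> W11_dot (strip bm bp)" "v \<in> W11_dot (strip bm bp)"
    and t: "trace_function bm bp u t" and t': "trace_function bm bp v t'"
  shows "trace_function bm bp (\<lambda>x. u x + v x) (\<lambda>x. t x + t' x)"
  unfolding trace_function_def
proof (intro conjI ballI allI impI)
  show "(\<lambda>x. t x + t' x) \<in> L1_loc surface_measure (frontier (strip bm bp))"
    using t t' by (intro L1_loc_add) (auto simp: trace_function_def)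
  have L: "(\<lambda>x. t (x, c)) \<in> L1_loc lebesgue UNIV" "(\<lambda>x. t' (x, c)) \<in> L1_loc lebesgue UNIV"
    if "c \<in> {bm, bp}" for c
    using t t' that unfolding trace_function_def L1_loc_frontier_strip[OF b] by blast+
  fix \<psi> :: "(real^'n) \<times> real \<Rightarrow> real" and i :: "(real^'n) \<times> real" and g
  assume \<psi>: "\<psi> \<in> C_c 1" and i: "i \<in> Basis"
    and g: "has_weak_partial (strip bm bp) i (\<lambda>x. u x + v x) g"
  obtain gu where gu: "has_weak_partial (strip bm bp) i u gu" "set_integrable lebesgue (strip bm bp) gu"
    using u(1) i by (auto simp: W11_dot_def)
  obtain gv where gv: "has_weak_partial (strip bm bp) i v gv" "set_integrable lebesgue (strip bm bp) gv"
    using u(2) i by (auto simp: W11_dot_def)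
  let ?D = "\<lambda>x. frechet_derivative \<psi> (at x) i"
  let ?B = "\<lambda>t. LINT x:frontier (strip bm bp)|surface_measure. \<psi> x * t x * (outward_unit_normal (strip bm bp) x \<bullet> i)"
  have U: "set_integrable lebesgue (strip bm bp) (\<lambda>x. u x * ?D x)"
    "(LINT x:strip bm bp|lebesgue. u x * ?D x) = - (LINT x:strip bm bp|lebesgue. \<psi> x * gu x) + ?B t"
    using t \<psi> i gu(1) unfolding trace_function_def by blast+
  have V: "set_integrable lebesgue (strip bm bp) (\<lambda>x. v x * ?D x)"
    "(LINT x:strip bm bp|lebesgue. v x * ?D x) = - (LINT x:strip bm bp|lebesgue. \<psi> x * gv x) + ?B t'"
    using t' \<psi> i gv(1) unfolding trace_function_def by blast+
  show "set_integrable lebesgue (strip bm bp) (\<lambda>x. (u x + v x) * ?D x)"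
    using set_integral_add(1)[OF U(1) V(1)] by (simp add: distrib_right)
  have B: "?B (\<lambda>x. t x + t' x) = ?B t + ?B t'"
  proof -
    have S: "(\<lambda>x. t (x, c) + t' (x, c)) \<in> L1_loc lebesgue UNIV" if "c \<in> {bm, bp}" for c
      by (intro L1_loc_add L that)
    have I: "(\<integral>x. \<psi> (x, c) * (t (x, c) + t' (x, c)) \<partial>lebesgue) =
        (\<integral>x. \<psi> (x, c) * t (x, c) \<partial>lebesgue) + (\<integral>x. \<psi> (x, c) * t' (x, c) \<partial>lebesgue)" if "c \<in> {bm, bp}" for c
      using C_c_slice_times_integrable[OF \<psi> L(1)[OF that]] C_c_slice_times_integrable[OF \<psi> L(2)[OF that]]
      by (simp add: distrib_left)
    have "?B (\<lambda>x. t x + t' x) = snd i * ((\<integral>x. \<psi> (x, bp) * (t (x, bp) + t' (x, bp)) \<partial>lebesgue) -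
        (\<integral>x. \<psi> (x, bm) * (t (x, bm) + t' (x, bm)) \<partial>lebesgue))"
      by (rule boundary_integral_strip[OF b \<psi> S])
    also have "\<dots> = ?B t + ?B t'"
    proof -
      have b1: "?B t = snd i * ((\<integral>x. \<psi> (x, bp) * t (x, bp) \<partial>lebesgue) - (\<integral>x. \<psi> (x, bm) * t (x, bm) \<partial>lebesgue))"
        by (rule boundary_integral_strip[OF b \<psi> L(1)])
      have b2: "?B t' = snd i * ((\<integral>x. \<psi> (x, bp) * t' (x, bp) \<partial>lebesgue) - (\<integral>x. \<psi> (x, bm) * t' (x, bm) \<partial>lebesgue))"
        by (rule boundary_integral_strip[OF b \<psi> L(2)])
      have "bp \<in> {bm, bp}" "bm \<in> {bm, bp}" by simp_all
      then show ?thesis unfolding b1 b2 by (simp only: I) (simp add: algebra_simps)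
    qed
    finally show ?thesis .
  qed
  have "AE x in lebesgue. x \<in> strip bm bp \<longrightarrow> g x = gu x + gv x"
    by (rule has_weak_partial_unique[OF open_strip g has_weak_partial_add[OF gu(1) gv(1)]])
  then have "(LINT x:strip bm bp|lebesgue. \<psi> x * g x) = (LINT x:strip bm bp|lebesgue. \<psi> x * gu x + \<psi> x * gv x)"
    unfolding set_lebesgue_integral_def
  proof (intro integral_cong_AE)
    show m: "(\<lambda>x. indicator (strip bm bp) x *\<^sub>R (\<psi> x * gu x + \<psi> x * gv x)) \<in> borel_measurable lebesgue"
      using set_integral_add(1)[OF C_c_times_set_integrable[OF \<psi> gu(2)] C_c_times_set_integrable[OF \<psi> gv(2)]]
      unfolding set_integrable_def by (rule borel_measurable_integrable)
    assume ae: "AE x in lebesgue. x \<in> strip bm bp \<longrightarrow> g x = gu x + gv x"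
    then show ae': "AE x in lebesgue. indicator (strip bm bp) x *\<^sub>R (\<psi> x * g x) =
        indicator (strip bm bp) x *\<^sub>R (\<psi> x * gu x + \<psi> x * gv x)"
      by eventually_elim (auto simp: indicator_def distrib_left)
    then have "AE x in lebesgue. indicator (strip bm bp) x *\<^sub>R (\<psi> x * gu x + \<psi> x * gv x) =
        indicator (strip bm bp) x *\<^sub>R (\<psi> x * g x)"
      by eventually_elim (rule sym)
    then show "(\<lambda>x. indicator (strip bm bp) x *\<^sub>R (\<psi> x * g x)) \<in> borel_measurable lebesgue"
      by (rule completion_borel_measurable_AE[OF m])
  qed
  also have "\<dots> = (LINT x:strip bm bp|lebesgue. \<psi> x * gu x) + (LINT x:strip bm bp|lebesgue. \<psi> x * gv x)"
    by (rule set_integral_add(2)[OF C_c_times_set_integrable[OF \<psi> gu(2)] C_c_times_set_integrable[OF \<psi> gv(2)]])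
  finally show "(LINT x:strip bm bp|lebesgue. (u x + v x) * ?D x) =
      - (LINT x:strip bm bp|lebesgue. \<psi> x * g x) + ?B (\<lambda>x. t x + t' x)"
    using set_integral_add(2)[OF U(1) V(1)] U(2) V(2) B by (simp add: distrib_right)
qed

lemma has_weak_partial_cong_AE:
  assumes u: "u \<in> L1_loc lebesgue \<Omega>" and \<Omega>: "\<Omega> \<in> sets lebesgue" and uv: "AE x in lebesgue. x \<in> \<Omega> \<longrightarrow> u x = v x"
    and v: "has_weak_partial \<Omega> i v g"
  shows "has_weak_partial \<Omega> i u g"
  unfolding has_weak_partial_def
proof (intro conjI ballI)
  have L: "v \<in> L1_loc lebesgue \<Omega>" using v by (simp add: has_weak_partial_def)
  show "u \<in> L1_loc lebesgue \<Omega>" by fact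
  show "g \<in> L1_loc lebesgue \<Omega>" using v by (simp add: has_weak_partial_def)
  fix \<phi> assume \<phi>: "\<phi> \<in> test_functions \<Omega>"
  have "(LINT x:\<Omega>|lebesgue. u x * frechet_derivative \<phi> (at x) i) = (LINT x:\<Omega>|lebesgue. v x * frechet_derivative \<phi> (at x) i)"
    unfolding set_lebesgue_integral_def
  proof (rule integral_cong_AE)
    show "(\<lambda>x. indicator \<Omega> x *\<^sub>R (u x * frechet_derivative \<phi> (at x) i)) \<in> borel_measurable lebesgue"
      "(\<lambda>x. indicator \<Omega> x *\<^sub>R (v x * frechet_derivative \<phi> (at x) i)) \<in> borel_measurable lebesgue"
      using L1_loc_times_test_integrable'(2)[OF u \<phi>] L1_loc_times_test_integrable'(2)[OF L \<phi>]
      unfolding set_integrable_def by (auto dest: borel_measurable_integrable)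
    show "AE x in lebesgue. indicator \<Omega> x *\<^sub>R (u x * frechet_derivative \<phi> (at x) i) =
        indicator \<Omega> x *\<^sub>R (v x * frechet_derivative \<phi> (at x) i)"
      using uv by eventually_elim (auto simp: indicator_def)
  qed
  then show "(LINT x:\<Omega>|lebesgue. u x * frechet_derivative \<phi> (at x) i) = - (LINT x:\<Omega>|lebesgue. g x * \<phi> x)"
    using v \<phi> by (simp add: has_weak_partial_def)
qed

text \<open>Needed for the operator to be well defined on classes: u and v have the same weak
  derivatives and the same integrals, so a boundary function of u is one of v.\<close>

lemma trace_function_cong_AE:
  fixes t :: "(real^'n) \<times> real \<Rightarrow> real"
  assumes u: "u \<in> W11_dot (strip bm bp)" and v: "v \<in> W11_dot (strip bm bp)"
    and uv: "AE x in lebesgue. x \<in> strip bm bp \<longrightarrow> u x = v x" and t: "trace_function bm bp u t"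
  shows "trace_function bm bp v t"
  unfolding trace_function_def
proof (intro conjI ballI allI impI)
  show "t \<in> L1_loc surface_measure (frontier (strip bm bp))" using t by (simp add: trace_function_def)
  fix \<psi> :: "(real^'n) \<times> real \<Rightarrow> real" and i :: "(real^'n) \<times> real" and g
  assume \<psi>: "\<psi> \<in> C_c 1" and i: "i \<in> Basis" and g: "has_weak_partial (strip bm bp) i v g"
  have "has_weak_partial (strip bm bp) i u g"
    using u by (intro has_weak_partial_cong_AE[OF _ _ uv g]) (auto simp: W11_dot_def open_strip)
  then have U: "set_integrable lebesgue (strip bm bp) (\<lambda>x. u x * frechet_derivative \<psi> (at x) i)"
    "(LINT x:strip bm bp|lebesgue. u x * frechet_derivative \<psi> (at x) i) =
      - (LINT x:strip bm bp|lebesgue. \<psi> x * g x) + (LINT x:frontier (strip bm bp)|surface_measure.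
           \<psi> x * t x * (outward_unit_normal (strip bm bp) x \<bullet> i))"
    using t \<psi> i unfolding trace_function_def by blast+
  have ae: "AE x in lebesgue. indicator (strip bm bp) x *\<^sub>R (u x * frechet_derivative \<psi> (at x) i) =
      indicator (strip bm bp) x *\<^sub>R (v x * frechet_derivative \<psi> (at x) i)"
    using uv by eventually_elim (auto simp: indicator_def)
  have mu: "(\<lambda>x. indicator (strip bm bp) x *\<^sub>R (u x * frechet_derivative \<psi> (at x) i)) \<in> borel_measurable lebesgue"
    using U(1) unfolding set_integrable_def by (rule borel_measurable_integrable)
  have mv: "(\<lambda>x. indicator (strip bm bp) x *\<^sub>R (v x * frechet_derivative \<psi> (at x) i)) \<in> borel_measurable lebesgue"
    by (rule completion_borel_measurable_AE[OF mu ae])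
  show "set_integrable lebesgue (strip bm bp) (\<lambda>x. v x * frechet_derivative \<psi> (at x) i)"
    using U(1) integrable_cong_AE[OF mu mv ae] by (simp add: set_integrable_def)
  show "(LINT x:strip bm bp|lebesgue. v x * frechet_derivative \<psi> (at x) i) =
      - (LINT x:strip bm bp|lebesgue. \<psi> x * g x) + (LINT x:frontier (strip bm bp)|surface_measure.
           \<psi> x * t x * (outward_unit_normal (strip bm bp) x \<bullet> i))"
    using U(2) integral_cong_AE[OF mu mv ae] by (simp add: set_lebesgue_integral_def)
qed

lemma trace_function_cmult:
  fixes t :: "(real^'n) \<times> real \<Rightarrow> real"
  assumes u: "u \<in> W11_dot (strip bm bp)" and t: "trace_function bm bp u t"
  shows "trace_function bm bp (\<lambda>x. a * u x) (\<lambda>x. a * t x)"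
  unfolding trace_function_def
proof (intro conjI ballI allI impI)
  show "(\<lambda>x. a * t x) \<in> L1_loc surface_measure (frontier (strip bm bp))"
    using t by (intro L1_loc_cmult) (auto simp: trace_function_def)
  fix \<psi> :: "(real^'n) \<times> real \<Rightarrow> real" and i :: "(real^'n) \<times> real" and g
  assume \<psi>: "\<psi> \<in> C_c 1" and i: "i \<in> Basis" and g: "has_weak_partial (strip bm bp) i (\<lambda>x. a * u x) g"
  obtain gu where gu: "has_weak_partial (strip bm bp) i u gu" "set_integrable lebesgue (strip bm bp) gu"
    using u i by (auto simp: W11_dot_def)
  let ?D = "\<lambda>x. frechet_derivative \<psi> (at x) i"
  let ?B = "\<lambda>t. LINT x:frontier (strip bm bp)|surface_measure. \<psi> x * t x * (outward_unit_normal (strip bm bp) x \<bullet> i)"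
  have U: "set_integrable lebesgue (strip bm bp) (\<lambda>x. u x * ?D x)"
    "(LINT x:strip bm bp|lebesgue. u x * ?D x) = - (LINT x:strip bm bp|lebesgue. \<psi> x * gu x) + ?B t"
    using t \<psi> i gu(1) unfolding trace_function_def by blast+
  have aU: "(\<lambda>x. a * u x * ?D x) = (\<lambda>x. a * (u x * ?D x))" by (simp add: mult.assoc)
  show "set_integrable lebesgue (strip bm bp) (\<lambda>x. a * u x * ?D x)"
    unfolding aU using U(1) by simp
  have B: "?B (\<lambda>x. a * t x) = a * ?B t"
    by (simp add: mult_ac flip: set_integral_mult_right)
  have "AE x in lebesgue. x \<in> strip bm bp \<longrightarrow> g x = a * gu x"
    by (rule has_weak_partial_unique[OF open_strip g has_weak_partial_cmult[OF gu(1)]])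
  then have ae: "AE x in lebesgue. indicator (strip bm bp) x *\<^sub>R (a * (\<psi> x * gu x)) =
      indicator (strip bm bp) x *\<^sub>R (\<psi> x * g x)"
    by eventually_elim (auto simp: indicator_def)
  have m: "(\<lambda>x. indicator (strip bm bp) x *\<^sub>R (a * (\<psi> x * gu x))) \<in> borel_measurable lebesgue"
    using set_integrable_mult_right[OF C_c_times_set_integrable[OF \<psi> gu(2)], of a]
    unfolding set_integrable_def by (rule borel_measurable_integrable)
  have "(LINT x:strip bm bp|lebesgue. a * (\<psi> x * gu x)) = (LINT x:strip bm bp|lebesgue. \<psi> x * g x)"
    unfolding set_lebesgue_integral_def
    by (rule integral_cong_AE[OF m completion_borel_measurable_AE[OF m ae] ae])
  then have G: "(LINT x:strip bm bp|lebesgue. \<psi> x * g x) = a * (LINT x:strip bm bp|lebesgue. \<psi> x * gu x)"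
    by simp
  show "(LINT x:strip bm bp|lebesgue. a * u x * ?D x) =
      - (LINT x:strip bm bp|lebesgue. \<psi> x * g x) + ?B (\<lambda>x. a * t x)"
    unfolding aU B set_integral_mult_right U(2) G by (simp add: algebra_simps)
qed

theorem theorem1p6:
  shows "\<exists>c>0. \<forall>bm bp. bm < bp \<longrightarrow>
    (\<exists>Tr :: ((real^'n) \<times> real \<Rightarrow> real) \<Rightarrow> ((real^'n) \<times> real \<Rightarrow> real).
       is_trace_operator c bm bp Tr \<and>
       (\<forall>Tr'. (\<exists>c'>0. is_trace_operator c' bm bp Tr') \<longrightarrow>
          (\<forall>u\<in>W11_dot (strip bm bp).
             AE x\<in>frontier (strip bm bp) in surface_measure. Tr' u x = Tr u x)))"
proof (intro exI[of _ "3 :: real"] conjI allI impI)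
  fix bm bp :: real assume b: "bm < bp"
  let ?\<Omega> = "strip bm bp :: ((real^'n) \<times> real) set"
  define Q where "Q u t \<longleftrightarrow> trace_function bm bp u t \<and>
    (continuous_on (closure ?\<Omega>) u \<longrightarrow> (AE x\<in>frontier ?\<Omega> in surface_measure. t x = u x)) \<and>
    (\<forall>\<epsilon> G. 0 < \<epsilon> \<and> \<epsilon> < bp - bm \<and> has_weak_gradient ?\<Omega> u G \<longrightarrow>
        (\<integral>\<^sup>+x. ennreal \<bar>t (x, bp) - t (x, bm)\<bar> \<partial>lebesgue)
          \<le> (\<integral>\<^sup>+x\<in>?\<Omega>. ennreal \<bar>G x \<bullet> (0, 1)\<bar> \<partial>lebesgue) \<and>
        (\<forall>b\<in>{bm, bp}. L1_modulus t b \<epsilon>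
          \<le> ennreal 3 * (\<integral>\<^sup>+x\<in>boundary_layer bm bp \<epsilon>. ennreal (norm (G x)) \<partial>lebesgue))) \<and>
    (\<forall>b\<in>{bm, bp}. (L1_modulus t b \<longlongrightarrow> 0) (at_right 0))" for u t
  \<comment> \<open>The choice is made separately for each u and is linear only up to null sets.
    Linearity follows because sums and multiples of boundary functions are again boundary functions,
    and these are unique almost everywhere.\<close>
  define Tr where "Tr u = (SOME t. Q u t)" for u
  have Q: "Q u (Tr u)" if "u \<in> W11_dot ?\<Omega>" for u
  proof -
    have "\<exists>t. Q u t" using trace_exists[OF b that] unfolding Q_def .
    then show ?thesis unfolding Tr_def by (rule someI_ex)
  qed
  have tf: "trace_function bm bp u (Tr u)" if "u \<in> W11_dot ?\<Omega>" for u
    using Q[OF that] by (simp add: Q_def)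
  note uniq = trace_function_unique[OF b]
  have lin: "linear_operator lebesgue ?\<Omega> (W11_dot ?\<Omega>) surface_measure (frontier ?\<Omega>)
      (L1_loc surface_measure (frontier ?\<Omega>)) Tr"
    unfolding linear_operator_def
  proof (intro conjI ballI allI impI)
    fix u assume u: "u \<in> W11_dot ?\<Omega>"
    show "Tr u \<in> L1_loc surface_measure (frontier ?\<Omega>)"
      using tf[OF u] by (simp add: trace_function_def)
    show "AE y\<in>frontier ?\<Omega> in surface_measure. Tr (\<lambda>x. a * u x) y = a * Tr u y" for a
      by (rule uniq[OF W11_dot_cmult[OF u] tf[OF W11_dot_cmult[OF u]] trace_function_cmult[OF u tf[OF u]]])
    fix v assume v: "v \<in> W11_dot ?\<Omega>"
    show "AE y\<in>frontier ?\<Omega> in surface_measure. Tr u y = Tr v y"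
      if "AE x\<in>?\<Omega> in lebesgue. u x = v x"
      by (rule uniq[OF v trace_function_cong_AE[OF u v that tf[OF u]] tf[OF v]])
    show "AE y\<in>frontier ?\<Omega> in surface_measure. Tr (\<lambda>x. u x + v x) y = Tr u y + Tr v y"
      by (rule uniq[OF W11_dot_add[OF u v] tf[OF W11_dot_add[OF u v]] trace_function_add[OF b u v tf[OF u] tf[OF v]]])
  qed
  have is_tr: "is_trace_operator 3 bm bp Tr"
    unfolding is_trace_operator_def
  proof (intro conjI lin)
    show "trace_of_continuous bm bp Tr"
      using Q unfolding trace_of_continuous_def Q_def by blast
    show "trace_estimates 3 bm bp Tr"
      using Q unfolding trace_estimates_def Q_def by blast
    show "trace_L1_continuity bm bp Tr"
      using Q unfolding trace_L1_continuity_def Q_def by blast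
    show "trace_integration_by_parts bm bp Tr"
      using tf unfolding trace_integration_by_parts_def trace_function_def by blast
  qed
  \<comment> \<open>Any competing operator sends u to a function satisfying the same integration by
    parts formula, whatever its constant \<open>c'\<close>, so uniqueness for single functions
    applies.\<close>
  have "AE x\<in>frontier ?\<Omega> in surface_measure. Tr' u x = Tr u x"
    if Tr': "\<exists>c'>0. is_trace_operator c' bm bp Tr'" and u: "u \<in> W11_dot ?\<Omega>" for Tr' u
  proof (rule uniq[OF u _ tf[OF u]])
    show "trace_function bm bp u (Tr' u)"
      using Tr' u unfolding is_trace_operator_def linear_operator_def trace_integration_by_parts_def trace_function_def
      by blast
  qed
  with is_tr show "\<exists>Tr :: ((real^'n) \<times> real \<Rightarrow> real) \<Rightarrow> ((real^'n) \<times> real \<Rightarrow> real).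
       is_trace_operator 3 bm bp Tr \<and>
       (\<forall>Tr'. (\<exists>c'>0. is_trace_operator c' bm bp Tr') \<longrightarrow>
          (\<forall>u\<in>W11_dot (strip bm bp).
             AE x\<in>frontier (strip bm bp) in surface_measure. Tr' u x = Tr u x))"
    by blast
qed simp

end
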